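(* Let $A$ be a commutative ring and let $M$ be a noetherian $A$-module. Suppose that every artinian subquotient of $M$ has finite cardinality. Then the Cantor-Bendixson rank of $M$ coincides with its reduced length: $\text{CB-rk}(M)=\ell'(M)$.
   Context: All rings are commutative with unity. Cantor-Bendixson rank. For an $A$-module $M$, let $\text{Sub}_A(M)$ be the set of submodules of $M$, a closed subset of $2^M$ with the product topology. $\text{Quo}_A(M)$ is the set of quotients of $M$, topologized by identification with $\text{Sub}_A(M)$ via $K\leftrightarrow M/K$; in particular the point $M\in\text{Quo}_A(M)$ corresponds to $\{0\}\in\text{Sub}_A(M)$. For a topological space $X$, define by transfinite induction $I_0(X)$ as the set of isolated points of $X$, and $I_\alpha(X)=I_0\big(X-\bigcup_{\beta<\alpha}I_\beta(X)\big)$; for $x\in X$ set $\text{CB-rk}(x,X)=\alpha$ if $x\in I_\alpha(X)$ and $\text{CB-rk}(x,X)=\infty$ if $x\notin\bigcup_\alpha I_\alpha(X)$. Set $\text{CB-rk}(M)=\text{CB-rk}(M,\text{Quo}_A(M))$. Reduced length. For an $A$-module $M$, $\Lambda(M)$ is the submodule of those $m\in M$ such that $Am$ has finite length. For a prime ideal $\mathcal{P}$ of $A$ and a noetherian $A$-module $M$, set $\ell_{\mathcal{P}}(M)=\ell_{A_{\mathcal{P}}}(\Lambda(M\otimes_A A_{\mathcal{P}}))$, where $A_{\mathcal{P}}$ is the localization of $A$ at $\mathcal{P}$, $\Lambda$ is taken over $A_{\mathcal{P}}$, and $\ell_{A_{\mathcal{P}}}$ is the usual length of finite length $A_{\mathcal{P}}$-modules.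 A prime ideal $\mathcal{P}$ is conoetherian if $A/\mathcal{P}$ is noetherian; its coheight is then the ordinal defined inductively by $\text{coht}(\mathcal{P})=\sup\{\text{coht}(\mathcal{Q})+1\mid \mathcal{Q}\text{ prime ideal properly containing }\mathcal{P}\}$. For an ordinal $\alpha$ set $\ell_\alpha(M)=\sum\ell_{\mathcal{P}}(M)$, where $\mathcal{P}$ ranges over conoetherian prime ideals of $A$ of coheight $\alpha$ (only finitely many terms are nonzero). For an ordinal $\alpha$ let $\alpha'=\alpha+1$ if $\alpha<\omega$ and $\alpha'=\alpha$ otherwise. The reduced length of a noetherian $A$-module $M$ is the ordinal $\ell'(M)=\sum_\alpha\omega^\alpha\cdot\ell_{\alpha'}(M)$, where the (finite) sum is taken over ordinals in reverse (decreasing) order. *)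

theory Defs
  imports "HOL-Analysis.Analysis" "HOL-Algebra.Algebra" "HOL-Library.Extended_Nat"
begin

section \<open>Ordinals of bounded cardinality\<close>

text \<open>
  Order types of the well-orders whose field is a subset of the infinite type \<open>'x + nat\<close>, that is,
  all ordinals of cardinality at most that of \<open>'x + nat\<close>. Lemma \<open>ordinal_bounded\<close> below shows that
  every family of at most that many such ordinals is bounded, so the suprema that occur in the
  definitions below exist in the type.
\<close>

quotient_type 'x ordinal = "('x + nat) rel" / partial: "\<lambda>r s. (r, s) \<in> ordIso"
proof (rule part_equivpI)
  have "Well_order ({} :: ('x + nat) rel)"
    by (simp add: well_order_on_def linear_order_on_def partial_order_on_def preorder_on_def
        refl_on_def trans_def antisym_def total_on_def)
  then show "\<exists>r :: ('x + nat) rel. (r, r) \<in> ordIso"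
    by (intro exI) (rule ordIso_reflexive)
  show "symp (\<lambda>r s :: ('x + nat) rel. (r, s) \<in> ordIso)"
    by (rule sympI) (rule ordIso_symmetric)
  show "transp (\<lambda>r s :: ('x + nat) rel. (r, s) \<in> ordIso)"
    by (rule transpI) (rule ordIso_transitive)
qed

instantiation ordinal :: (type) wellorder
begin

lift_definition less_eq_ordinal :: "'a ordinal \<Rightarrow> 'a ordinal \<Rightarrow> bool"
  is "\<lambda>r s. (r, s) \<in> ordLeq"
proof -
  fix r r' s s' :: "('a + nat) rel"
  assume *: "(r, r') \<in> ordIso" "(s, s') \<in> ordIso"
  show "(r, s) \<in> ordLeq \<longleftrightarrow> (r', s') \<in> ordLeq"
  proof
    assume "(r, s) \<in> ordLeq"
    then show "(r', s') \<in> ordLeq"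
      by (rule ordLeq_ordIso_trans[OF ordIso_ordLeq_trans[OF ordIso_symmetric[OF *(1)]] *(2)])
  next
    assume "(r', s') \<in> ordLeq"
    then show "(r, s) \<in> ordLeq"
      by (rule ordLeq_ordIso_trans[OF ordIso_ordLeq_trans[OF *(1)] ordIso_symmetric[OF *(2)]])
  qed
qed

lift_definition less_ordinal :: "'a ordinal \<Rightarrow> 'a ordinal \<Rightarrow> bool"
  is "\<lambda>r s. (r, s) \<in> ordLess"
proof -
  fix r r' s s' :: "('a + nat) rel"
  assume *: "(r, r') \<in> ordIso" "(s, s') \<in> ordIso"
  show "(r, s) \<in> ordLess \<longleftrightarrow> (r', s') \<in> ordLess"
  proof
    assume "(r, s) \<in> ordLess"
    then show "(r', s') \<in> ordLess"
      by (rule ordLess_ordIso_trans[OF ordIso_ordLess_trans[OF ordIso_symmetric[OF *(1)]] *(2)])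
  next
    assume "(r', s') \<in> ordLess"
    then show "(r, s) \<in> ordLess"
      by (rule ordLess_ordIso_trans[OF ordIso_ordLess_trans[OF *(1)] ordIso_symmetric[OF *(2)]])
  qed
qed

lemma rep_ordinal_Well_order: "Well_order (rep_ordinal \<alpha>)"
  using Quotient_rep_reflp[OF Quotient_ordinal, of \<alpha>] unfolding ordIso_def by blast

lemma rep_ordinal_le: "\<alpha> \<le> \<beta> \<longleftrightarrow> (rep_ordinal \<alpha>, rep_ordinal \<beta>) \<in> ordLeq"
  by (simp only: less_eq_ordinal_def map_fun_apply id_apply)

lemma rep_ordinal_less: "\<alpha> < \<beta> \<longleftrightarrow> (rep_ordinal \<alpha>, rep_ordinal \<beta>) \<in> ordLess"
  by (simp only: less_ordinal_def map_fun_apply id_apply)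

lemma rep_ordinal_eq: "\<alpha> = \<beta> \<longleftrightarrow> (rep_ordinal \<alpha>, rep_ordinal \<beta>) \<in> ordIso"
  by (rule Quotient_rel_rep[OF Quotient_ordinal, symmetric])

instance
proof
  fix \<alpha> \<beta> \<gamma> :: "'a ordinal" and P :: "'a ordinal \<Rightarrow> bool"
  note WO = rep_ordinal_Well_order
  show le: "\<alpha> \<le> \<beta> \<or> \<beta> \<le> \<alpha>"
    unfolding rep_ordinal_le by (rule ordLeq_total[OF WO WO])
  have "\<not> \<beta> \<le> \<alpha> \<longleftrightarrow> \<alpha> < \<beta>"
    unfolding rep_ordinal_le rep_ordinal_less by (rule not_ordLeq_iff_ordLess[OF WO WO])
  then show "(\<alpha> < \<beta>) = (\<alpha> \<le> \<beta> \<and> \<not> \<beta> \<le> \<alpha>)"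
    using le by blast
  show "\<alpha> \<le> \<alpha>"
    unfolding rep_ordinal_le by (rule ordLeq_reflexive[OF WO])
  show "\<alpha> \<le> \<beta> \<Longrightarrow> \<beta> \<le> \<gamma> \<Longrightarrow> \<alpha> \<le> \<gamma>"
    unfolding rep_ordinal_le by (rule ordLeq_transitive)
  show "\<alpha> \<le> \<beta> \<Longrightarrow> \<beta> \<le> \<alpha> \<Longrightarrow> \<alpha> = \<beta>"
    unfolding rep_ordinal_le rep_ordinal_eq ordIso_iff_ordLeq by (rule conjI)
  have wf: "wf {(\<alpha>, \<beta> :: 'a ordinal). \<alpha> < \<beta>}"
  proof (rule wf_subset[OF wf_inv_image[OF wf_ordLess]])
    show "{(\<alpha>, \<beta> :: 'a ordinal). \<alpha> < \<beta>} \<subseteq> inv_image ordLess rep_ordinal"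
      unfolding rep_ordinal_less inv_image_def by (rule order.refl)
  qed
  assume step: "\<And>\<alpha>. (\<And>\<beta>. \<beta> < \<alpha> \<Longrightarrow> P \<beta>) \<Longrightarrow> P \<alpha>"
  show "P \<alpha>"
    by (rule wf_induct_rule[OF wf]) (rule step, simp only: mem_Collect_eq case_prod_conv)
qed

end

lemma abs_ordinal_cases:
  obtains r :: "('x + nat) rel" where "Well_order r" "\<alpha> = abs_ordinal r"
  by (metis that rep_ordinal_Well_order Quotient_abs_rep[OF Quotient_ordinal])

lemma abs_ordinal_less:
  "Well_order r \<Longrightarrow> Well_order s \<Longrightarrow> abs_ordinal r < abs_ordinal s \<longleftrightarrow> (r, s) \<in> ordLess"
  by (intro less_ordinal.abs_eq ordIso_reflexive)

lemma abs_ordinal_eq: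
  "Well_order r \<Longrightarrow> Well_order s \<Longrightarrow> abs_ordinal r = abs_ordinal s \<longleftrightarrow> (r, s) \<in> ordIso"
  using Quotient_rel[OF Quotient_ordinal, of r s] ordIso_reflexive[of r] ordIso_reflexive[of s]
  by simp

lemma ordinal_initial_segment:
  fixes r :: "('x + nat) rel"
  assumes r: "Well_order r"
  obtains f where "bij_betw f (Field r) {..<abs_ordinal r}"
    and "\<And>a b. a \<in> Field r \<Longrightarrow> b \<in> Field r \<Longrightarrow> (a, b) \<in> r \<longleftrightarrow> f a \<le> f b"
proof
  interpret w: wo_rel r
    using r by (simp add: wo_rel_def)
  define f where "f a = abs_ordinal (Restr r (underS r a))" for a
  have WO: "Well_order (Restr r (underS r a))" for a
    by (rule Well_order_Restr[OF r])
  have of: "w.ofilter (underS r a)" for a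
    by (rule w.underS_ofilter)
  have less: "f a < f b \<longleftrightarrow> underS r a \<subset> underS r b" for a b
    unfolding f_def using abs_ordinal_less[OF WO WO]
      ofilter_subset_ordLess[OF r of of] by simp
  have sub: "underS r a \<subset> underS r b" if "(a, b) \<in> r" "a \<noteq> b" for a b
    proof
    show "underS r a \<subseteq> underS r b"
      by (rule underS_incr[OF w.TRANS w.ANTISYM that(1)])
    show "underS r a \<noteq> underS r b"
      using that by (auto simp: underS_def)
  qed
  have mono: "f a < f b" if "(a, b) \<in> r" "a \<noteq> b" for a b
    using sub[OF that] less by simp
  show *: "(a, b) \<in> r \<longleftrightarrow> f a \<le> f b" if "a \<in> Field r" "b \<in> Field r" for a b
    proof (cases "a = b")
    case True
    then show ?thesis
      using w.REFL that by (simp add: refl_on_def)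
  next
    case False
    then have "(a, b) \<in> r \<or> (b, a) \<in> r"
      using w.TOTAL that by (simp add: total_on_def)
    then show ?thesis
      using mono[of a b] mono[of b a] False by auto
  qed
  show "bij_betw f (Field r) {..<abs_ordinal r}"
    unfolding bij_betw_def
  proof (intro conjI inj_onI equalityI subsetI)
    fix a b assume "a \<in> Field r" "b \<in> Field r" "f a = f b"
    then show "a = b"
      using mono[of a b] *[of a b] by auto
  next
    fix \<alpha> assume "\<alpha> \<in> f ` Field r"
    then show "\<alpha> \<in> {..<abs_ordinal r}"
      by (auto simp: f_def abs_ordinal_less[OF WO r] intro!: underS_Restr_ordLess[OF r])
  next
    fix \<alpha> assume "\<alpha> \<in> {..<abs_ordinal r}"
    moreover obtain s where s: "Well_order s" "\<alpha> = abs_ordinal s"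
      by (rule abs_ordinal_cases)
    ultimately obtain a where "a \<in> Field r" "(s, Restr r (underS r a)) \<in> ordIso"
      by (auto simp: abs_ordinal_less[OF s(1) r] ordLess_iff_ordIso_Restr[OF r s(1)])
    then show "\<alpha> \<in> f ` Field r"
      by (auto simp: f_def s(2) abs_ordinal_eq[OF s(1) WO])
  qed
qed

lemma ordinal_segment_card: "|{..<\<alpha> :: 'x ordinal}| \<le>o |UNIV :: ('x + nat) set|"
proof -
  obtain r :: "('x + nat) rel" where r: "Well_order r" "\<alpha> = abs_ordinal r"
    by (rule abs_ordinal_cases)
  obtain f where "bij_betw f (Field r) {..<\<alpha>}"
    unfolding r(2) by (rule ordinal_initial_segment[OF r(1)])
  then have "{..<\<alpha>} = f ` Field r"
    by (simp add: bij_betw_imp_surj_on)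
  then show ?thesis
    using ordLeq_transitive[OF card_of_image card_of_mono1[OF subset_UNIV]] by simp
qed

theorem ordinal_bounded:
  fixes S :: "'x ordinal set"
  assumes "|S| \<le>o |UNIV :: ('x + nat) set|"
  shows "\<exists>\<gamma>. \<forall>\<beta>\<in>S. \<beta> < \<gamma>"
proof (rule ccontr)
  assume "\<not> ?thesis"
  then have U: "(UNIV :: 'x ordinal set) = (\<Union>\<beta>\<in>S. {..\<beta>})"
    by (force simp: not_less)
  have inf: "infinite (UNIV :: ('x + nat) set)"
    by simp
  have "|{..\<beta>}| \<le>o |UNIV :: ('x + nat) set|" for \<beta> :: "'x ordinal"
  proof -
    have "|{\<beta>}| \<le>o |UNIV :: ('x + nat) set|"
      by (rule card_of_ordLeqI[of "\<lambda>_. undefined"]) simp_all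
    then have "|{..<\<beta>} \<union> {\<beta>}| \<le>o |UNIV :: ('x + nat) set|"
      using card_of_Un_ordLeq_infinite[OF inf ordinal_segment_card] by blast
    moreover have "{..<\<beta>} \<union> {\<beta>} = {..\<beta>}"
      by auto
    ultimately show ?thesis
      by simp
  qed
  then have "|UNIV :: 'x ordinal set| \<le>o |UNIV :: ('x + nat) set|"
    unfolding U using card_of_UNION_ordLeq_infinite[OF inf assms] by blast
  then obtain h :: "'x ordinal \<Rightarrow> 'x + nat" where h: "inj h"
    using card_of_ordLeq[of "UNIV :: 'x ordinal set" "UNIV :: ('x + nat) set"] by auto
  define W where "W = {(\<alpha>, \<beta> :: 'x ordinal). \<alpha> \<le> \<beta>}"
  have FW: "Field W = UNIV"
    by (auto simp: W_def Field_def)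
  have "wf (W - Id)"
    by (rule wf_subset[OF wf]) (auto simp: W_def)
  then have W: "Well_order W"
    by (auto simp: FW well_order_on_def linear_order_on_def partial_order_on_def preorder_on_def
        refl_on_def trans_def antisym_def total_on_def) (auto simp: W_def)
  define r where "r = dir_image W h"
  have r: "Well_order r" "(W, r) \<in> ordIso"
    using Well_order_dir_image[OF W] dir_image_ordIso[OF W] h FW
    by (auto simp: r_def intro: inj_on_subset)
  obtain f where f: "bij_betw f (Field r) {..<abs_ordinal r}"
    "\<And>a b. a \<in> Field r \<Longrightarrow> b \<in> Field r \<Longrightarrow> (a, b) \<in> r \<longleftrightarrow> f a \<le> f b"
    by (rule ordinal_initial_segment[OF r(1)], rule that)
  have uS: "underS W (abs_ordinal r) = {..<abs_ordinal r}"
    by (auto simp: underS_def W_def)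
  have WR: "Well_order (Restr W {..<abs_ordinal r})"
    by (rule Well_order_Restr[OF W])
  have FR: "Field (Restr W {..<abs_ordinal r}) = {..<abs_ordinal r}"
    by (auto simp: W_def Field_def)
  have "BNF_Wellorder_Embedding.iso r (Restr W {..<abs_ordinal r}) f"
    unfolding iso_iff2 FR using f bij_betwE[OF f(1)] by (auto simp: W_def)
  then have "(r, Restr W {..<abs_ordinal r}) \<in> ordIso"
    using r(1) WR unfolding ordIso_def by blast
  then have "(r, W) \<in> ordLess"
    unfolding ordLess_iff_ordIso_Restr[OF W r(1)] FW using uS by (intro bexI[of _ "abs_ordinal r"]) simp_all
  then show False
    using not_ordLess_ordIso[of r W] ordIso_symmetric[OF r(2)] by simp
qed


definition osup :: "'o::wellorder set \<Rightarrow> 'o"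
  where "osup S = (LEAST \<gamma>. \<forall>\<beta>\<in>S. \<beta> \<le> \<gamma>)"

definition osuc :: "'o::wellorder \<Rightarrow> 'o"
  where "osuc \<alpha> = (LEAST \<beta>. \<alpha> < \<beta>)"

text \<open>
  Addition, multiplication and powers of \<open>\<omega>\<close>. Each recursion treats zero, successors and
  limits uniformly, by taking suprema over all smaller values of the second argument; the empty
  supremum is \<open>0\<close>.
\<close>

instantiation ordinal :: (type) "{zero, plus, times}"
begin

definition zero_ordinal :: "'a ordinal"
  where "(0 :: 'a ordinal) = osup {}"

function plus_ordinal :: "'a ordinal \<Rightarrow> 'a ordinal \<Rightarrow> 'a ordinal"
  where "\<alpha> + (\<beta> :: 'a ordinal) = osup (insert \<alpha> ((\<lambda>\<gamma>. osuc (\<alpha> + \<gamma>)) ` {..<\<beta>}))"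
  by pat_completeness auto
termination
  by (relation "inv_image {(\<alpha>, \<beta>). \<alpha> < \<beta>} snd") (rule wf_inv_image[OF wf], simp)

declare plus_ordinal.simps [simp del]

function times_ordinal :: "'a ordinal \<Rightarrow> 'a ordinal \<Rightarrow> 'a ordinal"
  where "\<alpha> * (\<beta> :: 'a ordinal) = osup ((\<lambda>\<gamma>. \<alpha> * \<gamma> + \<alpha>) ` {..<\<beta>})"
  by pat_completeness auto
termination
  by (relation "inv_image {(\<alpha>, \<beta>). \<alpha> < \<beta>} snd") (rule wf_inv_image[OF wf], simp)

declare times_ordinal.simps [simp del]

instance ..

end

definition ord_of_nat :: "nat \<Rightarrow> 'x ordinal"
  where "ord_of_nat n = (osuc ^^ n) 0"

definition omega :: "'x ordinal"
  where "omega = osup (range ord_of_nat)"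

function omega_power :: "'x ordinal \<Rightarrow> 'x ordinal"
  where "omega_power \<alpha> = osup (insert (ord_of_nat 1) ((\<lambda>\<beta>. omega_power \<beta> * omega) ` {..<\<alpha>}))"
  by pat_completeness auto
termination
  by (relation "{(\<alpha>, \<beta>). \<alpha> < \<beta>}") (rule wf, simp)

declare omega_power.simps [simp del]

subsection \<open>The usual recursion equations\<close>

lemma osup_least: "(\<And>\<beta>. \<beta> \<in> S \<Longrightarrow> \<beta> \<le> \<gamma>) \<Longrightarrow> osup S \<le> (\<gamma> :: 'o::wellorder)"
  unfolding osup_def by (rule Least_le) blast

lemma osup_upper:
  fixes S :: "'x ordinal set"
  assumes "|S| \<le>o |UNIV :: ('x + nat) set|" and "\<beta> \<in> S"
  shows "\<beta> \<le> osup S"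
proof -
  obtain \<gamma> where "\<forall>\<beta>\<in>S. \<beta> < \<gamma>"
    using ordinal_bounded[OF assms(1)] by blast
  then have "\<forall>\<beta>\<in>S. \<beta> \<le> \<gamma>"
    using less_imp_le by blast
  then have "\<forall>\<beta>\<in>S. \<beta> \<le> osup S"
    unfolding osup_def by (rule LeastI)
  then show ?thesis
    using assms(2) by blast
qed

lemma osuc_le_iff: "osuc \<alpha> \<le> \<beta> \<longleftrightarrow> \<alpha> < (\<beta> :: 'x ordinal)"
proof
  have "|{\<alpha>}| \<le>o |UNIV :: ('x + nat) set|"
    by (rule card_of_ordLeqI[of "\<lambda>_. undefined"]) simp_all
  then obtain \<gamma> where "\<alpha> < \<gamma>"
    using ordinal_bounded by blast
  then have "\<alpha> < osuc \<alpha>"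
    unfolding osuc_def by (rule LeastI)
  then show "osuc \<alpha> \<le> \<beta> \<Longrightarrow> \<alpha> < \<beta>"
    by (rule less_le_trans)
  show "\<alpha> < \<beta> \<Longrightarrow> osuc \<alpha> \<le> \<beta>"
    unfolding osuc_def by (rule Least_le)
qed

lemma less_osuc_iff: "\<beta> < osuc \<alpha> \<longleftrightarrow> \<beta> \<le> (\<alpha> :: 'x ordinal)"
  using osuc_le_iff[of \<alpha> \<beta>] by (metis not_less)

lemma osuc_mono: "\<alpha> \<le> \<beta> \<Longrightarrow> osuc \<alpha> \<le> osuc (\<beta> :: 'x ordinal)"
  by (meson less_osuc_iff osuc_le_iff order_trans order_refl)

lemma osup_segment_upper:
  fixes f :: "'x ordinal \<Rightarrow> 'x ordinal"
  assumes "\<gamma> < \<beta>"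
  shows "f \<gamma> \<le> osup (f ` {..<\<beta>})" "f \<gamma> \<le> osup (insert \<alpha> (f ` {..<\<beta>}))"
    "\<alpha> \<le> osup (insert \<alpha> (f ` {..<\<beta>}))"
proof -
  have inf: "infinite (UNIV :: ('x + nat) set)"
    by simp
  have 1: "|f ` {..<\<beta>}| \<le>o |UNIV :: ('x + nat) set|"
    by (rule ordLeq_transitive[OF card_of_image ordinal_segment_card])
  have "|{\<alpha>}| \<le>o |UNIV :: ('x + nat) set|"
    by (rule card_of_ordLeqI[of "\<lambda>_. undefined"]) simp_all
  then have 2: "|insert \<alpha> (f ` {..<\<beta>})| \<le>o |UNIV :: ('x + nat) set|"
    using card_of_Un_ordLeq_infinite[OF inf _ 1, of "{\<alpha>}"] by simp
  show "f \<gamma> \<le> osup (f ` {..<\<beta>})"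
    by (rule osup_upper[OF 1]) (use assms in auto)
  show "f \<gamma> \<le> osup (insert \<alpha> (f ` {..<\<beta>}))" "\<alpha> \<le> osup (insert \<alpha> (f ` {..<\<beta>}))"
    by (rule osup_upper[OF 2]; use assms in auto)+
qed

lemma ordinal_zero_le: "0 \<le> (\<alpha> :: 'x ordinal)"
  unfolding zero_ordinal_def by (rule osup_least) simp

lemma lessThan_zero_ordinal: "{..<0 :: 'x ordinal} = {}"
  using ordinal_zero_le by (auto simp: not_less[symmetric])

lemma osup_singleton: "osup {\<alpha> :: 'x ordinal} = \<alpha>"
proof (rule antisym)
  have "|{\<alpha>}| \<le>o |UNIV :: ('x + nat) set|"
    by (rule card_of_ordLeqI[of "\<lambda>_. undefined"]) simp_all
  then show "\<alpha> \<le> osup {\<alpha>}"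
    by (rule osup_upper) simp
qed (rule osup_least, simp)

lemma ordinal_add_0: "\<alpha> + 0 = (\<alpha> :: 'x ordinal)"
  by (subst plus_ordinal.simps) (simp add: lessThan_zero_ordinal osup_singleton)

lemma ordinal_add_less: "\<gamma> < \<beta> \<Longrightarrow> \<alpha> + \<gamma> < \<alpha> + (\<beta> :: 'x ordinal)"
  by (subst osuc_le_iff[symmetric], subst (2) plus_ordinal.simps) (rule osup_segment_upper)

lemma ordinal_le_add: "\<alpha> \<le> \<alpha> + (\<beta> :: 'x ordinal)"
proof (cases "\<beta> = 0")
  case False
  then have "\<alpha> + 0 < \<alpha> + \<beta>"
    using ordinal_zero_le[of \<beta>] by (intro ordinal_add_less) simp
  then show ?thesis
    by (simp add: ordinal_add_0)
qed (simp add: ordinal_add_0)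

lemma ordinal_add_osuc: "\<alpha> + osuc \<beta> = osuc (\<alpha> + \<beta> :: 'x ordinal)"
proof (rule antisym)
  have "\<alpha> + \<gamma> \<le> \<alpha> + \<beta>" if "\<gamma> \<le> \<beta>" for \<gamma>
    using that ordinal_add_less[of \<gamma> \<beta> \<alpha>] by (auto simp: le_less)
  then show "\<alpha> + osuc \<beta> \<le> osuc (\<alpha> + \<beta>)"
    using ordinal_le_add[of \<alpha> \<beta>]
    by (subst plus_ordinal.simps, intro osup_least)
      (auto simp: less_osuc_iff intro: osuc_mono dest: less_osuc_iff[THEN iffD2] less_imp_le)
  show "osuc (\<alpha> + \<beta>) \<le> \<alpha> + osuc \<beta>"
    by (simp add: osuc_le_iff ordinal_add_less less_osuc_iff)
qed

lemma ordinal_add_limit: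
  assumes "\<kappa> \<noteq> 0" and "\<And>\<gamma>. \<gamma> < \<kappa> \<Longrightarrow> osuc \<gamma> < \<kappa>"
  shows "\<alpha> + \<kappa> = osup ((\<lambda>\<gamma>. \<alpha> + \<gamma>) ` {..<\<kappa> :: 'x ordinal})"
proof (rule antisym)
  have "0 < \<kappa>"
    using assms(1) ordinal_zero_le[of \<kappa>] by simp
  then have "\<alpha> \<le> osup ((\<lambda>\<gamma>. \<alpha> + \<gamma>) ` {..<\<kappa>})"
    using osup_segment_upper(1)[of 0 \<kappa> "\<lambda>\<gamma>. \<alpha> + \<gamma>"] by (simp add: ordinal_add_0)
  moreover have "osuc (\<alpha> + \<gamma>) \<le> osup ((\<lambda>\<gamma>. \<alpha> + \<gamma>) ` {..<\<kappa>})" if "\<gamma> < \<kappa>" for \<gamma>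
    using osup_segment_upper(1)[OF assms(2)[OF that], of "\<lambda>\<gamma>. \<alpha> + \<gamma>"]
    by (simp add: ordinal_add_osuc)
  ultimately show "\<alpha> + \<kappa> \<le> osup ((\<lambda>\<gamma>. \<alpha> + \<gamma>) ` {..<\<kappa>})"
    by (subst plus_ordinal.simps, intro osup_least) auto
  show "osup ((\<lambda>\<gamma>. \<alpha> + \<gamma>) ` {..<\<kappa>}) \<le> \<alpha> + \<kappa>"
    by (rule osup_least) (auto intro: less_imp_le ordinal_add_less)
qed

lemma ordinal_zero_add: "0 + \<alpha> = (\<alpha> :: 'x ordinal)"
proof (induction \<alpha> rule: less_induct)
  case (less \<alpha>)
  have "0 + \<alpha> = osup (insert 0 (osuc ` {..<\<alpha>}))"
    by (subst plus_ordinal.simps) (simp add: less.IH)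
  also have "\<dots> = \<alpha>"
  proof (rule antisym)
    show "osup (insert 0 (osuc ` {..<\<alpha>})) \<le> \<alpha>"
      by (rule osup_least) (auto simp: osuc_le_iff ordinal_zero_le)
    show "\<alpha> \<le> osup (insert 0 (osuc ` {..<\<alpha>}))"
    proof (rule ccontr)
      assume "\<not> ?thesis"
      then have "osup (insert 0 (osuc ` {..<\<alpha>})) < \<alpha>"
        by simp
      then have "osuc (osup (insert 0 (osuc ` {..<\<alpha>}))) \<le> osup (insert 0 (osuc ` {..<\<alpha>}))"
        by (rule osup_segment_upper)
      then show False
        by (simp add: osuc_le_iff)
    qed
  qed
  finally show ?case .
qed

lemma ordinal_add_left_mono: "\<alpha> \<le> \<beta> \<Longrightarrow> \<alpha> + \<gamma> \<le> \<beta> + (\<gamma> :: 'x ordinal)"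
proof (induction \<gamma> rule: less_induct)
  case (less \<gamma>)
  have "osuc (\<alpha> + \<delta>) \<le> \<beta> + \<gamma>" if "\<delta> < \<gamma>" for \<delta>
    using less.IH[OF that less.prems] ordinal_add_less[OF that, of \<beta>] by (simp add: osuc_le_iff)
  moreover have "\<alpha> \<le> \<beta> + \<gamma>"
    using less.prems ordinal_le_add[of \<beta> \<gamma>] by simp
  ultimately show ?case
    by (subst plus_ordinal.simps, intro osup_least) auto
qed

lemma ordinal_mult_0: "\<alpha> * 0 = (0 :: 'x ordinal)"
  by (subst times_ordinal.simps, subst lessThan_zero_ordinal)
    (simp only: image_empty zero_ordinal_def)

lemma ordinal_mult_add_le: "\<gamma> < \<beta> \<Longrightarrow> \<alpha> * \<gamma> + \<alpha> \<le> \<alpha> * (\<beta> :: 'x ordinal)"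
  by (subst (2) times_ordinal.simps) (rule osup_segment_upper)

lemma ordinal_mult_mono: "\<gamma> \<le> \<beta> \<Longrightarrow> \<alpha> * \<gamma> \<le> \<alpha> * (\<beta> :: 'x ordinal)"
  using ordinal_mult_add_le[of \<gamma> \<beta> \<alpha>] ordinal_le_add[of "\<alpha> * \<gamma>" \<alpha>]
  by (metis le_less order_trans)

lemma ordinal_mult_osuc: "\<alpha> * osuc \<beta> = \<alpha> * \<beta> + (\<alpha> :: 'x ordinal)"
proof (rule antisym)
  show "\<alpha> * osuc \<beta> \<le> \<alpha> * \<beta> + \<alpha>"
    by (subst times_ordinal.simps, intro osup_least)
      (auto simp: less_osuc_iff intro!: ordinal_add_left_mono ordinal_mult_mono)
  show "\<alpha> * \<beta> + \<alpha> \<le> \<alpha> * osuc \<beta>"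
    by (simp add: ordinal_mult_add_le less_osuc_iff)
qed

lemma ordinal_mult_limit:
  assumes "\<And>\<gamma>. \<gamma> < \<kappa> \<Longrightarrow> osuc \<gamma> < \<kappa>"
  shows "\<alpha> * \<kappa> = osup ((\<lambda>\<gamma>. \<alpha> * \<gamma>) ` {..<\<kappa> :: 'x ordinal})"
proof (rule antisym)
  have "\<alpha> * \<gamma> + \<alpha> \<le> osup ((\<lambda>\<gamma>. \<alpha> * \<gamma>) ` {..<\<kappa>})" if "\<gamma> < \<kappa>" for \<gamma>
    using osup_segment_upper(1)[OF assms[OF that], of "\<lambda>\<gamma>. \<alpha> * \<gamma>"]
    by (simp add: ordinal_mult_osuc)
  then show "\<alpha> * \<kappa> \<le> osup ((\<lambda>\<gamma>. \<alpha> * \<gamma>) ` {..<\<kappa>})"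
    by (subst times_ordinal.simps, intro osup_least) auto
  show "osup ((\<lambda>\<gamma>. \<alpha> * \<gamma>) ` {..<\<kappa>}) \<le> \<alpha> * \<kappa>"
    by (rule osup_least) (auto intro: less_imp_le ordinal_mult_mono)
qed

lemma ordinal_mult_left_mono: "\<alpha> \<le> \<beta> \<Longrightarrow> \<alpha> * \<gamma> \<le> \<beta> * (\<gamma> :: 'x ordinal)"
proof (induction \<gamma> rule: less_induct)
  case (less \<gamma>)
  have add: "\<delta> + \<alpha> \<le> \<delta> + \<beta>" for \<delta>
    using less.prems ordinal_add_less[of \<alpha> \<beta> \<delta>] by (auto simp: le_less)
  have "\<alpha> * \<delta> + \<alpha> \<le> \<beta> * \<gamma>" if "\<delta> < \<gamma>" for \<delta>
    using ordinal_add_left_mono[OF less.IH[OF that less.prems], of \<alpha>] add[of "\<beta> * \<delta>"]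
      ordinal_mult_add_le[OF that, of \<beta>] by simp
  then show ?case
    by (subst times_ordinal.simps, intro osup_least) auto
qed

lemma omega_power_0: "omega_power 0 = (ord_of_nat 1 :: 'x ordinal)"
  by (subst omega_power.simps) (simp add: lessThan_zero_ordinal osup_singleton)

lemma omega_power_mult_le: "\<beta> < \<alpha> \<Longrightarrow> omega_power \<beta> * omega \<le> omega_power (\<alpha> :: 'x ordinal)"
  by (subst (2) omega_power.simps) (rule osup_segment_upper)

lemma ord_of_nat_less_omega: "ord_of_nat n < (omega :: 'x ordinal)"
proof -
  have "|range ord_of_nat :: 'x ordinal set| \<le>o |UNIV :: nat set|"
    by (rule card_of_image)
  moreover have "|UNIV :: nat set| \<le>o |UNIV :: ('x + nat) set|"
    by (rule card_of_ordLeqI[of Inr]) simp_all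
  ultimately have "|range ord_of_nat :: 'x ordinal set| \<le>o |UNIV :: ('x + nat) set|"
    by (rule ordLeq_transitive)
  then have "ord_of_nat (Suc n) \<le> (omega :: 'x ordinal)"
    unfolding omega_def by (rule osup_upper) simp
  then show ?thesis
    by (simp add: ord_of_nat_def osuc_le_iff)
qed

lemma one_le_omega_power: "ord_of_nat 1 \<le> omega_power (\<alpha> :: 'x ordinal)"
proof (cases "\<alpha> = 0")
  case False
  then have "0 < \<alpha>"
    using ordinal_zero_le[of \<alpha>] by simp
  then show ?thesis
    by (subst omega_power.simps) (rule osup_segment_upper)
qed (simp add: omega_power_0)

lemma omega_power_le_mult: "omega_power \<alpha> \<le> omega_power \<alpha> * (omega :: 'x ordinal)"
proof -
  have "0 < (omega :: 'x ordinal)"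
    using ord_of_nat_less_omega[of 0] by (simp add: ord_of_nat_def)
  then have "omega_power \<alpha> * 0 + omega_power \<alpha> \<le> omega_power \<alpha> * (omega :: 'x ordinal)"
    by (rule ordinal_mult_add_le)
  moreover have "omega_power \<alpha> \<le> omega_power \<alpha> * 0 + (omega_power \<alpha> :: 'x ordinal)"
    using ordinal_add_left_mono[OF ordinal_zero_le, of "omega_power \<alpha>" 0] ordinal_zero_add[of "omega_power \<alpha>"]
    by (simp add: ordinal_mult_0)
  ultimately show ?thesis
    by (rule order_trans[rotated])
qed

lemma omega_power_mono: "\<beta> \<le> \<alpha> \<Longrightarrow> omega_power \<beta> \<le> omega_power (\<alpha> :: 'x ordinal)"
  using one_le_omega_power[of \<alpha>]
  by (subst omega_power.simps, intro osup_least)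
    (auto intro: omega_power_mult_le less_le_trans)

lemma omega_power_osuc: "omega_power (osuc \<alpha>) = omega_power \<alpha> * (omega :: 'x ordinal)"
proof (rule antisym)
  have "ord_of_nat 1 \<le> omega_power \<alpha> * (omega :: 'x ordinal)"
    using one_le_omega_power[of \<alpha>] omega_power_le_mult[of \<alpha>] by (rule order_trans)
  then show "omega_power (osuc \<alpha>) \<le> omega_power \<alpha> * omega"
    by (subst omega_power.simps, intro osup_least)
      (auto simp: less_osuc_iff intro!: ordinal_mult_left_mono omega_power_mono)
  show "omega_power \<alpha> * omega \<le> omega_power (osuc \<alpha>)"
    by (rule omega_power_mult_le) (simp add: less_osuc_iff)
qed

lemma omega_power_limit:
  assumes "\<kappa> \<noteq> 0" and "\<And>\<gamma>. \<gamma> < \<kappa> \<Longrightarrow> osuc \<gamma> < \<kappa>"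
  shows "omega_power \<kappa> = osup (omega_power ` {..<\<kappa> :: 'x ordinal})"
proof (rule antisym)
  have "0 < \<kappa>"
    using assms(1) ordinal_zero_le[of \<kappa>] by simp
  then have "ord_of_nat 1 \<le> osup (omega_power ` {..<\<kappa>})"
    using osup_segment_upper(1)[of 0 \<kappa> omega_power] by (simp add: omega_power_0)
  moreover have "omega_power \<gamma> * omega \<le> osup (omega_power ` {..<\<kappa>})" if "\<gamma> < \<kappa>" for \<gamma>
    using osup_segment_upper(1)[OF assms(2)[OF that], of omega_power]
    by (simp add: omega_power_osuc)
  ultimately show "omega_power \<kappa> \<le> osup (omega_power ` {..<\<kappa>})"
    by (subst omega_power.simps, intro osup_least) auto
  show "osup (omega_power ` {..<\<kappa>}) \<le> omega_power \<kappa>"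
    by (rule osup_least) (auto intro: less_imp_le omega_power_mono)
qed


section \<open>Modules\<close>

text \<open>
  Module records carry a multiplication and a unit inherited from rings; they play no role for
  modules and are left unspecified in the constructions below.
\<close>

definition noetherian_module :: "('a, 'r) ring_scheme \<Rightarrow> ('a, 'm, 'e) module_scheme \<Rightarrow> bool"
  where "noetherian_module R M \<longleftrightarrow>
    (\<forall>N :: nat \<Rightarrow> 'm set. (\<forall>i. submodule (N i) R M \<and> N i \<subseteq> N (Suc i)) \<longrightarrow>
      (\<exists>n. \<forall>i\<ge>n. N i = N n))"

definition artinian_module :: "('a, 'r) ring_scheme \<Rightarrow> ('a, 'm, 'e) module_scheme \<Rightarrow> bool"
  where "artinian_module R M \<longleftrightarrow>
    (\<forall>N :: nat \<Rightarrow> 'm set. (\<forall>i. submodule (N i) R M \<and> N (Suc i) \<subseteq> N i) \<longrightarrow>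
      (\<exists>n. \<forall>i\<ge>n. N i = N n))"

definition quotient_module :: "('a, 'm, 'e) module_scheme \<Rightarrow> 'm set \<Rightarrow> ('a, 'm set) module"
  where "quotient_module M K =
    \<lparr>carrier = a_rcosets\<^bsub>M\<^esub> K, monoid.mult = undefined, monoid.one = undefined,
     ring.zero = K, ring.add = set_add M, smult = (\<lambda>a C. \<Union>x\<in>C. K +>\<^bsub>M\<^esub> (a \<odot>\<^bsub>M\<^esub> x))\<rparr>"

definition module_length :: "('a, 'r) ring_scheme \<Rightarrow> ('a, 'm, 'e) module_scheme \<Rightarrow> enat"
  where "module_length R M =
    (SUP n\<in>{n. \<exists>N :: nat \<Rightarrow> 'm set.
      (\<forall>i\<le>n. submodule (N i) R M) \<and> (\<forall>i<n. N i \<subset> N (Suc i))}. enat n)"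

definition cyclic_submodule :: "('a, 'r) ring_scheme \<Rightarrow> ('a, 'm, 'e) module_scheme \<Rightarrow> 'm \<Rightarrow> 'm set"
  where "cyclic_submodule R M m = (\<lambda>a. a \<odot>\<^bsub>M\<^esub> m) ` carrier R"

definition finite_length_part :: "('a, 'r) ring_scheme \<Rightarrow> ('a, 'm, 'e) module_scheme \<Rightarrow> 'm set"
  where "finite_length_part R M =
    {m \<in> carrier M. module_length R (M\<lparr>carrier := cyclic_submodule R M m\<rparr>) \<noteq> \<infinity>}"


section \<open>Localization and base change\<close>

definition fraction_rel :: "('a, 'r) ring_scheme \<Rightarrow> 'a set \<Rightarrow> (('a \<times> 'a) \<times> ('a \<times> 'a)) set"
  where "fraction_rel R P =
    {((a, s), (b, t)). a \<in> carrier R \<and> s \<in> carrier R - P \<and> b \<in> carrier R \<and> t \<in> carrier R - P \<and>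
      (\<exists>u \<in> carrier R - P. u \<otimes>\<^bsub>R\<^esub> (a \<otimes>\<^bsub>R\<^esub> t) = u \<otimes>\<^bsub>R\<^esub> (b \<otimes>\<^bsub>R\<^esub> s))}"

definition fraction :: "('a, 'r) ring_scheme \<Rightarrow> 'a set \<Rightarrow> 'a \<Rightarrow> 'a \<Rightarrow> ('a \<times> 'a) set"
  where "fraction R P a s = fraction_rel R P `` {(a, s)}"

definition localization :: "('a, 'r) ring_scheme \<Rightarrow> 'a set \<Rightarrow> ('a \<times> 'a) set ring"
  where "localization R P =
    \<lparr>carrier = (carrier R \<times> (carrier R - P)) // fraction_rel R P,
     monoid.mult = (\<lambda>U V. \<Union>(a, s)\<in>U. \<Union>(b, t)\<in>V. fraction R P (a \<otimes>\<^bsub>R\<^esub> b) (s \<otimes>\<^bsub>R\<^esub> t)),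
     monoid.one = fraction R P \<one>\<^bsub>R\<^esub> \<one>\<^bsub>R\<^esub>,
     ring.zero = fraction R P \<zero>\<^bsub>R\<^esub> \<one>\<^bsub>R\<^esub>,
     ring.add = (\<lambda>U V. \<Union>(a, s)\<in>U. \<Union>(b, t)\<in>V.
       fraction R P ((a \<otimes>\<^bsub>R\<^esub> t) \<oplus>\<^bsub>R\<^esub> (b \<otimes>\<^bsub>R\<^esub> s)) (s \<otimes>\<^bsub>R\<^esub> t))\<rparr>"

text \<open>
  The tensor product \<open>M \<otimes>\<^sub>R B\<close> for a ring homomorphism \<open>\<phi>\<close> from \<open>R\<close> to \<open>B\<close>: the quotient of the free
  abelian group on \<open>M \<times> B\<close> by the bilinearity relations, as a \<open>B\<close>-module via
  \<open>b \<cdot> (m \<otimes> c) = m \<otimes> b c\<close>.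
\<close>

definition tensor_relations ::
    "('a, 'm, 'e) module_scheme \<Rightarrow> ('a, 'r) ring_scheme \<Rightarrow> ('b, 's) ring_scheme \<Rightarrow> ('a \<Rightarrow> 'b) \<Rightarrow>
     ('m \<times> 'b \<Rightarrow>\<^sub>0 int) set"
  where "tensor_relations M R B \<phi> =
    {frag_of (m \<oplus>\<^bsub>M\<^esub> m', b) - frag_of (m, b) - frag_of (m', b) | m m' b.
       m \<in> carrier M \<and> m' \<in> carrier M \<and> b \<in> carrier B} \<union>
    {frag_of (m, b \<oplus>\<^bsub>B\<^esub> b') - frag_of (m, b) - frag_of (m, b') | m b b'.
       m \<in> carrier M \<and> b \<in> carrier B \<and> b' \<in> carrier B} \<union>
    {frag_of (a \<odot>\<^bsub>M\<^esub> m, b) - frag_of (m, \<phi> a \<otimes>\<^bsub>B\<^esub> b) | a m b.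
       a \<in> carrier R \<and> m \<in> carrier M \<and> b \<in> carrier B}"

definition base_change ::
    "('a, 'm, 'e) module_scheme \<Rightarrow> ('a, 'r) ring_scheme \<Rightarrow> ('b, 's) ring_scheme \<Rightarrow> ('a \<Rightarrow> 'b) \<Rightarrow>
     ('b, ('m \<times> 'b \<Rightarrow>\<^sub>0 int) set) module"
  where "base_change M R B \<phi> =
    (let F = free_Abelian_group (carrier M \<times> carrier B);
         K = generate F (tensor_relations M R B \<phi>)
     in \<lparr>carrier = carrier (F Mod K), monoid.mult = undefined, monoid.one = undefined,
         ring.zero = monoid.one (F Mod K), ring.add = monoid.mult (F Mod K),
         smult = (\<lambda>b C. \<Union>x\<in>C. K #>\<^bsub>F\<^esub> frag_extend (\<lambda>(m, c). frag_of (m, b \<otimes>\<^bsub>B\<^esub> c)) x)\<rparr>)"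

definition module_localization ::
    "('a, 'r) ring_scheme \<Rightarrow> ('a, 'm, 'e) module_scheme \<Rightarrow> 'a set \<Rightarrow>
     (('a \<times> 'a) set, ('m \<times> ('a \<times> 'a) set \<Rightarrow>\<^sub>0 int) set) module"
  where "module_localization R M P =
    base_change M R (localization R P) (\<lambda>a. fraction R P a \<one>\<^bsub>R\<^esub>)"


section \<open>Reduced length\<close>

definition local_length :: "('a, 'r) ring_scheme \<Rightarrow> ('a, 'm, 'e) module_scheme \<Rightarrow> 'a set \<Rightarrow> nat"
  where "local_length R M P =
    (let A = localization R P; N = module_localization R M P
     in the_enat (module_length A (N\<lparr>carrier := finite_length_part A N\<rparr>)))"

definition conoetherian_prime :: "('a, 'r) ring_scheme \<Rightarrow> 'a set \<Rightarrow> bool"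
  where "conoetherian_prime R P \<longleftrightarrow> primeideal P R \<and> noetherian_ring (R Quot P)"

text \<open>
  The recursion is restricted to conoetherian \<open>P\<close>, where proper inclusion is well-founded upwards.
  The ordinal type \<open>'x ordinal\<close> is left open here; it is fixed in the definition of the reduced length.
\<close>

definition coheight_rel :: "('a, 'r) ring_scheme \<Rightarrow> ('a set \<times> 'a set) set"
  where "coheight_rel R = {(Q, P). conoetherian_prime R P \<and> primeideal Q R \<and> P \<subset> Q}"

definition coheight :: "('a, 'r) ring_scheme \<Rightarrow> 'a set \<Rightarrow> 'x ordinal"
  where "coheight R =
    wfrec (coheight_rel R) (\<lambda>coht P. osup {osuc (coht Q) | Q. (Q, P) \<in> coheight_rel R})"

lemma wf_coheight_rel:
  assumes "cring R"
  shows "wf (coheight_rel R)"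
  unfolding wf_iff_no_infinite_down_chain
proof
  interpret cring R
    by (rule assms)
  assume "\<exists>f. \<forall>i. (f (Suc i), f i) \<in> coheight_rel R"
  then obtain f where f: "(f (Suc i), f i) \<in> coheight_rel R" for i
    by blast
  then have step: "f i \<subset> f (Suc i)" and prime: "primeideal (f i) R" for i
    unfolding coheight_rel_def conoetherian_prime_def by blast+
  have mono: "f i \<subseteq> f j" if "i \<le> j" for i j
    using step by (intro lift_Suc_mono_le[OF _ that]) (rule psubset_imp_subset)
  have ideal: "ideal (f i) R" for i
    using prime by (rule primeideal.axioms(1))
  define g where "g i = a_r_coset R (f 0) ` f i" for i
  interpret Q: noetherian_ring "R Quot f 0"
    using f[of 0] unfolding coheight_rel_def conoetherian_prime_def by blast
  have "subset.chain {I. ideal I (R Quot f 0)} (range g)"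
    unfolding subset_chain_def
  proof (intro conjI ballI)
    show "range g \<subseteq> {I. ideal I (R Quot f 0)}"
      using ring_ideal_imp_quot_ideal[OF ideal ideal] by (auto simp: g_def)
    fix A B assume "A \<in> range g" "B \<in> range g"
    then obtain i j where "A = g i" "B = g j"
      by blast
    then show "A \<subseteq> B \<or> B \<subseteq> A"
      using mono[of i j] mono[of j i] unfolding g_def by (metis image_mono nat_le_linear)
  qed
  then have "\<Union>(range g) \<in> range g"
    by (rule Q.ideal_chain_is_trivial[rotated]) simp
  then obtain n where "\<Union>(range g) = g n"
    by blast
  then have "g (Suc n) \<subseteq> g n"
    by blast
  moreover have "f i = \<Union>(g i)" for i
    using ideal_incl_iff[OF ideal ideal, of 0 i] mono[of 0 i] by (simp add: g_def)
  ultimately have "f (Suc n) \<subseteq> f n"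
    by (metis Union_mono)
  then show False
    using step[of n] by blast
qed

lemma coheight_rec:
  assumes "cring R" and "conoetherian_prime R P"
  shows "(coheight R P :: 'x ordinal) = osup {osuc (coheight R Q) | Q. primeideal Q R \<and> P \<subset> Q}"
proof -
  have "(coheight R P :: 'x ordinal) =
      osup {osuc (cut (coheight R) (coheight_rel R) P Q) | Q. (Q, P) \<in> coheight_rel R}"
    unfolding coheight_def by (rule wfrec[OF wf_coheight_rel[OF assms(1)]])
  also have "{osuc (cut (coheight R) (coheight_rel R) P Q :: 'x ordinal) | Q. (Q, P) \<in> coheight_rel R} =
      {osuc (coheight R Q) | Q. (Q, P) \<in> coheight_rel R}"
    unfolding setcompr_eq_image by (rule image_cong) (simp_all add: cut_apply)
  also have "\<dots> = {osuc (coheight R Q) | Q. primeideal Q R \<and> P \<subset> Q}"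
    using assms(2) by (simp add: coheight_rel_def)
  finally show ?thesis .
qed

definition length_at ::
    "('a, 'r) ring_scheme \<Rightarrow> ('a, 'm, 'e) module_scheme \<Rightarrow> 'x ordinal \<Rightarrow> nat"
  where "length_at R M \<alpha> =
    (\<Sum>P | conoetherian_prime R P \<and> coheight R P = \<alpha> \<and> local_length R M P \<noteq> 0. local_length R M P)"

definition ordinal_shift :: "'x ordinal \<Rightarrow> 'x ordinal"
  where "ordinal_shift \<alpha> = (if \<alpha> < omega then osuc \<alpha> else \<alpha>)"

text \<open>
  The ordinals in \<open>('a + 'm) set ordinal\<close> are those of cardinality at most that of
  \<open>('a + 'm) set + nat\<close>. This covers the Cantor-Bendixson ranks of spaces of submodules of \<open>M\<close>, the
  coheights of prime ideals of \<open>R\<close>, and the ordinals formed from them below.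
  The right-nested sum lists the finitely many nonzero terms by decreasing exponent.
\<close>

definition reduced_length ::
    "('a, 'r) ring_scheme \<Rightarrow> ('a, 'm, 'e) module_scheme \<Rightarrow> ('a + 'm) set ordinal"
  where "reduced_length R M =
    (let l = (\<lambda>\<alpha>. length_at R M (ordinal_shift \<alpha>))
     in foldr (\<lambda>\<alpha> \<sigma>. omega_power \<alpha> * ord_of_nat (l \<alpha>) + \<sigma>)
          (rev (sorted_list_of_set {\<alpha>. l \<alpha> \<noteq> 0})) 0)"


section \<open>Cantor-Bendixson rank\<close>

definition isolated_points :: "'p topology \<Rightarrow> 'p set"
  where "isolated_points T = {x \<in> topspace T. openin T {x}}"

function CB_layer :: "'p topology \<Rightarrow> 'o::wellorder \<Rightarrow> 'p set"
  where "CB_layer T \<alpha> =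
    isolated_points (subtopology T (topspace T - (\<Union>\<beta>\<in>{..<\<alpha>}. CB_layer T \<beta>)))"
  by pat_completeness auto
termination
  by (relation "inv_image {(\<alpha>, \<beta>). \<alpha> < \<beta>} snd") (rule wf_inv_image[OF wf], simp)

declare CB_layer.simps [simp del]

text \<open>\<open>None\<close> stands for the rank \<open>\<infinity>\<close>.\<close>

definition CB_rank :: "'p \<Rightarrow> 'p topology \<Rightarrow> 'o::wellorder option"
  where "CB_rank x T =
    (if \<exists>\<alpha> :: 'o. x \<in> CB_layer T \<alpha> then Some (THE \<alpha>. x \<in> CB_layer T \<alpha>) else None)"

definition submodule_topology ::
    "('a, 'r) ring_scheme \<Rightarrow> ('a, 'm, 'e) module_scheme \<Rightarrow> 'm set topology"
  where "submodule_topology R M =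
    pullback_topology {N. submodule N R M} (\<lambda>N. \<lambda>m\<in>carrier M. m \<in> N)
      (product_topology (\<lambda>_. discrete_topology (UNIV :: bool set)) (carrier M))"

text \<open>The quotient \<open>M/K\<close> has zero element \<open>K\<close>, so \<open>zero\<close> is the inverse of \<open>K \<mapsto> M/K\<close>.\<close>

definition quotient_topology ::
    "('a, 'r) ring_scheme \<Rightarrow> ('a, 'm, 'e) module_scheme \<Rightarrow> ('a, 'm set) module topology"
  where "quotient_topology R M =
    pullback_topology {quotient_module M K | K. submodule K R M} ring.zero (submodule_topology R M)"

definition module_CB_rank ::
    "('a, 'r) ring_scheme \<Rightarrow> ('a, 'm, 'e) module_scheme \<Rightarrow> ('a + 'm) set ordinal option"
  where "module_CB_rank R M = CB_rank (quotient_module M {\<zero>\<^bsub>M\<^esub>}) (quotient_topology R M)"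

end

theory Submission
  imports Defs
begin

text \<open>
  A quotient \<open>M/K\<close> is represented by the submodule \<open>K\<close>. For a prime \<open>P\<close> let \<open>l\<^sub>P(K)\<close> be the length of the
  finite length part of \<open>(M/K)\<^sub>P\<close>, read off from the lattice of \<open>P\<close>-saturated submodules of \<open>M\<close>, and let
  the rank of \<open>K\<close> be the ordinal with Cantor normal form \<open>\<Sum> \<omega>\<^sup>\<alpha> c\<^sub>\<alpha>\<close>, where \<open>c\<^sub>\<alpha>\<close> is the sum of \<open>l\<^sub>P(K)\<close> over the
  conoetherian primes \<open>P\<close> of coheight \<open>\<alpha>'\<close>.

  If \<open>P\<close> is an associated prime of \<open>M/K\<close> of coheight \<open>0\<close>, the elements of \<open>M/K\<close> annihilated by \<open>P\<close> form an
  artinian module, which is finite by assumption. So the submodules \<open>N\<close> close to \<open>K\<close> avoid its nonzero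
  elements, and all associated primes of \<open>N/K\<close> have positive coheight. Passing from \<open>K\<close> to \<open>N \<noteq> K\<close> then
  lowers \<open>l\<^sub>P\<close> at the associated primes \<open>P\<close> of \<open>N/K\<close> of greatest coheight and changes it at no other prime of
  that coheight or above: the rank drops.

  Conversely, let \<open>\<gamma>\<close> be the least exponent in the rank of \<open>K\<close>, and \<open>P = (K : m)\<close> an associated prime of
  coheight \<open>\<gamma>'\<close>. If \<open>N \<noteq> K\<close> lies between \<open>K\<close> and \<open>K + R m\<close>, the coefficient at \<open>\<gamma>\<close> drops by at most one and
  those above \<open>\<gamma>\<close> do not change. For each prime \<open>Q\<close> strictly above \<open>P\<close> such an \<open>N\<close> can be chosen arbitrarily
  close to \<open>K\<close> with \<open>l\<^sub>Q(N)\<close> arbitrarily large, so every ordinal below the rank of \<open>K\<close> is exceeded or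
  attained by the rank of some \<open>N \<noteq> K\<close> near \<open>K\<close>. By induction the rank is the Cantor-Bendixson rank.
\<close>

section \<open>Cantor normal forms\<close>

text \<open>Why the exponents are shifted: a prime of coheight 0 contributes only finitely many
  elements near K, and a neighbourhood can exclude these. This is the one place where the hypothesis
  on artinian subquotients enters. The shift is an order isomorphism onto the positive ordinals, so
  every prime that does matter has exactly one exponent. Two obstacles shape the proof. R need not
  be noetherian, so every chain condition is taken in M, and annihilators are maximized through the
  submodules of M that they kill. Also, the localizations of M/K would change with K and P;
  replacing them by saturated submodules of the fixed module M lets K and a larger N be compared
  inside one lattice. The tensor product enters only at the end, for K = 0. Small submodules of
  finite colength would usually come from powers of a maximal ideal and Krull's intersection
  theorem. Here submodules that are maximal with respect to avoiding an element take their place.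
  The two halves compare ordinals differently: the drop of the rank is lexicographic and must hold
  for every N near K, while the lower bound needs one N whose coefficients dominate prescribed
  ones.\<close>

lemma less_osup:
  fixes S :: "'o::wellorder set"
  assumes "\<beta> < osup S"
  shows "\<exists>\<sigma>\<in>S. \<beta> < \<sigma>"
  using osup_least[of S \<beta>] assms by (meson leI leD)

section \<open>Ordinal sums and cofinal sequences in powers of \<omega>\<close>

lemma ordinal_add_right_mono: "\<beta> \<le> \<gamma> \<Longrightarrow> \<alpha> + \<beta> \<le> \<alpha> + (\<gamma> :: 'x ordinal)"
  using ordinal_add_less[of \<beta> \<gamma> \<alpha>] by (auto simp: le_less)

lemma less_ordinal_add:
  assumes "\<epsilon> < \<alpha> + (\<beta> :: 'x ordinal)"
  shows "\<epsilon> < \<alpha> \<or> (\<exists>\<delta><\<beta>. \<epsilon> \<le> \<alpha> + \<delta>)"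
proof -
  have "\<epsilon> < osup (insert \<alpha> ((\<lambda>\<gamma>. osuc (\<alpha> + \<gamma>)) ` {..<\<beta>}))"
    using assms by (subst (asm) plus_ordinal.simps)
  from less_osup[OF this] show ?thesis
    by (auto simp: less_osuc_iff)
qed

lemma ordinal_add_assoc: "(\<alpha> + \<beta>) + \<gamma> = \<alpha> + (\<beta> + (\<gamma> :: 'x ordinal))"
proof (induction \<gamma> rule: less_induct)
  case (less \<gamma>)
  show ?case
  proof (rule antisym)
    have "osuc ((\<alpha> + \<beta>) + \<delta>) \<le> \<alpha> + (\<beta> + \<gamma>)" if "\<delta> < \<gamma>" for \<delta>
      using less[OF that] that by (simp add: osuc_le_iff ordinal_add_less)
    then show "(\<alpha> + \<beta>) + \<gamma> \<le> \<alpha> + (\<beta> + \<gamma>)"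
      by (subst plus_ordinal.simps, intro osup_least)
        (auto intro: ordinal_add_right_mono ordinal_le_add)
    have "osuc (\<alpha> + \<epsilon>) \<le> (\<alpha> + \<beta>) + \<gamma>" if "\<epsilon> < \<beta> + \<gamma>" for \<epsilon>
      using less_ordinal_add[OF that]
    proof
      assume "\<epsilon> < \<beta>"
      then have "\<alpha> + \<epsilon> < \<alpha> + \<beta>"
        by (rule ordinal_add_less)
      then show ?thesis
        unfolding osuc_le_iff using ordinal_le_add by (rule less_le_trans)
    next
      assume "\<exists>\<delta><\<gamma>. \<epsilon> \<le> \<beta> + \<delta>"
      then obtain \<delta> where \<delta>: "\<delta> < \<gamma>" "\<epsilon> \<le> \<beta> + \<delta>"
        by blast
      have "\<alpha> + \<epsilon> \<le> (\<alpha> + \<beta>) + \<delta>"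
        using ordinal_add_right_mono[OF \<delta>(2)] less[OF \<delta>(1)] by simp
      then show ?thesis
        unfolding osuc_le_iff using ordinal_add_less[OF \<delta>(1)] by (rule le_less_trans)
    qed
    moreover have "\<alpha> \<le> (\<alpha> + \<beta>) + \<gamma>"
      using ordinal_le_add order_trans by blast
    ultimately show "\<alpha> + (\<beta> + \<gamma>) \<le> (\<alpha> + \<beta>) + \<gamma>"
      by (subst (1) plus_ordinal.simps, intro osup_least) auto
  qed
qed

lemma ord_of_nat_Suc: "ord_of_nat (Suc n) = osuc (ord_of_nat n)"
  by (simp add: ord_of_nat_def)

lemma ord_of_nat_mono: "m \<le> n \<Longrightarrow> (ord_of_nat m :: 'x ordinal) \<le> ord_of_nat n"
proof (rule lift_Suc_mono_le[where f = "ord_of_nat :: nat \<Rightarrow> 'x ordinal"])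
  show "(ord_of_nat n :: 'x ordinal) \<le> ord_of_nat (Suc n)" for n
    by (simp add: ord_of_nat_Suc less_imp_le less_osuc_iff)
qed

lemma less_omegaD: "\<delta> < (omega :: 'x ordinal) \<Longrightarrow> \<exists>n. \<delta> < ord_of_nat n"
  using less_osup[of \<delta> "range ord_of_nat"] by (auto simp: omega_def)

lemma ordinal_mult_zero_nat: "\<alpha> * ord_of_nat 0 = (0 :: 'x ordinal)"
  by (simp add: ord_of_nat_def ordinal_mult_0)

lemma omega_power_mult_nat_le:
  assumes "\<zeta> < (\<gamma> :: 'x ordinal)"
  shows "omega_power \<zeta> * ord_of_nat n \<le> omega_power \<gamma>"
proof -
  have "omega_power \<zeta> * ord_of_nat n \<le> omega_power \<zeta> * omega"
    by (intro ordinal_mult_mono less_imp_le ord_of_nat_less_omega)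
  also have "\<dots> \<le> omega_power \<gamma>"
    using assms by (rule omega_power_mult_le)
  finally show ?thesis .
qed

text \<open>The multiples of \<omega>^\<zeta> by naturals, for \<zeta> < \<gamma>, are cofinal in
  \<omega>^\<gamma>. The value 0 is listed apart because no \<zeta> exists when \<gamma> =
  0.\<close>

lemma less_omega_powerD:
  assumes "\<delta> < omega_power (\<gamma> :: 'x ordinal)"
  shows "\<delta> = 0 \<or> (\<exists>\<zeta><\<gamma>. \<exists>n. \<delta> \<le> omega_power \<zeta> * ord_of_nat n)"
proof -
  have "\<exists>\<sigma>\<in>insert (ord_of_nat 1) ((\<lambda>\<beta>. omega_power \<beta> * omega) ` {..<\<gamma>}). \<delta> < \<sigma>"
    by (rule less_osup) (use assms in \<open>subst (asm) omega_power.simps\<close>)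
  then consider "\<delta> < ord_of_nat 1" | \<zeta> where "\<zeta> < \<gamma>" "\<delta> < omega_power \<zeta> * omega"
    by auto
  then show ?thesis
  proof cases
    case 1
    then have "\<delta> \<le> 0"
      by (simp add: ord_of_nat_def less_osuc_iff)
    then show ?thesis
      using ordinal_zero_le antisym by blast
  next
    case 2
    then have "\<exists>\<sigma>\<in>(\<lambda>\<gamma>. omega_power \<zeta> * \<gamma> + omega_power \<zeta>) ` {..<omega}. \<delta> < \<sigma>"
      by (intro less_osup) (simp add: times_ordinal.simps[symmetric])
    then obtain \<eta> where \<eta>: "\<eta> < omega" "\<delta> < omega_power \<zeta> * \<eta> + omega_power \<zeta>"
      by auto
    obtain n where "\<eta> < ord_of_nat n"
      using less_omegaD[OF \<eta>(1)] by blast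
    then have "\<delta> \<le> omega_power \<zeta> * ord_of_nat n"
      using \<eta>(2) ordinal_mult_add_le[of \<eta> _ "omega_power \<zeta>"] by (meson less_imp_le less_le_trans)
    then show ?thesis
      using 2(1) by blast
  qed
qed

section \<open>Comparison of Cantor normal forms by their coefficients\<close>

definition cantor_sum :: "('x ordinal \<Rightarrow> nat) \<Rightarrow> 'x ordinal"
  where "cantor_sum f = foldr (\<lambda>\<alpha> \<sigma>. omega_power \<alpha> * ord_of_nat (f \<alpha>) + \<sigma>)
    (rev (sorted_list_of_set {\<alpha>. f \<alpha> \<noteq> 0})) 0"

lemma foldr_ordinal_append:
  fixes h :: "'b \<Rightarrow> 'x ordinal"
  shows "foldr (\<lambda>\<alpha> \<sigma>. h \<alpha> + \<sigma>) (xs @ ys) 0 =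
    foldr (\<lambda>\<alpha> \<sigma>. h \<alpha> + \<sigma>) xs 0 + foldr (\<lambda>\<alpha> \<sigma>. h \<alpha> + \<sigma>) ys 0"
  by (induction xs) (simp_all add: ordinal_zero_add ordinal_add_assoc)

lemma cantor_sum_zero: "cantor_sum (\<lambda>_. 0) = 0"
  by (simp add: cantor_sum_def)

lemma cantor_sum_single: "cantor_sum ((\<lambda>_. 0)(\<zeta> := n)) = omega_power \<zeta> * ord_of_nat n"
proof (cases "n = 0")
  case True
  then have "(\<lambda>_. 0)(\<zeta> := n) = (\<lambda>_. 0)"
    by auto
  then show ?thesis
    using True by (simp add: cantor_sum_zero ordinal_mult_zero_nat)
next
  case False
  then have "{\<alpha>. ((\<lambda>_. 0)(\<zeta> := n)) \<alpha> \<noteq> 0} = {\<zeta>}"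
    by auto
  then show ?thesis
    by (simp add: cantor_sum_def ordinal_add_0)
qed

lemma rev_sorted_list_of_set_split:
  fixes \<alpha> :: "'o::linorder"
  assumes "finite S"
  shows "rev (sorted_list_of_set S) = rev (sorted_list_of_set {\<beta>\<in>S. \<alpha> < \<beta>}) @
    (if \<alpha> \<in> S then [\<alpha>] else []) @ rev (sorted_list_of_set {\<beta>\<in>S. \<beta> < \<alpha>})"
proof -
  let ?xs = "sorted_list_of_set {\<beta>\<in>S. \<beta> < \<alpha>} @ (if \<alpha> \<in> S then [\<alpha>] else []) @
    sorted_list_of_set {\<beta>\<in>S. \<alpha> < \<beta>}"
  have "set ?xs = S" "sorted_wrt (<) ?xs"
    using assms by (auto simp: sorted_wrt_append)
  then have "sorted_list_of_set S = ?xs"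
    using assms by (metis sorted_list_of_set_unique strict_sorted_iff distinct_card)
  then show ?thesis
    by simp
qed

text \<open>Comparisons of coefficients are reduced to this cut into head, single term and tail.
  Finite support matters because \<open>sorted_list_of_set\<close> of an infinite set is the empty
  list.\<close>

lemma cantor_sum_split:
  assumes "finite {\<beta>. f \<beta> \<noteq> 0}"
  shows "cantor_sum f = cantor_sum (\<lambda>\<beta>. if \<alpha> < \<beta> then f \<beta> else 0) +
    (omega_power \<alpha> * ord_of_nat (f \<alpha>) + cantor_sum (\<lambda>\<beta>. if \<beta> < \<alpha> then f \<beta> else 0))"
proof -
  define h where "h f \<beta> = omega_power \<beta> * ord_of_nat (f \<beta>)" for f :: "'a ordinal \<Rightarrow> nat" and \<beta>
  define F where "F f xs = foldr (\<lambda>\<beta> \<sigma>. h f \<beta> + \<sigma>) xs 0" for f xs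
  have cs: "cantor_sum f = F f (rev (sorted_list_of_set {\<alpha>. f \<alpha> \<noteq> 0}))" for f
    by (simp add: cantor_sum_def F_def h_def)
  have app: "F f (xs @ ys) = F f xs + F f ys" for f xs ys
    unfolding F_def by (rule foldr_ordinal_append)
  have cong: "F f xs = F g xs" if "\<And>\<beta>. \<beta> \<in> set xs \<Longrightarrow> f \<beta> = g \<beta>" for f g xs
    unfolding F_def by (rule foldr_cong) (simp_all add: that h_def)
  have mid: "F f (if \<alpha> \<in> {\<beta>. f \<beta> \<noteq> 0} then [\<alpha>] else []) = omega_power \<alpha> * ord_of_nat (f \<alpha>)"
    by (simp add: F_def h_def ordinal_add_0 ordinal_mult_zero_nat)
  have up: "F f (rev (sorted_list_of_set {\<beta> \<in> {\<beta>. f \<beta> \<noteq> 0}. \<alpha> < \<beta>})) =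
      cantor_sum (\<lambda>\<beta>. if \<alpha> < \<beta> then f \<beta> else 0)"
  proof -
    have *: "{\<beta>. (if \<alpha> < \<beta> then f \<beta> else 0) \<noteq> 0} = {\<beta> \<in> {\<beta>. f \<beta> \<noteq> 0}. \<alpha> < \<beta>}"
      by auto
    from cs[of "\<lambda>\<beta>. if \<alpha> < \<beta> then f \<beta> else 0"] show ?thesis
      unfolding * by (elim ssubst, intro cong) (use assms in auto)
  qed
  have lo: "F f (rev (sorted_list_of_set {\<beta> \<in> {\<beta>. f \<beta> \<noteq> 0}. \<beta> < \<alpha>})) =
      cantor_sum (\<lambda>\<beta>. if \<beta> < \<alpha> then f \<beta> else 0)"
  proof -
    have *: "{\<beta>. (if \<beta> < \<alpha> then f \<beta> else 0) \<noteq> 0} = {\<beta> \<in> {\<beta>. f \<beta> \<noteq> 0}. \<beta> < \<alpha>}"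
      by auto
    from cs[of "\<lambda>\<beta>. if \<beta> < \<alpha> then f \<beta> else 0"] show ?thesis
      unfolding * by (elim ssubst, intro cong) (use assms in auto)
  qed
  show ?thesis
    unfolding cs[of f] rev_sorted_list_of_set_split[OF assms, of \<alpha>] app mid up lo ..
qed

lemma cantor_sum_less_omega_power:
  assumes "finite {\<beta>. f \<beta> \<noteq> 0}" and "\<And>\<beta>. f \<beta> \<noteq> 0 \<Longrightarrow> \<beta> < \<alpha>"
  shows "cantor_sum f < omega_power \<alpha>"
proof -
  \<comment> \<open>The bound is generalized along with the list: for the tail, the leading exponent
    \<open>x\<close> takes the role of \<alpha>.\<close>
  have "foldr (\<lambda>\<alpha> \<sigma>. omega_power \<alpha> * ord_of_nat (f \<alpha>) + \<sigma>) xs 0 < omega_power \<alpha>"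
    if "sorted_wrt (>) xs" "\<forall>\<beta>\<in>set xs. \<beta> < \<alpha>" for xs
    using that
  proof (induction xs arbitrary: \<alpha>)
    case Nil
    have "0 < (ord_of_nat 1 :: 'a ordinal)"
      by (simp add: ord_of_nat_def less_osuc_iff)
    then show ?case
      using one_le_omega_power[of \<alpha>] by simp
  next
    case (Cons x xs)
    let ?s = "foldr (\<lambda>\<alpha> \<sigma>. omega_power \<alpha> * ord_of_nat (f \<alpha>) + \<sigma>) xs 0"
    have "?s < omega_power x"
      using Cons.prems by (intro Cons.IH) auto
    then have "omega_power x * ord_of_nat (f x) + ?s <
        omega_power x * ord_of_nat (f x) + omega_power x"
      by (rule ordinal_add_less)
    also have "\<dots> = omega_power x * ord_of_nat (Suc (f x))"
      by (simp add: ordinal_mult_osuc ord_of_nat_Suc)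
    also have "\<dots> \<le> omega_power \<alpha>"
      using Cons.prems by (intro omega_power_mult_nat_le) simp
    finally show ?case
      by simp
  qed
  from this[of "rev (sorted_list_of_set {\<beta>. f \<beta> \<noteq> 0})"] show ?thesis
    using assms by (simp add: cantor_sum_def sorted_wrt_rev)
qed

text \<open>Lexicographic comparison from the top: the tail of f below \<alpha> is smaller than
  \<omega>^\<alpha>, so it cannot make up for a missing copy of \<omega>^\<alpha>.\<close>

lemma cantor_sum_less:
  assumes f: "finite {\<beta>. f \<beta> \<noteq> 0}" and g: "finite {\<beta>. g \<beta> \<noteq> 0}"
    and eq: "\<And>\<beta>. \<alpha> < \<beta> \<Longrightarrow> f \<beta> = g \<beta>" and less: "f \<alpha> < g \<alpha>"
  shows "cantor_sum f < cantor_sum g"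
proof -
  let ?H = "cantor_sum (\<lambda>\<beta>. if \<alpha> < \<beta> then g \<beta> else 0)"
  have H: "(\<lambda>\<beta>. if \<alpha> < \<beta> then f \<beta> else 0) = (\<lambda>\<beta>. if \<alpha> < \<beta> then g \<beta> else 0)"
    using eq by auto
  have "cantor_sum (\<lambda>\<beta>. if \<beta> < \<alpha> then f \<beta> else 0) < omega_power \<alpha>"
    by (rule cantor_sum_less_omega_power) (auto intro: finite_subset[OF _ f] split: if_splits)
  then have "omega_power \<alpha> * ord_of_nat (f \<alpha>) + cantor_sum (\<lambda>\<beta>. if \<beta> < \<alpha> then f \<beta> else 0)
      < omega_power \<alpha> * ord_of_nat (f \<alpha>) + omega_power \<alpha>"
    by (rule ordinal_add_less)
  also have "\<dots> = omega_power \<alpha> * ord_of_nat (Suc (f \<alpha>))"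
    by (simp add: ordinal_mult_osuc ord_of_nat_Suc)
  also have "\<dots> \<le> omega_power \<alpha> * ord_of_nat (g \<alpha>)"
    using less by (intro ordinal_mult_mono ord_of_nat_mono) simp
  also have "\<dots> \<le> omega_power \<alpha> * ord_of_nat (g \<alpha>) + cantor_sum (\<lambda>\<beta>. if \<beta> < \<alpha> then g \<beta> else 0)"
    by (rule ordinal_le_add)
  finally show ?thesis
    unfolding cantor_sum_split[OF f, of \<alpha>] cantor_sum_split[OF g, of \<alpha>] H by (rule ordinal_add_less)
qed

text \<open>The largest exponent at which f and g differ is at least \<alpha>; the inequality is
  strict there, and the lexicographic comparison applies. This form suits submodules whose
  coefficients are known only from below.\<close>

lemma cantor_sum_less_if_dominated:
  assumes f: "finite {\<beta>. f \<beta> \<noteq> 0}" and g: "finite {\<beta>. g \<beta> \<noteq> 0}"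
    and le: "\<And>\<beta>. \<alpha> < \<beta> \<Longrightarrow> f \<beta> \<le> g \<beta>" and less: "f \<alpha> < g \<alpha>"
  shows "cantor_sum f < cantor_sum g"
proof -
  let ?D = "{\<beta>. f \<beta> \<noteq> g \<beta>}"
  have fin: "finite ?D"
    by (rule finite_subset[OF _ finite_UnI[OF f g]]) auto
  have "\<alpha> \<in> ?D"
    using less by simp
  then have max: "Max ?D \<in> ?D" "\<alpha> \<le> Max ?D"
    using Max_in[OF fin] Max_ge[OF fin] by auto
  show ?thesis
  proof (rule cantor_sum_less[OF f g])
    show "f \<beta> = g \<beta>" if "Max ?D < \<beta>" for \<beta>
      using Max_ge[OF fin, of \<beta>] that by (meson leD mem_Collect_eq)
    show "f (Max ?D) < g (Max ?D)"
    proof (cases "Max ?D = \<alpha>")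
      case True
      then show ?thesis
        using less by simp
    next
      case False
      then have "f (Max ?D) \<le> g (Max ?D)"
        using max(2) by (intro le) simp
      moreover have "f (Max ?D) \<noteq> g (Max ?D)"
        using max(1) by blast
      ultimately show ?thesis
        by (rule le_neq_implies_less)
    qed
  qed
qed

lemma cantor_sum_mono:
  assumes "finite {\<beta>. f \<beta> \<noteq> 0}" and "finite {\<beta>. g \<beta> \<noteq> 0}" and le: "\<And>\<beta>. f \<beta> \<le> g \<beta>"
  shows "cantor_sum f \<le> cantor_sum g"
proof (cases "f = g")
  case False
  then obtain \<alpha> where "f \<alpha> \<noteq> g \<alpha>"
    by auto
  then have "f \<alpha> < g \<alpha>"
    using le[of \<alpha>] by simp
  then show ?thesis
    using cantor_sum_less_if_dominated[OF assms(1,2) le] by (simp add: less_imp_le)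
qed simp

text \<open>If \<gamma> is the least exponent, the sum is G + \<omega>^\<gamma>, where G has one
  copy of \<omega>^\<gamma> less. Everything below it is reached by G itself or by G +
  \<omega>^\<zeta> n with \<zeta> < \<gamma>, and these are the normal forms that small submodules
  will be made to dominate.\<close>

lemma cantor_sum_approx:
  assumes g: "finite {\<beta>. g \<beta> \<noteq> 0}" and \<gamma>: "g \<gamma> \<noteq> 0" "\<And>\<beta>. \<beta> < \<gamma> \<Longrightarrow> g \<beta> = 0"
    and b: "b < cantor_sum g"
  shows "b \<le> cantor_sum (g(\<gamma> := g \<gamma> - 1)) \<or>
    (\<exists>\<zeta><\<gamma>. \<exists>n. b \<le> cantor_sum (g(\<gamma> := g \<gamma> - 1, \<zeta> := n)))"
proof -
  define H where "H = cantor_sum (\<lambda>\<beta>. if \<gamma> < \<beta> then g \<beta> else 0)"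
  define G where "G = H + omega_power \<gamma> * ord_of_nat (g \<gamma> - 1)"
  have low: "(\<lambda>\<beta>. if \<beta> < \<gamma> then g \<beta> else 0) = (\<lambda>_. 0)"
    using \<gamma>(2) by auto
  have "omega_power \<gamma> * ord_of_nat (g \<gamma>) = omega_power \<gamma> * ord_of_nat (g \<gamma> - 1) + omega_power \<gamma>"
    using \<gamma>(1) by (cases "g \<gamma>") (simp_all add: ordinal_mult_osuc ord_of_nat_Suc)
  then have "cantor_sum g = G + omega_power \<gamma>"
    unfolding cantor_sum_split[OF g, of \<gamma>] low
    by (simp add: G_def H_def ordinal_add_assoc cantor_sum_zero ordinal_add_0)
  then have "b < G \<or> (\<exists>\<delta> < omega_power \<gamma>. b \<le> G + \<delta>)"
    using less_ordinal_add b by metis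
  then have "b \<le> G + 0 \<or> (\<exists>\<delta> < omega_power \<gamma>. b \<le> G + \<delta>)"
    by (auto simp: ordinal_add_0)
  then have *: "b \<le> G + 0 \<or> (\<exists>\<zeta><\<gamma>. \<exists>n. b \<le> G + omega_power \<zeta> * ord_of_nat n)"
    using less_omega_powerD[of _ \<gamma>] ordinal_add_right_mono[of _ _ G] order_trans by metis
  have h: "finite {\<beta>. (g(\<gamma> := g \<gamma> - 1)) \<beta> \<noteq> 0}"
    by (rule finite_subset[OF _ g]) (use \<gamma>(1) in auto)
  have 1: "cantor_sum (g(\<gamma> := g \<gamma> - 1)) = G + 0"
  proof -
    have "(\<lambda>\<beta>. if \<gamma> < \<beta> then (g(\<gamma> := g \<gamma> - 1)) \<beta> else 0) = (\<lambda>\<beta>. if \<gamma> < \<beta> then g \<beta> else 0)"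
      "(\<lambda>\<beta>. if \<beta> < \<gamma> then (g(\<gamma> := g \<gamma> - 1)) \<beta> else 0) = (\<lambda>_. 0)"
      using \<gamma>(2) by auto
    then show ?thesis
      unfolding cantor_sum_split[OF h, of \<gamma>]
      by (simp add: G_def H_def cantor_sum_zero ordinal_add_0)
  qed
  have 2: "cantor_sum (g(\<gamma> := g \<gamma> - 1, \<zeta> := n)) = G + omega_power \<zeta> * ord_of_nat n"
    if "\<zeta> < \<gamma>" for \<zeta> n
  proof -
    have h: "finite {\<beta>. (g(\<gamma> := g \<gamma> - 1, \<zeta> := n)) \<beta> \<noteq> 0}"
      by (rule finite_subset[OF _ finite.insertI[OF h, of \<zeta>]]) auto
    have "(\<lambda>\<beta>. if \<gamma> < \<beta> then (g(\<gamma> := g \<gamma> - 1, \<zeta> := n)) \<beta> else 0) =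
        (\<lambda>\<beta>. if \<gamma> < \<beta> then g \<beta> else 0)"
      "(\<lambda>\<beta>. if \<beta> < \<gamma> then (g(\<gamma> := g \<gamma> - 1, \<zeta> := n)) \<beta> else 0) = (\<lambda>_. 0)(\<zeta> := n)"
      using \<gamma>(2) that by (auto simp: fun_eq_iff)
    then show ?thesis
      unfolding cantor_sum_split[OF h, of \<gamma>]
      using that less_imp_neq[OF that] by (simp add: G_def H_def cantor_sum_single ordinal_add_assoc)
  qed
  show ?thesis
    using * 1 2 by metis
qed

section \<open>The shift between coheights and exponents\<close>

lemma ordinal_shift_strict_mono:
  assumes "\<alpha> < (\<beta> :: 'x ordinal)"
  shows "ordinal_shift \<alpha> < ordinal_shift \<beta>"
proof (cases "\<beta> < omega")
  case True
  then show ?thesis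
    using assms by (simp add: ordinal_shift_def less_osuc_iff osuc_le_iff less_imp_le)
next
  case False
  have "osuc \<alpha> < \<beta>" if \<alpha>: "\<alpha> < omega"
  proof -
    obtain n where "\<alpha> < ord_of_nat n"
      using less_omegaD[OF \<alpha>] by blast
    then have "osuc \<alpha> < omega"
      using ord_of_nat_less_omega[of n] by (meson osuc_le_iff le_less_trans)
    then show ?thesis
      using False by simp
  qed
  then show ?thesis
    using assms False by (simp add: ordinal_shift_def)
qed

text \<open>A nonzero finite ordinal is a successor, and an infinite one is its own image. With
  strict monotonicity and positivity, the shift is thus an order isomorphism onto the positive
  ordinals.\<close>

lemma ordinal_shift_surj:
  assumes "0 < (\<beta> :: 'x ordinal)"
  obtains \<alpha> where "ordinal_shift \<alpha> = \<beta>"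
proof (cases "\<beta> < omega")
  case True
  then obtain n where n: "\<beta> < ord_of_nat n"
    using less_omegaD by blast
  define m where "m = (LEAST n. \<beta> < ord_of_nat n)"
  have m: "\<beta> < ord_of_nat m"
    unfolding m_def by (rule LeastI[of _ n]) (rule n)
  then obtain k where k: "m = Suc k"
    using assms by (cases m) (auto simp: ord_of_nat_def)
  have "\<not> \<beta> < ord_of_nat k"
    using not_less_Least[of k "\<lambda>n. \<beta> < ord_of_nat n"] k by (simp add: m_def)
  with m k have b: "\<beta> = ord_of_nat k"
    by (simp add: ord_of_nat_Suc less_osuc_iff)
  then obtain j where "k = Suc j"
    using assms by (cases k) (auto simp: ord_of_nat_def)
  then show ?thesis
    using b that[of "ord_of_nat j"] by (simp add: ordinal_shift_def ord_of_nat_less_omega ord_of_nat_Suc)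
next
  case False
  then show ?thesis
    using that[of \<beta>] by (simp add: ordinal_shift_def)
qed

lemma ordinal_shift_pos: "0 < ordinal_shift (\<alpha> :: 'x ordinal)"
proof (cases "\<alpha> < omega")
  case True
  then show ?thesis
    using ordinal_zero_le[of \<alpha>] by (simp add: ordinal_shift_def less_osuc_iff)
next
  case False
  then show ?thesis
    using ord_of_nat_less_omega[of 0] by (auto simp: ordinal_shift_def ord_of_nat_def not_less intro: less_le_trans)
qed

section \<open>Cantor-Bendixson layers of a ranked space\<close>

text \<open>The first condition makes \<open>x\<close> isolated among the points of rank at least \<open>rk x\<close>; the second
  one keeps it from being isolated any earlier.\<close>

lemma CB_layer_eq_rank:
  fixes rk :: "'p \<Rightarrow> 'o::wellorder"
  assumes below: "\<And>x. x \<in> topspace T \<Longrightarrow> \<exists>U. openin T U \<and> x \<in> U \<and> (\<forall>y\<in>U - {x}. rk y < rk x)"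
    and approx: "\<And>x U b. x \<in> topspace T \<Longrightarrow> openin T U \<Longrightarrow> x \<in> U \<Longrightarrow> b < rk x \<Longrightarrow>
      \<exists>y\<in>U - {x}. b \<le> rk y"
  shows "CB_layer T \<alpha> = {x \<in> topspace T. rk x = \<alpha>}"
proof (induction \<alpha> rule: less_induct)
  case (less \<alpha>)
  have rest: "topspace T - (\<Union>\<beta>\<in>{..<\<alpha>}. CB_layer T \<beta>) = {x \<in> topspace T. \<alpha> \<le> rk x}"
    using less by auto
  have "openin (subtopology T {x \<in> topspace T. \<alpha> \<le> rk x}) {x} \<longleftrightarrow> rk x = \<alpha>"
    if x: "x \<in> topspace T" "\<alpha> \<le> rk x" for x
  proof
    assume "openin (subtopology T {x \<in> topspace T. \<alpha> \<le> rk x}) {x}"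
    then obtain U where U: "openin T U" "{x} = U \<inter> {x \<in> topspace T. \<alpha> \<le> rk x}"
      unfolding openin_subtopology by blast
    show "rk x = \<alpha>"
    proof (rule ccontr)
      assume "rk x \<noteq> \<alpha>"
      then have "\<alpha> < rk x"
        using x by simp
      then obtain y where "y \<in> U - {x}" "\<alpha> \<le> rk y"
        using approx[OF x(1) U(1)] U(2) by blast
      then show False
        using U openin_subset[OF U(1)] by blast
    qed
  next
    assume r: "rk x = \<alpha>"
    obtain U where U: "openin T U" "x \<in> U" "\<forall>y\<in>U - {x}. rk y < rk x"
      using below[OF x(1)] by blast
    have "{x} = U \<inter> {x \<in> topspace T. \<alpha> \<le> rk x}"
      using U x r by (auto simp: not_less[symmetric])
    then show "openin (subtopology T {x \<in> topspace T. \<alpha> \<le> rk x}) {x}"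
      unfolding openin_subtopology using U(1) by blast
  qed
  then show ?case
    by (subst CB_layer.simps) (auto simp: rest isolated_points_def)
qed

lemma CB_rank_eq_rank:
  fixes rk :: "'p \<Rightarrow> 'o::wellorder"
  assumes "\<And>\<alpha> :: 'o. CB_layer T \<alpha> = {x \<in> topspace T. rk x = \<alpha>}" and "x \<in> topspace T"
  shows "CB_rank x T = Some (rk x)"
  using assms(2) by (simp add: CB_rank_def assms(1))

section \<open>Lengths of chains\<close>

text \<open>Chains are counted in arbitrary families of sets, so that submodules of a localization
  and saturated submodules of M can be compared along monotone maps. The number counts inclusions
  rather than members.\<close>

definition has_chain :: "'b set set \<Rightarrow> nat \<Rightarrow> bool"
  where "has_chain S n \<longleftrightarrow> (\<exists>N :: nat \<Rightarrow> 'b set. (\<forall>i\<le>n. N i \<in> S) \<and> (\<forall>i<n. N i \<subset> N (Suc i)))"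

definition chain_length :: "'b set set \<Rightarrow> enat"
  where "chain_length S = (SUP n\<in>{n. has_chain S n}. enat n)"

lemma module_length_eq: "module_length R M = chain_length {N. submodule N R M}"
  by (simp add: module_length_def chain_length_def has_chain_def)

lemma has_chain_0: "has_chain S 0 \<longleftrightarrow> S \<noteq> {}"
  by (auto simp: has_chain_def)

lemma has_chain_mono: "has_chain S n \<Longrightarrow> m \<le> n \<Longrightarrow> has_chain S m"
  unfolding has_chain_def by (meson order_less_le_trans order_trans)

lemma has_chain_subset: "has_chain S n \<Longrightarrow> S \<subseteq> T \<Longrightarrow> has_chain T n"
  unfolding has_chain_def by blast

lemma has_chain_image:
  assumes "has_chain S n" and "f ` S \<subseteq> T"
    and "\<And>A B. A \<in> S \<Longrightarrow> B \<in> S \<Longrightarrow> A \<subset> B \<Longrightarrow> f A \<subset> f B"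
  shows "has_chain T n"
proof -
  obtain N where "\<forall>i\<le>n. N i \<in> S" "\<forall>i<n. N i \<subset> N (Suc i)"
    using assms(1) by (auto simp: has_chain_def)
  then show ?thesis
    unfolding has_chain_def using assms(2,3) by (intro exI[of _ "\<lambda>i. f (N i)"]) (auto simp: Suc_leI)
qed

lemma has_chain_Cons:
  assumes "has_chain S n" and "B \<in> T" and "S \<subseteq> T" and "\<And>A. A \<in> S \<Longrightarrow> B \<subset> A"
  shows "has_chain T (Suc n)"
proof -
  obtain N where "\<forall>i\<le>n. N i \<in> S" "\<forall>i<n. N i \<subset> N (Suc i)"
    using assms(1) by (auto simp: has_chain_def)
  then show ?thesis
    unfolding has_chain_def using assms(2-)
    by (intro exI[of _ "case_nat B N"]) (auto split: nat.split)
qed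

lemma chain_length_eqI: "(\<And>n. has_chain S n \<longleftrightarrow> has_chain T n) \<Longrightarrow> chain_length S = chain_length T"
  by (simp add: chain_length_def)

lemma chain_length_finite_iff: "chain_length S \<noteq> \<infinity> \<longleftrightarrow> (\<exists>b. \<forall>n. has_chain S n \<longrightarrow> n \<le> b)"
proof
  assume "chain_length S \<noteq> \<infinity>"
  then obtain b where "chain_length S = enat b"
    by auto
  then have "enat n \<le> enat b" if "has_chain S n" for n
    using SUP_upper[of n "{n. has_chain S n}" enat] that by (simp add: chain_length_def)
  then show "\<exists>b. \<forall>n. has_chain S n \<longrightarrow> n \<le> b"
    by auto
next
  assume "\<exists>b. \<forall>n. has_chain S n \<longrightarrow> n \<le> b"
  then obtain b where "chain_length S \<le> enat b"
    by (auto simp: chain_length_def SUP_le_iff)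
  then show "chain_length S \<noteq> \<infinity>"
    by (metis enat_ord_simps(5) infinity_ne_i0 enat.distinct(1))
qed

text \<open>A finite supremum of naturals is a maximum, and chains can be truncated. Nonemptiness
  provides the chain of length 0.\<close>

lemma has_chain_iff_le:
  assumes "chain_length S \<noteq> \<infinity>" and "S \<noteq> {}"
  shows "has_chain S n \<longleftrightarrow> n \<le> the_enat (chain_length S)"
proof -
  let ?A = "{n. has_chain S n}"
  obtain b where "\<forall>n. has_chain S n \<longrightarrow> n \<le> b"
    using assms(1) unfolding chain_length_finite_iff by blast
  then have fin: "finite ?A"
    by (auto simp: finite_nat_set_iff_bounded_le)
  have ne: "?A \<noteq> {}"
    using assms(2) has_chain_0[of S] by blast
  have "chain_length S = enat (Max ?A)"
    unfolding chain_length_def using Max_in[OF fin ne] Max_ge[OF fin]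
    by (intro antisym SUP_least SUP_upper) auto
  then show ?thesis
    using Max_in[OF fin ne] Max_ge[OF fin, of n] by (auto intro: has_chain_mono)
qed

lemma has_chain_1: "has_chain S 1 \<longleftrightarrow> (\<exists>N\<in>S. \<exists>N'\<in>S. N \<subset> N')"
proof
  assume "has_chain S 1"
  then obtain N where "\<forall>i\<le>1. N i \<in> S" "\<forall>i<1. N i \<subset> N (Suc i)"
    unfolding has_chain_def by blast
  then have "N 0 \<in> S" "N 1 \<in> S" "N 0 \<subset> N 1"
    by simp_all
  then show "\<exists>N\<in>S. \<exists>N'\<in>S. N \<subset> N'"
    by blast
next
  assume "\<exists>N\<in>S. \<exists>N'\<in>S. N \<subset> N'"
  then obtain N N' where "N \<in> S" "N' \<in> S" "N \<subset> N'"
    by blast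
  then show "has_chain S 1"
    unfolding has_chain_def by (intro exI[of _ "case_nat N (\<lambda>_. N')"]) (auto split: nat.split)
qed

lemma has_chain_snoc:
  assumes "has_chain S n" and "B \<in> T" and "S \<subseteq> T" and "\<And>A. A \<in> S \<Longrightarrow> A \<subset> B"
  shows "has_chain T (Suc n)"
proof -
  obtain N where N: "\<forall>i\<le>n. N i \<in> S" "\<forall>i<n. N i \<subset> N (Suc i)"
    using assms(1) by (auto simp: has_chain_def)
  let ?N = "\<lambda>i. if i \<le> n then N i else B"
  have 1: "?N i \<in> T" for i
  proof (cases "i \<le> n")
    case True
    then have "N i \<in> S"
      using N(1) by simp
    then show ?thesis
      using True assms(3) by auto
  qed (simp add: assms(2))
  have 2: "?N i \<subset> ?N (Suc i)" if "i < Suc n" for i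
  proof (cases "i = n")
    case True
    then show ?thesis
      using N(1) assms(4) by simp
  next
    case False
    then show ?thesis
      using N(2) that by simp
  qed
  show ?thesis
    unfolding has_chain_def by (intro exI[of _ ?N] conjI allI impI 1 2)
qed

text \<open>A descending sequence that never becomes constant contains strict chains of every
  length, against the bound.\<close>

lemma decreasing_stabilizes:
  fixes f :: "nat \<Rightarrow> 'b set"
  assumes bound: "\<And>n. has_chain S n \<Longrightarrow> n \<le> b" and S: "\<And>i. f i \<in> S" and dec: "\<And>i. f (Suc i) \<subseteq> f i"
  shows "\<exists>n. \<forall>i\<ge>n. f i = f n"
proof (rule ccontr)
  assume "\<nexists>n. \<forall>i\<ge>n. f i = f n"
  then have "\<forall>n. \<exists>i\<ge>n. f i \<noteq> f n"
    by blast
  then have drop: "\<exists>i\<ge>n. f i \<subset> f n" for n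
    using lift_Suc_antimono_le[of f, OF dec] by (metis psubsetI)
  \<comment> \<open>The start n is arbitrary so that a chain found from a later index i on can be
    capped by the larger member \<open>f n\<close>.\<close>
  have "has_chain {f i | i. n \<le> i} k" for k n
  proof (induction k arbitrary: n)
    case 0
    show ?case
      unfolding has_chain_0 by blast
  next
    case (Suc k)
    obtain i where i: "n \<le> i" "f i \<subset> f n"
      using drop by blast
    show ?case
    proof (rule has_chain_snoc[OF Suc.IH[of i]])
      show "f n \<in> {f i | i. n \<le> i}"
        by blast
      show "{f j | j. i \<le> j} \<subseteq> {f i | i. n \<le> i}"
        using i(1) order_trans by blast
      show "A \<subset> f n" if "A \<in> {f j | j. i \<le> j}" for A
        using that i(2) lift_Suc_antimono_le[of f, OF dec] by blast
    qed
  qed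
  then have "has_chain {f i | i. 0 \<le> i} (Suc b)" .
  then have "has_chain S (Suc b)"
    by (rule has_chain_subset) (use S in blast)
  then show False
    using bound by fastforce
qed

section \<open>Saturations and local lengths inside a noetherian module\<close>

locale noetherian_mod = Module.module R M for R (structure) and M (structure) +
  assumes noetherian: "noetherian_module R M"
begin

text \<open>The annihilator of the class of m in M/K, written without forming the quotient.\<close>

definition colon :: "'c set \<Rightarrow> 'c \<Rightarrow> 'a set"
  where "colon K m = {a \<in> carrier R. a \<odot>\<^bsub>M\<^esub> m \<in> K}"

definition adjoin :: "'c set \<Rightarrow> 'c \<Rightarrow> 'c set"
  where "adjoin K m = {k \<oplus>\<^bsub>M\<^esub> a \<odot>\<^bsub>M\<^esub> m | k a. k \<in> K \<and> a \<in> carrier R}"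

text \<open>The \<open>P\<close>-saturated submodules correspond to the submodules of the localization at \<open>P\<close>, and
  \<open>tors P K\<close> to the elements generating a submodule of finite length in the localization of \<open>M/K\<close>.\<close>

definition sat :: "'a set \<Rightarrow> 'c set \<Rightarrow> 'c set"
  where "sat P K = {m \<in> carrier M. \<exists>s \<in> carrier R - P. s \<odot>\<^bsub>M\<^esub> m \<in> K}"

text \<open>In the localization of M/K at P, an element has finite length exactly if it is supported
  at P alone, that is, if it vanishes at every prime strictly below P.\<close>

definition tors :: "'a set \<Rightarrow> 'c set \<Rightarrow> 'c set"
  where "tors P K = {m \<in> carrier M. \<forall>P1. primeideal P1 R \<longrightarrow> P1 \<subset> P \<longrightarrow> m \<in> sat P1 K}"

text \<open>The submodules of the finite length part of the localization of M/K, seen inside M. A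
  saturated N that contains K also contains \<open>sat P K\<close>.\<close>

definition sats :: "'a set \<Rightarrow> 'c set \<Rightarrow> 'c set set"
  where "sats P K = {N. submodule N R M \<and> sat P N = N \<and> K \<subseteq> N \<and> N \<subseteq> tors P K}"

definition loc_length :: "'a set \<Rightarrow> 'c set \<Rightarrow> nat"
  where "loc_length P K = the_enat (chain_length (sats P K))"

definition assoc_primes :: "'c set \<Rightarrow> 'a set set"
  where "assoc_primes K = {colon K m | m. m \<in> carrier M \<and> primeideal (colon K m) R}"

lemma sub_carrier: "submodule K R M \<Longrightarrow> x \<in> K \<Longrightarrow> x \<in> carrier M"
  using submoduleE(1) by blast

lemma sub_zero: "submodule K R M \<Longrightarrow> \<zero>\<^bsub>M\<^esub> \<in> K"
  using subgroup.one_closed[OF submodule.axioms(1)] by fastforce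

lemmas sub_add = submoduleE(5) and sub_smult = submoduleE(4) and sub_neg = submoduleE(3)

lemma sub_add_cancel:
  assumes "submodule K R M" "x \<in> K" "y \<in> carrier M" "x \<oplus>\<^bsub>M\<^esub> y \<in> K"
  shows "y \<in> K"
proof -
  have "x \<in> carrier M"
    using assms sub_carrier by blast
  then have "y = \<ominus>\<^bsub>M\<^esub> x \<oplus>\<^bsub>M\<^esub> (x \<oplus>\<^bsub>M\<^esub> y)"
    using assms(3) by (simp add: M.r_neg1)
  then show ?thesis
    using assms sub_add sub_neg by metis
qed

lemma submoduleI_smult:
  assumes "H \<subseteq> carrier M" "\<zero>\<^bsub>M\<^esub> \<in> H"
    and "\<And>a b. a \<in> H \<Longrightarrow> b \<in> H \<Longrightarrow> a \<oplus>\<^bsub>M\<^esub> b \<in> H"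
    and smult: "\<And>a x. a \<in> carrier R \<Longrightarrow> x \<in> H \<Longrightarrow> a \<odot>\<^bsub>M\<^esub> x \<in> H"
  shows "submodule H R M"
proof (rule submoduleI[OF assms(1,2) _ assms(3,4)])
  fix a assume a: "a \<in> H"
  then have "\<ominus>\<^bsub>M\<^esub> a = (\<ominus> \<one>) \<odot>\<^bsub>M\<^esub> a"
    using assms(1) smult_l_minus[of \<one> a] by auto
  then show "\<ominus>\<^bsub>M\<^esub> a \<in> H"
    using smult[of "\<ominus> \<one>" a] a by simp
qed

lemma sub_Int: "submodule K R M \<Longrightarrow> submodule N R M \<Longrightarrow> submodule (K \<inter> N) R M"
  by (intro submoduleI) (auto dest: sub_carrier sub_zero sub_add sub_smult sub_neg)

lemma zero_sub: "submodule {\<zero>\<^bsub>M\<^esub>} R M"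
  by (intro submoduleI) auto

lemma adjoin_zero:
  "m \<in> carrier M \<Longrightarrow> adjoin {\<zero>\<^bsub>M\<^esub>} m = {a \<odot>\<^bsub>M\<^esub> m | a. a \<in> carrier R}"
  by (force simp: adjoin_def)

lemma adjoin_sub:
  assumes K: "submodule K R M" and m: "m \<in> carrier M"
  shows "submodule (adjoin K m) R M"
proof (rule submoduleI)
  show "adjoin K m \<subseteq> carrier M"
    using assms by (auto simp: adjoin_def dest: sub_carrier)
  have "\<zero>\<^bsub>M\<^esub> = \<zero>\<^bsub>M\<^esub> \<oplus>\<^bsub>M\<^esub> \<zero> \<odot>\<^bsub>M\<^esub> m"
    using m by simp
  then show "\<zero>\<^bsub>M\<^esub> \<in> adjoin K m"
    unfolding adjoin_def using sub_zero[OF K] by blast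
next
  fix x assume "x \<in> adjoin K m"
  then obtain k a where x: "k \<in> K" "a \<in> carrier R" "x = k \<oplus>\<^bsub>M\<^esub> a \<odot>\<^bsub>M\<^esub> m"
    by (auto simp: adjoin_def)
  have k: "k \<in> carrier M"
    using x sub_carrier[OF K] by blast
  have "\<ominus>\<^bsub>M\<^esub> x = \<ominus>\<^bsub>M\<^esub> k \<oplus>\<^bsub>M\<^esub> (\<ominus> a) \<odot>\<^bsub>M\<^esub> m"
    using x k m by (simp add: M.minus_add smult_l_minus)
  then show "\<ominus>\<^bsub>M\<^esub> x \<in> adjoin K m"
    unfolding adjoin_def using x sub_neg[OF K] by blast
  fix y assume "y \<in> adjoin K m"
  then obtain l b where y: "l \<in> K" "b \<in> carrier R" "y = l \<oplus>\<^bsub>M\<^esub> b \<odot>\<^bsub>M\<^esub> m"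
    by (auto simp: adjoin_def)
  have l: "l \<in> carrier M"
    using y sub_carrier[OF K] by blast
  have "x \<oplus>\<^bsub>M\<^esub> y = (k \<oplus>\<^bsub>M\<^esub> l) \<oplus>\<^bsub>M\<^esub> (a \<oplus> b) \<odot>\<^bsub>M\<^esub> m"
    using x y k l m by (simp add: smult_l_distr M.a_ac)
  then show "x \<oplus>\<^bsub>M\<^esub> y \<in> adjoin K m"
    unfolding adjoin_def using x y sub_add[OF K] by blast
next
  fix c x assume c: "c \<in> carrier R" and "x \<in> adjoin K m"
  then obtain k a where x: "k \<in> K" "a \<in> carrier R" "x = k \<oplus>\<^bsub>M\<^esub> a \<odot>\<^bsub>M\<^esub> m"
    by (auto simp: adjoin_def)
  have k: "k \<in> carrier M"
    using x sub_carrier[OF K] by blast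
  have "c \<odot>\<^bsub>M\<^esub> x = c \<odot>\<^bsub>M\<^esub> k \<oplus>\<^bsub>M\<^esub> (c \<otimes> a) \<odot>\<^bsub>M\<^esub> m"
    using x k m c by (simp add: smult_r_distr smult_assoc1)
  then show "c \<odot>\<^bsub>M\<^esub> x \<in> adjoin K m"
    unfolding adjoin_def using x c sub_smult[OF K] by blast
qed

lemma adjoin_superset:
  assumes K: "submodule K R M" and m: "m \<in> carrier M"
  shows "K \<subseteq> adjoin K m" "m \<in> adjoin K m"
proof
  fix k assume "k \<in> K"
  moreover from this have "k = k \<oplus>\<^bsub>M\<^esub> \<zero> \<odot>\<^bsub>M\<^esub> m"
    using m sub_carrier[OF K] by simp
  ultimately show "k \<in> adjoin K m"
    unfolding adjoin_def by blast
next
  have "m = \<zero>\<^bsub>M\<^esub> \<oplus>\<^bsub>M\<^esub> \<one> \<odot>\<^bsub>M\<^esub> m"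
    using m by simp
  then show "m \<in> adjoin K m"
    unfolding adjoin_def using sub_zero[OF K] by blast
qed

lemma adjoin_least: "submodule N R M \<Longrightarrow> K \<subseteq> N \<Longrightarrow> m \<in> N \<Longrightarrow> adjoin K m \<subseteq> N"
  by (auto simp: adjoin_def intro!: sub_add sub_smult)

lemma smult_in_adjoin:
  "submodule K R M \<Longrightarrow> m \<in> carrier M \<Longrightarrow> a \<in> carrier R \<Longrightarrow> a \<odot>\<^bsub>M\<^esub> m \<in> adjoin K m"
  by (intro sub_smult adjoin_sub adjoin_superset)

lemma adjoin_mono: "K \<subseteq> N \<Longrightarrow> adjoin K m \<subseteq> adjoin N m"
  by (auto simp: adjoin_def)

subsection \<open>Noetherian induction\<close>

lemma wf_sub: "wf {(N, K). submodule N R M \<and> submodule K R M \<and> K \<subset> N}"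
  unfolding wf_iff_no_infinite_down_chain
proof
  assume "\<exists>f. \<forall>i. (f (Suc i), f i) \<in> {(N, K). submodule N R M \<and> submodule K R M \<and> K \<subset> N}"
  then obtain f where "\<forall>i. (f (Suc i), f i) \<in> {(N, K). submodule N R M \<and> submodule K R M \<and> K \<subset> N}"
    by (rule exE)
  then have f: "\<And>i. submodule (f i) R M" "\<And>i. f i \<subset> f (Suc i)"
    by simp_all
  then have "\<forall>i. submodule (f i) R M \<and> f i \<subseteq> f (Suc i)"
    by (simp add: psubset_imp_subset)
  then have "\<exists>n. \<forall>i\<ge>n. f i = f n"
    by (rule noetherian[unfolded noetherian_module_def, THEN spec, THEN mp])
  then obtain n where "\<forall>i\<ge>n. f i = f n"
    by (rule exE)
  then have "f (Suc n) = f n"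
    using le_SucI by blast
  then show False
    using f(2)[of n] by simp
qed

lemma noeth_induct [consumes 1, case_names step]:
  assumes "submodule K R M"
    and "\<And>K. submodule K R M \<Longrightarrow> (\<And>N. submodule N R M \<Longrightarrow> K \<subset> N \<Longrightarrow> Q N) \<Longrightarrow> Q K"
  shows "Q K"
  using assms(1)
proof (induction K rule: wf_induct_rule[OF wf_sub])
  case (1 K)
  show ?case
  proof (rule assms(2)[OF "1.prems"])
    fix N assume N: "submodule N R M" "K \<subset> N"
    then have "(N, K) \<in> {(N, K). submodule N R M \<and> submodule K R M \<and> K \<subset> N}"
      using "1.prems" by simp
    then show "Q N"
      using N(1) by (rule "1.IH")
  qed
qed

lemma noeth_maximal:
  assumes "N0 \<in> S" and "\<And>N. N \<in> S \<Longrightarrow> submodule N R M"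
  obtains N where "N \<in> S" and "\<And>N'. N' \<in> S \<Longrightarrow> N \<subseteq> N' \<Longrightarrow> N' = N"
proof -
  obtain N where N: "N \<in> S" "\<And>N'. (N', N) \<in> {(N, K). submodule N R M \<and> submodule K R M \<and> K \<subset> N} \<Longrightarrow> N' \<notin> S"
    by (rule wfE_min[OF wf_sub assms(1)], rule that)
  have "N' = N" if "N' \<in> S" "N \<subseteq> N'" for N'
    using N(2)[of N'] assms(2)[OF N(1)] assms(2)[OF that(1)] that by auto
  then show thesis
    using that N(1) by blast
qed

text \<open>A submodule that is maximal among those controlled by a finite subset of K absorbs each
  x in K, since x can be added to the finite subset. Generation is phrased through containment
  because this makes the condition K \<subseteq> N on N an open one.\<close>

lemma finitely_generated:
  assumes K: "submodule K R M"
  obtains F where "finite F" "F \<subseteq> K" "\<And>N. submodule N R M \<Longrightarrow> F \<subseteq> N \<Longrightarrow> K \<subseteq> N"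
proof -
  let ?S = "{N. submodule N R M \<and> N \<subseteq> K \<and>
    (\<exists>F. finite F \<and> F \<subseteq> K \<and> (\<forall>N'. submodule N' R M \<longrightarrow> F \<subseteq> N' \<longrightarrow> N \<subseteq> N'))}"
  have "{\<zero>\<^bsub>M\<^esub>} \<in> ?S"
    using zero_sub sub_zero K by (auto intro!: exI[of _ "{}"])
  then obtain N where N: "N \<in> ?S" "\<And>N'. N' \<in> ?S \<Longrightarrow> N \<subseteq> N' \<Longrightarrow> N' = N"
    using noeth_maximal[of _ ?S] by (metis (no_types, lifting) mem_Collect_eq)
  from N(1) obtain F where F: "finite F" "F \<subseteq> K" "\<And>N'. submodule N' R M \<Longrightarrow> F \<subseteq> N' \<Longrightarrow> N \<subseteq> N'"
    by blast
  have "K \<subseteq> N"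
  proof
    fix x assume x: "x \<in> K"
    have xM: "x \<in> carrier M"
      using x K sub_carrier by blast
    have N': "submodule N R M"
      using N(1) by blast
    have "adjoin N x \<in> ?S"
    proof (intro CollectI conjI exI[of _ "insert x F"] allI impI)
      show "adjoin N x \<subseteq> K"
        using N(1) x K by (intro adjoin_least) auto
      show "adjoin N x \<subseteq> N'" if "submodule N' R M" "insert x F \<subseteq> N'" for N'
        using that F(3)[of N'] by (intro adjoin_least) auto
    qed (use F x adjoin_sub[OF N' xM] in auto)
    then have "adjoin N x = N"
      using adjoin_superset(1)[OF N' xM] by (rule N(2))
    then show "x \<in> N"
      using adjoin_superset(2)[OF N' xM] by simp
  qed
  then show thesis
    using F(3) by (intro that[OF F(1,2)]) (rule order_trans)
qed

subsection \<open>Saturation\<close>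

lemma prime_subset: "primeideal P R \<Longrightarrow> a \<in> P \<Longrightarrow> a \<in> carrier R"
  by (meson additive_subgroup.a_Hcarr ideal.axioms(1) primeideal.axioms(1))

lemma prime_one: "primeideal P R \<Longrightarrow> \<one> \<notin> P"
  by (metis ideal.one_imp_carrier primeideal.I_notcarr primeideal.axioms(1))

lemma prime_mult_notin:
  "primeideal P R \<Longrightarrow> s \<in> carrier R - P \<Longrightarrow> t \<in> carrier R - P \<Longrightarrow> s \<otimes> t \<in> carrier R - P"
  using primeideal.I_prime[of P R s t] by auto

lemma prime_mult_in: "primeideal P R \<Longrightarrow> p \<in> P \<Longrightarrow> a \<in> carrier R \<Longrightarrow> a \<otimes> p \<in> P"
  by (meson ideal.I_l_closed primeideal.axioms(1))

lemma satI: "m \<in> carrier M \<Longrightarrow> s \<in> carrier R \<Longrightarrow> s \<notin> P \<Longrightarrow> s \<odot>\<^bsub>M\<^esub> m \<in> K \<Longrightarrow> m \<in> sat P K"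
  by (auto simp: sat_def)

lemma satE:
  assumes "m \<in> sat P K"
  obtains s where "m \<in> carrier M" "s \<in> carrier R" "s \<notin> P" "s \<odot>\<^bsub>M\<^esub> m \<in> K"
  using assms by (auto simp: sat_def)

lemma sat_superset: "submodule K R M \<Longrightarrow> primeideal P R \<Longrightarrow> K \<subseteq> sat P K"
  by (auto intro!: satI[of _ \<one>] dest: sub_carrier prime_one)

lemma sat_mono: "K \<subseteq> N \<Longrightarrow> sat P K \<subseteq> sat P N"
  by (auto simp: sat_def)

lemma sat_anti: "P1 \<subseteq> P \<Longrightarrow> sat P K \<subseteq> sat P1 K"
  by (auto simp: sat_def)

lemma sat_sub:
  assumes K: "submodule K R M" and P: "primeideal P R"
  shows "submodule (sat P K) R M"
proof (rule submoduleI)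
  show "sat P K \<subseteq> carrier M"
    by (auto simp: sat_def)
  show "\<zero>\<^bsub>M\<^esub> \<in> sat P K"
    using sat_superset[OF K P] sub_zero[OF K] by blast
next
  fix x assume "x \<in> sat P K"
  then obtain s where s: "x \<in> carrier M" "s \<in> carrier R" "s \<notin> P" "s \<odot>\<^bsub>M\<^esub> x \<in> K"
    by (rule satE)
  show "\<ominus>\<^bsub>M\<^esub> x \<in> sat P K"
    using s sub_neg[OF K s(4)] by (intro satI[of _ s]) (auto simp: smult_r_minus)
  fix y assume "y \<in> sat P K"
  then obtain t where t: "y \<in> carrier M" "t \<in> carrier R" "t \<notin> P" "t \<odot>\<^bsub>M\<^esub> y \<in> K"
    by (rule satE)
  have "(s \<otimes> t) \<odot>\<^bsub>M\<^esub> (x \<oplus>\<^bsub>M\<^esub> y) = t \<odot>\<^bsub>M\<^esub> (s \<odot>\<^bsub>M\<^esub> x) \<oplus>\<^bsub>M\<^esub> s \<odot>\<^bsub>M\<^esub> (t \<odot>\<^bsub>M\<^esub> y)"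
    using s t by (simp add: smult_r_distr smult_assoc1[symmetric] R.m_comm)
  also have "\<dots> \<in> K"
    by (intro sub_add[OF K] sub_smult[OF K t(2) s(4)] sub_smult[OF K s(2) t(4)])
  finally show "x \<oplus>\<^bsub>M\<^esub> y \<in> sat P K"
    using s t prime_mult_notin[OF P, of s t] by (intro satI[of _ "s \<otimes> t"]) auto
next
  fix a x assume a: "a \<in> carrier R" and "x \<in> sat P K"
  then obtain s where s: "x \<in> carrier M" "s \<in> carrier R" "s \<notin> P" "s \<odot>\<^bsub>M\<^esub> x \<in> K"
    by (auto elim: satE)
  have "s \<odot>\<^bsub>M\<^esub> (a \<odot>\<^bsub>M\<^esub> x) = a \<odot>\<^bsub>M\<^esub> (s \<odot>\<^bsub>M\<^esub> x)"
    using s a by (simp add: smult_assoc1[symmetric] R.m_comm)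
  then show "a \<odot>\<^bsub>M\<^esub> x \<in> sat P K"
    using s a sub_smult[OF K a s(4)] by (intro satI[of _ s]) auto
qed

lemma sat_cancel:
  assumes "primeideal P R" "s \<in> carrier R" "s \<notin> P" "x \<in> carrier M" "s \<odot>\<^bsub>M\<^esub> x \<in> sat P K"
  shows "x \<in> sat P K"
proof -
  obtain t where t: "t \<in> carrier R" "t \<notin> P" "t \<odot>\<^bsub>M\<^esub> (s \<odot>\<^bsub>M\<^esub> x) \<in> K"
    using assms(5) by (rule satE)
  then show ?thesis
    using assms prime_mult_notin[OF assms(1), of t s] by (intro satI[of _ "t \<otimes> s"]) (auto simp: smult_assoc1)
qed

text \<open>Denominators allowed at P are allowed at any smaller prime, so localizing at P first
  makes no difference there.\<close>

lemma sat_sat: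
  assumes P: "primeideal P R" and K: "submodule K R M" and P1: "primeideal P1 R" "P1 \<subseteq> P"
  shows "sat P1 (sat P K) = sat P1 K"
proof
  show "sat P1 (sat P K) \<subseteq> sat P1 K"
  proof
    fix x assume "x \<in> sat P1 (sat P K)"
    then obtain s where s: "x \<in> carrier M" "s \<in> carrier R" "s \<notin> P1" "s \<odot>\<^bsub>M\<^esub> x \<in> sat P K"
      by (rule satE)
    then have "s \<odot>\<^bsub>M\<^esub> x \<in> sat P1 K"
      using sat_anti[OF P1(2)] by blast
    then show "x \<in> sat P1 K"
      by (rule sat_cancel[OF P1(1) s(2,3,1)])
  qed
  show "sat P1 K \<subseteq> sat P1 (sat P K)"
    by (intro sat_mono sat_superset[OF K P])
qed

lemma sat_idem: "primeideal P R \<Longrightarrow> submodule K R M \<Longrightarrow> sat P (sat P K) = sat P K"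
  by (rule sat_sat) auto

text \<open>The product of the two denominators serves for both memberships: localization commutes
  with finite intersections.\<close>

lemma sat_Int:
  assumes K: "submodule K R M" and N: "submodule N R M" and P: "primeideal P R"
  shows "sat P (K \<inter> N) = sat P K \<inter> sat P N"
proof
  show "sat P (K \<inter> N) \<subseteq> sat P K \<inter> sat P N"
    by (auto intro: sat_mono[THEN subsetD])
  show "sat P K \<inter> sat P N \<subseteq> sat P (K \<inter> N)"
  proof
    fix x assume "x \<in> sat P K \<inter> sat P N"
    then obtain s t where s: "x \<in> carrier M" "s \<in> carrier R" "s \<notin> P" "s \<odot>\<^bsub>M\<^esub> x \<in> K"
      and t: "t \<in> carrier R" "t \<notin> P" "t \<odot>\<^bsub>M\<^esub> x \<in> N"
      by (auto elim!: satE)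
    have "(s \<otimes> t) \<odot>\<^bsub>M\<^esub> x = t \<odot>\<^bsub>M\<^esub> (s \<odot>\<^bsub>M\<^esub> x)" "(s \<otimes> t) \<odot>\<^bsub>M\<^esub> x = s \<odot>\<^bsub>M\<^esub> (t \<odot>\<^bsub>M\<^esub> x)"
      using s t by (simp_all add: smult_assoc1[symmetric] R.m_comm)
    then have "(s \<otimes> t) \<odot>\<^bsub>M\<^esub> x \<in> K \<inter> N"
      using sub_smult[OF K t(1) s(4)] sub_smult[OF N s(2) t(3)] by simp
    then show "x \<in> sat P (K \<inter> N)"
      using s t prime_mult_notin[OF P, of s t] by (intro satI[of _ "s \<otimes> t"]) auto
  qed
qed

lemma tors_carrier: "tors P K \<subseteq> carrier M"
  by (auto simp: tors_def)

lemma torsD: "m \<in> tors P K \<Longrightarrow> primeideal P1 R \<Longrightarrow> P1 \<subset> P \<Longrightarrow> m \<in> sat P1 K"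
  by (simp add: tors_def)

lemma tors_sub:
  assumes K: "submodule K R M"
  shows "submodule (tors P K) R M"
proof (rule submoduleI)
  show "tors P K \<subseteq> carrier M"
    by (rule tors_carrier)
qed (simp_all add: tors_def sub_zero[OF sat_sub[OF K]] sub_add[OF sat_sub[OF K]]
      sub_neg[OF sat_sub[OF K]] sub_smult[OF sat_sub[OF K]])

lemma sat_subset_tors: "sat P K \<subseteq> tors P K"
  using sat_anti[of _ P K] by (auto simp: tors_def elim: satE)

lemma sat_tors:
  assumes P: "primeideal P R" and K: "submodule K R M"
  shows "sat P (tors P K) = tors P K"
proof
  show "sat P (tors P K) \<subseteq> tors P K"
  proof
    fix x assume "x \<in> sat P (tors P K)"
    then obtain s where s: "x \<in> carrier M" "s \<in> carrier R" "s \<notin> P" "s \<odot>\<^bsub>M\<^esub> x \<in> tors P K"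
      by (rule satE)
    have "x \<in> sat P1 K" if P1: "primeideal P1 R" "P1 \<subset> P" for P1
    proof (rule sat_cancel[OF P1(1) s(2) _ s(1)])
      show "s \<notin> P1"
        using s(3) P1(2) by blast
      show "s \<odot>\<^bsub>M\<^esub> x \<in> sat P1 K"
        by (rule torsD[OF s(4) P1])
    qed
    then show "x \<in> tors P K"
      using s(1) by (simp add: tors_def)
  qed
qed (rule sat_superset[OF tors_sub[OF K] P])

text \<open>Only localizations at primes strictly below P enter \<open>tors\<close>, and there K and
  N agree because N/K vanishes.\<close>

lemma tors_eq:
  assumes K: "submodule K R M" and N: "K \<subseteq> N" "N \<subseteq> tors P K"
  shows "tors P N = tors P K"
proof -
  have "sat P1 N = sat P1 K" if P1: "primeideal P1 R" "P1 \<subset> P" for P1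
  proof
    have "N \<subseteq> sat P1 K"
      using torsD[OF _ P1] N(2) by blast
    then show "sat P1 N \<subseteq> sat P1 K"
      using sat_mono sat_idem[OF P1(1) K] by blast
  qed (rule sat_mono[OF N(1)])
  then show ?thesis
    by (auto simp: tors_def)
qed

text \<open>A prime strictly below P misses some element of P, and that element sends m into
  K.\<close>

lemma prime_colon_tors:
  assumes K: "submodule K R M" and m: "m \<in> carrier M" "colon K m = P"
  shows "m \<in> tors P K"
proof -
  have "m \<in> sat P1 K" if P1: "primeideal P1 R" "P1 \<subset> P" for P1
  proof -
    obtain p where "p \<in> P" "p \<notin> P1"
      using P1(2) by blast
    then show ?thesis
      using m by (intro satI[of _ p]) (auto simp: colon_def)
  qed
  then show ?thesis
    using m(1) by (simp add: tors_def)
qed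

lemma sat_in_sats: "submodule K R M \<Longrightarrow> primeideal P R \<Longrightarrow> sat P K \<in> sats P K"
  by (simp add: sats_def sat_sub sat_idem sat_superset sat_subset_tors)

subsection \<open>Associated primes\<close>

lemma colon_ideal:
  assumes K: "submodule K R M" and m: "m \<in> carrier M"
  shows "ideal (colon K m) R"
proof (rule idealI)
  show "ring R"
    by (rule R.ring_axioms)
  show "subgroup (colon K m) (add_monoid R)"
  proof (rule group.subgroupI)
    show "group (add_monoid R)"
      by (rule R.add.is_group)
    show "colon K m \<noteq> {}"
      using sub_zero[OF K] m by (auto simp: colon_def intro!: exI[of _ \<zero>])
    fix a assume a: "a \<in> colon K m"
    then have "\<ominus> a \<in> colon K m"
      using m sub_neg[OF K] by (auto simp: colon_def smult_l_minus)
    then show "inv\<^bsub>add_monoid R\<^esub> a \<in> colon K m"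
      by (simp add: a_inv_def)
    fix b assume "b \<in> colon K m"
    then show "a \<otimes>\<^bsub>add_monoid R\<^esub> b \<in> colon K m"
      using a m sub_add[OF K] by (auto simp: colon_def smult_l_distr)
  qed (auto simp: colon_def)
next
  fix a x assume "a \<in> colon K m" "x \<in> carrier R"
  moreover from this have "x \<odot>\<^bsub>M\<^esub> (a \<odot>\<^bsub>M\<^esub> m) \<in> K"
    using sub_smult[OF K] by (auto simp: colon_def)
  ultimately show "x \<otimes> a \<in> colon K m" "a \<otimes> x \<in> colon K m"
    using m by (auto simp: colon_def smult_assoc1[symmetric] R.m_comm)
qed

text \<open>In place of a maximal annihilator ideal of R, the submodule of those x in M with a x in
  K is maximized over a in C. At the maximum, a multiple of \<open>a\<close> that stays in C kills
  no further multiple of m modulo K.\<close>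

lemma colon_maximal:
  assumes K: "submodule K R M" and m: "m \<in> carrier M" and "C \<noteq> {}" and C: "C \<subseteq> carrier R"
  obtains a where "a \<in> C"
    and "\<And>b c. b \<in> carrier R \<Longrightarrow> b \<otimes> a \<in> C \<Longrightarrow> c \<in> carrier R \<Longrightarrow>
      (b \<otimes> a) \<odot>\<^bsub>M\<^esub> (c \<odot>\<^bsub>M\<^esub> m) \<in> K \<Longrightarrow> a \<odot>\<^bsub>M\<^esub> (c \<odot>\<^bsub>M\<^esub> m) \<in> K"
proof -
  define D where "D a = {x \<in> carrier M. a \<odot>\<^bsub>M\<^esub> x \<in> K}" for a
  have comm: "a \<odot>\<^bsub>M\<^esub> (c \<odot>\<^bsub>M\<^esub> x) = c \<odot>\<^bsub>M\<^esub> (a \<odot>\<^bsub>M\<^esub> x)"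
    if "a \<in> carrier R" "c \<in> carrier R" "x \<in> carrier M" for a c x
    using that by (simp add: smult_assoc1[symmetric] R.m_comm)
  have D: "submodule (D a) R M" if "a \<in> carrier R" for a
    by (rule submoduleI) (use that sub_zero[OF K] sub_add[OF K] sub_neg[OF K] sub_smult[OF K] in
        \<open>auto simp: D_def smult_r_distr smult_r_minus comm\<close>)
  obtain a0 where "a0 \<in> C"
    using assms(3) by blast
  then obtain N where N: "N \<in> D ` C" "\<And>N'. N' \<in> D ` C \<Longrightarrow> N \<subseteq> N' \<Longrightarrow> N' = N"
    using noeth_maximal[of "D a0" "D ` C"] D C by blast
  then obtain a where a: "a \<in> C" "N = D a"
    by blast
  show thesis
  proof (rule that[OF a(1)])
    fix b c assume bc: "b \<in> carrier R" "b \<otimes> a \<in> C" "c \<in> carrier R" "(b \<otimes> a) \<odot>\<^bsub>M\<^esub> (c \<odot>\<^bsub>M\<^esub> m) \<in> K"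
    have "D a \<subseteq> D (b \<otimes> a)"
      using a C bc sub_smult[OF K] by (auto simp: D_def smult_assoc1)
    then have "D (b \<otimes> a) = D a"
      using N(2) a bc by blast
    moreover have "c \<odot>\<^bsub>M\<^esub> m \<in> D (b \<otimes> a)"
      using bc m by (auto simp: D_def)
    ultimately show "a \<odot>\<^bsub>M\<^esub> (c \<odot>\<^bsub>M\<^esub> m) \<in> K"
      by (auto simp: D_def)
  qed
qed

text \<open>Take C to be the multipliers that keep m outside K. If c d kills a m modulo K and d does
  not, then d a is again in C and kills c m; by maximality \<open>a\<close> already kills c m, so c
  kills a m.\<close>

lemma exists_prime_colon:
  assumes K: "submodule K R M" and m: "m \<in> carrier M" "m \<notin> K"
  shows "\<exists>a\<in>carrier R. primeideal (colon K (a \<odot>\<^bsub>M\<^esub> m)) R"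
proof -
  let ?C = "{a \<in> carrier R. a \<odot>\<^bsub>M\<^esub> m \<notin> K}"
  have "\<one> \<in> ?C"
    using m by simp
  then have ne: "?C \<noteq> {}"
    by blast
  obtain a where a: "a \<in> ?C"
    and max: "\<And>b c. b \<in> carrier R \<Longrightarrow> b \<otimes> a \<in> ?C \<Longrightarrow> c \<in> carrier R \<Longrightarrow>
      (b \<otimes> a) \<odot>\<^bsub>M\<^esub> (c \<odot>\<^bsub>M\<^esub> m) \<in> K \<Longrightarrow> a \<odot>\<^bsub>M\<^esub> (c \<odot>\<^bsub>M\<^esub> m) \<in> K"
    by (rule colon_maximal[OF K m(1) ne]) (blast, rule that)
  have "primeideal (colon K (a \<odot>\<^bsub>M\<^esub> m)) R"
  proof (rule primeidealI)
    show "ideal (colon K (a \<odot>\<^bsub>M\<^esub> m)) R"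
      using a m by (intro colon_ideal[OF K]) auto
    show "cring R"
      by (rule R.is_cring)
    have "\<one> \<notin> colon K (a \<odot>\<^bsub>M\<^esub> m)"
      using a m by (auto simp: colon_def)
    then show "carrier R \<noteq> colon K (a \<odot>\<^bsub>M\<^esub> m)"
      by blast
    fix c d assume cd: "c \<in> carrier R" "d \<in> carrier R" "c \<otimes> d \<in> colon K (a \<odot>\<^bsub>M\<^esub> m)"
    show "c \<in> colon K (a \<odot>\<^bsub>M\<^esub> m) \<or> d \<in> colon K (a \<odot>\<^bsub>M\<^esub> m)"
    proof (rule disjCI)
      assume "d \<notin> colon K (a \<odot>\<^bsub>M\<^esub> m)"
      then have "d \<otimes> a \<in> ?C"
        using a cd m by (auto simp: colon_def smult_assoc1)
      moreover have "(d \<otimes> a) \<odot>\<^bsub>M\<^esub> (c \<odot>\<^bsub>M\<^esub> m) \<in> K"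
      proof -
        have "(d \<otimes> a) \<otimes> c = (c \<otimes> d) \<otimes> a"
          using cd a by (simp add: R.m_ac)
        then have "(d \<otimes> a) \<odot>\<^bsub>M\<^esub> (c \<odot>\<^bsub>M\<^esub> m) = (c \<otimes> d) \<odot>\<^bsub>M\<^esub> (a \<odot>\<^bsub>M\<^esub> m)"
          using cd a m by (simp add: smult_assoc1[symmetric])
        then show ?thesis
          using cd by (simp add: colon_def)
      qed
      ultimately have "a \<odot>\<^bsub>M\<^esub> (c \<odot>\<^bsub>M\<^esub> m) \<in> K"
        using max cd by blast
      then show "c \<in> colon K (a \<odot>\<^bsub>M\<^esub> m)"
        using cd a m by (simp add: colon_def smult_assoc1[symmetric] R.m_comm)
    qed
  qed
  then show ?thesis
    using a by blast
qed

text \<open>First m is multiplied by an s outside P with largest kernel modulo K. If some t outside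
  P killed c s m, then t s would compete with s, and maximality would put c s m into K; so a prime
  annihilator of c s m stays inside P.\<close>

lemma exists_prime_colon_below:
  assumes K: "submodule K R M" and P: "primeideal P R" and m: "m \<in> carrier M" "m \<notin> sat P K"
  shows "\<exists>a\<in>carrier R. primeideal (colon K (a \<odot>\<^bsub>M\<^esub> m)) R \<and> colon K (a \<odot>\<^bsub>M\<^esub> m) \<subseteq> P"
proof -
  have "\<one> \<in> carrier R - P"
    using prime_one[OF P] by simp
  then have ne: "carrier R - P \<noteq> {}"
    by blast
  obtain s where s: "s \<in> carrier R - P"
    and max: "\<And>b c. b \<in> carrier R \<Longrightarrow> b \<otimes> s \<in> carrier R - P \<Longrightarrow> c \<in> carrier R \<Longrightarrow>
      (b \<otimes> s) \<odot>\<^bsub>M\<^esub> (c \<odot>\<^bsub>M\<^esub> m) \<in> K \<Longrightarrow> s \<odot>\<^bsub>M\<^esub> (c \<odot>\<^bsub>M\<^esub> m) \<in> K"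
    by (rule colon_maximal[OF K m(1) ne Diff_subset]) (rule that)
  have sm: "s \<odot>\<^bsub>M\<^esub> m \<in> carrier M" "s \<odot>\<^bsub>M\<^esub> m \<notin> K"
    using s m satI[OF m(1), of s P K] by auto
  obtain c where c: "c \<in> carrier R" "primeideal (colon K (c \<odot>\<^bsub>M\<^esub> (s \<odot>\<^bsub>M\<^esub> m))) R"
    using exists_prime_colon[OF K sm] by blast
  have eq: "c \<odot>\<^bsub>M\<^esub> (s \<odot>\<^bsub>M\<^esub> m) = (c \<otimes> s) \<odot>\<^bsub>M\<^esub> m" "c \<odot>\<^bsub>M\<^esub> (s \<odot>\<^bsub>M\<^esub> m) = s \<odot>\<^bsub>M\<^esub> (c \<odot>\<^bsub>M\<^esub> m)"
    using c s m by (simp_all add: smult_assoc1[symmetric] R.m_comm)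
  have "t \<in> P" if t: "t \<in> colon K ((c \<otimes> s) \<odot>\<^bsub>M\<^esub> m)" for t
  proof (rule ccontr)
    assume tP: "t \<notin> P"
    have tR: "t \<in> carrier R" "t \<odot>\<^bsub>M\<^esub> ((c \<otimes> s) \<odot>\<^bsub>M\<^esub> m) \<in> K"
      using t by (auto simp: colon_def)
    have "(t \<otimes> s) \<odot>\<^bsub>M\<^esub> (c \<odot>\<^bsub>M\<^esub> m) = t \<odot>\<^bsub>M\<^esub> (s \<odot>\<^bsub>M\<^esub> (c \<odot>\<^bsub>M\<^esub> m))"
      using tR c s m by (intro smult_assoc1) auto
    also have "\<dots> = t \<odot>\<^bsub>M\<^esub> ((c \<otimes> s) \<odot>\<^bsub>M\<^esub> m)"
      by (simp only: eq[symmetric])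
    finally have *: "(t \<otimes> s) \<odot>\<^bsub>M\<^esub> (c \<odot>\<^bsub>M\<^esub> m) = t \<odot>\<^bsub>M\<^esub> ((c \<otimes> s) \<odot>\<^bsub>M\<^esub> m)" .
    have "s \<odot>\<^bsub>M\<^esub> (c \<odot>\<^bsub>M\<^esub> m) \<in> K"
      using tR(2) tP s prime_mult_notin[OF P, of t s] tR(1) c by (intro max[of t c]) (simp_all add: *)
    then have "c \<odot>\<^bsub>M\<^esub> (s \<odot>\<^bsub>M\<^esub> m) \<in> K"
      by (simp only: eq(2))
    then have "\<one> \<in> colon K (c \<odot>\<^bsub>M\<^esub> (s \<odot>\<^bsub>M\<^esub> m))"
      using c s m by (simp add: colon_def)
    then show False
      using prime_one[OF c(2)] by blast
  qed
  then have "colon K ((c \<otimes> s) \<odot>\<^bsub>M\<^esub> m) \<subseteq> P"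
    by (rule subsetI)
  moreover have "primeideal (colon K ((c \<otimes> s) \<odot>\<^bsub>M\<^esub> m)) R"
    using c(2) by (simp only: eq(1))
  ultimately show ?thesis
    using c(1) s by (intro bexI[of _ "c \<otimes> s"] conjI) auto
qed

text \<open>The class of m generates a copy of R/P with P = \<open>colon K m\<close>. This is a
  domain, so all its nonzero elements have annihilator P.\<close>

lemma colon_prime_smult:
  assumes K: "submodule K R M" and m: "m \<in> carrier M" and P: "primeideal (colon K m) R"
    and a: "a \<in> carrier R" "a \<odot>\<^bsub>M\<^esub> m \<notin> K"
  shows "colon K (a \<odot>\<^bsub>M\<^esub> m) = colon K m"
proof
  have na: "a \<notin> colon K m"
    using a by (auto simp: colon_def)
  show "colon K (a \<odot>\<^bsub>M\<^esub> m) \<subseteq> colon K m"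
  proof
    fix c assume c: "c \<in> colon K (a \<odot>\<^bsub>M\<^esub> m)"
    then have "c \<otimes> a \<in> colon K m"
      using a m by (auto simp: colon_def smult_assoc1)
    then show "c \<in> colon K m"
      using primeideal.I_prime[OF P, of c a] na a c by (auto simp: colon_def)
  qed
  show "colon K m \<subseteq> colon K (a \<odot>\<^bsub>M\<^esub> m)"
  proof
    fix c assume c: "c \<in> colon K m"
    then have "c \<odot>\<^bsub>M\<^esub> (a \<odot>\<^bsub>M\<^esub> m) = a \<odot>\<^bsub>M\<^esub> (c \<odot>\<^bsub>M\<^esub> m)"
      using a m by (simp add: colon_def smult_assoc1[symmetric] R.m_comm)
    then show "c \<in> colon K (a \<odot>\<^bsub>M\<^esub> m)"
      using sub_smult[OF K a(1)] c by (auto simp: colon_def)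
  qed
qed

lemma colon_add:
  assumes K: "submodule K R M" and k: "k \<in> K" and m: "m \<in> carrier M"
  shows "colon K (k \<oplus>\<^bsub>M\<^esub> m) = colon K m"
proof -
  have "k \<in> carrier M"
    using sub_carrier[OF K k] .
  then have "a \<odot>\<^bsub>M\<^esub> (k \<oplus>\<^bsub>M\<^esub> m) = a \<odot>\<^bsub>M\<^esub> k \<oplus>\<^bsub>M\<^esub> a \<odot>\<^bsub>M\<^esub> m" if "a \<in> carrier R" for a
    using that m by (simp add: smult_r_distr)
  then have "a \<odot>\<^bsub>M\<^esub> (k \<oplus>\<^bsub>M\<^esub> m) \<in> K \<longleftrightarrow> a \<odot>\<^bsub>M\<^esub> m \<in> K" if "a \<in> carrier R" for a
    using that sub_smult[OF K that k] sub_add[OF K] sub_add_cancel[OF K _ smult_closed[OF that m]] by metis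
  then show ?thesis
    by (auto simp: colon_def)
qed

text \<open>Adjoining m with prime annihilator enlarges K by a copy of R/P, which has P as its only
  associated prime. Noetherian induction on K then adds one prime per step.\<close>

lemma finite_assoc_primes:
  assumes "submodule K R M"
  shows "finite (assoc_primes K)"
  using assms
proof (induction rule: noeth_induct)
  case (step K)
  note K = \<open>submodule K R M\<close>
  show ?case
  proof (cases "K = carrier M")
    case True
    then have "colon K m = carrier R" if "m \<in> carrier M" for m
      using that by (auto simp: colon_def)
    then have "assoc_primes K = {}"
      using prime_one by (auto simp: assoc_primes_def)
    then show ?thesis
      by simp
  next
    case False
    then obtain m0 where m0: "m0 \<in> carrier M" "m0 \<notin> K"
      using sub_carrier[OF K] by blast
    then obtain a0 where "a0 \<in> carrier R" "primeideal (colon K (a0 \<odot>\<^bsub>M\<^esub> m0)) R"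
      using exists_prime_colon[OF K] by blast
    then obtain m where m: "m \<in> carrier M" "primeideal (colon K m) R"
      using m0 by blast
    have mK: "m \<notin> K"
      using prime_one[OF m(2)] m(1) by (auto simp: colon_def)
    let ?K = "adjoin K m"
    have K': "submodule ?K R M"
      by (rule adjoin_sub[OF K m(1)])
    have fin: "finite (assoc_primes ?K)"
      using adjoin_superset[OF K m(1)] mK by (intro step.IH[OF K']) auto
    have "assoc_primes K \<subseteq> insert (colon K m) (assoc_primes ?K)"
    proof
      fix P assume "P \<in> assoc_primes K"
      then obtain x where x: "x \<in> carrier M" "P = colon K x" "primeideal (colon K x) R"
        by (auto simp: assoc_primes_def)
      show "P \<in> insert (colon K m) (assoc_primes ?K)"
      proof (cases "colon ?K x = colon K x")
        case True
        have "P = colon ?K x" "primeideal (colon ?K x) R"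
          using x True by simp_all
        then have "P \<in> assoc_primes ?K"
          unfolding assoc_primes_def using x(1) by blast
        then show ?thesis
          by simp
      next
        case False
        \<comment> \<open>If the annihilator of x grows modulo K + R m, some multiple of x outside K
          falls into K + R m. Modulo K it is then a nonzero multiple of both x and m, so the two
          annihilators coincide.\<close>
        then obtain a where a: "a \<in> carrier R" "a \<odot>\<^bsub>M\<^esub> x \<in> ?K" "a \<odot>\<^bsub>M\<^esub> x \<notin> K"
          using adjoin_superset(1)[OF K m(1)] by (auto simp: colon_def)
        then obtain k b where kb: "k \<in> K" "b \<in> carrier R" "a \<odot>\<^bsub>M\<^esub> x = k \<oplus>\<^bsub>M\<^esub> b \<odot>\<^bsub>M\<^esub> m"
          by (auto simp: adjoin_def)
        have "b \<odot>\<^bsub>M\<^esub> m \<notin> K"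
          using a(3) kb sub_add[OF K kb(1)] by auto
        then have "colon K x = colon K m"
          using colon_prime_smult[OF K x(1,3) a(1,3)] colon_prime_smult[OF K m kb(2)]
            colon_add[OF K kb(1)] kb m by auto
        then show ?thesis
          using x by simp
      qed
    qed
    then show ?thesis
      using fin finite_subset by blast
  qed
qed

subsection \<open>Local lengths\<close>

text \<open>Some multiple of x has a prime annihilator inside P. Were that prime strictly below P,
  the multiple would vanish there, which contradicts its annihilator being that very prime.\<close>

lemma tors_assoc:
  assumes K: "submodule K R M" and P: "primeideal P R" and x: "x \<in> tors P K" "x \<notin> sat P K"
  shows "\<exists>a\<in>carrier R. colon K (a \<odot>\<^bsub>M\<^esub> x) = P"
proof -
  have xM: "x \<in> carrier M"
    using x(1) tors_carrier by (rule rev_subsetD)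
  obtain a where a: "a \<in> carrier R" "primeideal (colon K (a \<odot>\<^bsub>M\<^esub> x)) R" "colon K (a \<odot>\<^bsub>M\<^esub> x) \<subseteq> P"
    using exists_prime_colon_below[OF K P xM x(2)] by blast
  have "colon K (a \<odot>\<^bsub>M\<^esub> x) = P"
  proof (rule ccontr)
    assume "colon K (a \<odot>\<^bsub>M\<^esub> x) \<noteq> P"
    then have "a \<odot>\<^bsub>M\<^esub> x \<in> sat (colon K (a \<odot>\<^bsub>M\<^esub> x)) K"
      using a by (intro torsD[OF sub_smult[OF tors_sub[OF K] a(1) x(1)]]) auto
    then show False
      by (elim satE) (simp add: colon_def)
  qed
  then show ?thesis
    using a(1) by (rule bexI)
qed

text \<open>At P, the module (K + R m)/K becomes the residue field, a simple module. Adding m to all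
  members of a chain therefore makes at most one inclusion collapse.\<close>

lemma has_chain_adjoin:
  assumes K: "submodule K R M" and P: "primeideal P R" and m: "m \<in> carrier M" "colon K m = P"
    and chain: "has_chain (sats P K) n"
  shows "has_chain (sats P (adjoin K m)) (n - 1)"
proof -
  let ?K = "adjoin K m"
  obtain C where C: "\<And>i. i \<le> n \<Longrightarrow> C i \<in> sats P K" and less: "\<And>i. i < n \<Longrightarrow> C i \<subset> C (Suc i)"
    using chain by (auto simp: has_chain_def)
  have mt: "m \<in> tors P K"
    by (rule prime_colon_tors[OF K m])
  have K': "submodule ?K R M"
    by (rule adjoin_sub[OF K m(1)])
  have tors: "tors P ?K = tors P K"
    by (intro tors_eq[OF K] adjoin_superset[OF K m(1)] adjoin_least tors_sub[OF K] mt)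
      (use sat_superset[OF K P] sat_subset_tors in blast)
  have Cs: "submodule (C i) R M" "sat P (C i) = C i" "K \<subseteq> C i" "C i \<subseteq> tors P K" if "i \<le> n" for i
    using C[OF that] by (auto simp: sats_def)
  \<comment> \<open>The collapsing inclusion is the one at which m enters the chain. From there on
    the index is advanced by one, so the new chain skips that inclusion.\<close>
  define D where "D i = (if m \<in> C i then C (Suc i) else sat P (adjoin (C i) m))" for i
  have D: "D i \<in> sats P ?K" if i: "i < n" for i
  proof (cases "m \<in> C i")
    case True
    then have "m \<in> C (Suc i)"
      using less[OF i] by blast
    moreover note CS = Cs[of "Suc i", OF Suc_leI[OF i]]
    ultimately have "?K \<subseteq> C (Suc i)"
      by (intro adjoin_least)
    then show ?thesis
      using True CS by (simp add: D_def sats_def tors)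
  next
    case False
    have C': "submodule (adjoin (C i) m) R M"
      using Cs(1)[of i] i m by (intro adjoin_sub) auto
    have "?K \<subseteq> sat P (adjoin (C i) m)"
      using adjoin_mono[of K "C i" m] Cs(3)[of i] i sat_superset[OF C' P] by auto
    moreover have "adjoin (C i) m \<subseteq> tors P K"
      using Cs(4)[of i] i mt by (intro adjoin_least tors_sub[OF K]) auto
    then have "sat P (adjoin (C i) m) \<subseteq> tors P K"
      using sat_mono sat_tors[OF P K] by blast
    ultimately show ?thesis
      using False by (simp add: D_def sats_def tors sat_sub[OF C' P] sat_idem[OF P C'])
  qed
  have "D i \<subset> D (Suc i)" if i: "Suc i < n" for i
  proof -
    have Ci: "C i \<subset> C (Suc i)" "C (Suc i) \<subset> C (Suc (Suc i))"
      using less[of i] less[of "Suc i"] i by simp_all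
    note CS = Cs[of "Suc i", OF less_imp_le[OF i]]
    show ?thesis
    proof (cases "m \<in> C (Suc i)")
      case True
      then have "adjoin (C i) m \<subseteq> C (Suc i)"
        using Ci CS(1) by (intro adjoin_least) auto
      then have "sat P (adjoin (C i) m) \<subseteq> C (Suc i)"
        using sat_mono CS(2) by blast
      then show ?thesis
        using True Ci by (auto simp: D_def)
    next
      case False
      then have Fi: "m \<notin> C i"
        using Ci by blast
      obtain x where x: "x \<in> C (Suc i)" "x \<notin> C i"
        using Ci(1) by blast
      have sub: "submodule (adjoin (C (Suc i)) m) R M"
        by (rule adjoin_sub[OF CS(1) m(1)])
      have "x \<in> sat P (adjoin (C (Suc i)) m)"
        using sat_superset[OF sub P] adjoin_superset[OF CS(1) m(1)] x(1) by blast
      moreover have "x \<notin> sat P (adjoin (C i) m)"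
      proof
        assume "x \<in> sat P (adjoin (C i) m)"
        then obtain s where s: "x \<in> carrier M" "s \<in> carrier R" "s \<notin> P" "s \<odot>\<^bsub>M\<^esub> x \<in> adjoin (C i) m"
          by (rule satE)
        from s(4) obtain c a where ca: "c \<in> C i" "a \<in> carrier R" "s \<odot>\<^bsub>M\<^esub> x = c \<oplus>\<^bsub>M\<^esub> a \<odot>\<^bsub>M\<^esub> m"
          unfolding adjoin_def by blast
        note C0 = Cs[of i, OF Suc_leD[OF less_imp_le[OF i]]]
        have "c \<in> C (Suc i)"
          using ca(1) Ci(1) by blast
        moreover have "c \<oplus>\<^bsub>M\<^esub> a \<odot>\<^bsub>M\<^esub> m \<in> C (Suc i)"
          unfolding ca(3)[symmetric] by (rule sub_smult[OF CS(1) s(2) x(1)])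
        ultimately have am: "a \<odot>\<^bsub>M\<^esub> m \<in> C (Suc i)"
          using ca(2) m(1) by (meson sub_add_cancel[OF CS(1)] smult_closed)
        \<comment> \<open>The multiplier \<open>a\<close> decides: if it lies in P, then a m is in K
          and x already belongs to \<open>C i\<close>; if not, saturation forces m into
          \<open>C (Suc i)\<close>.\<close>
        show False
        proof (cases "a \<in> P")
          case True
          then have "a \<in> colon K m"
            using m(2) by simp
          then have "a \<odot>\<^bsub>M\<^esub> m \<in> C i"
            using C0(3) by (auto simp: colon_def)
          then have "s \<odot>\<^bsub>M\<^esub> x \<in> C i"
            unfolding ca(3) by (rule sub_add[OF C0(1) ca(1)])
          then have "x \<in> sat P (C i)"
            by (rule satI[OF s(1-3)])
          then show False
            using x C0(2) by simp
        next
          case a: False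
          then have "m \<in> sat P (C (Suc i))"
            by (intro satI[of _ a] m(1) ca(2) am)
          then show False
            using False CS(2) by simp
        qed
      qed
      moreover have "sat P (adjoin (C i) m) \<subseteq> sat P (adjoin (C (Suc i)) m)"
        using Ci by (intro sat_mono adjoin_mono) auto
      ultimately show ?thesis
        using False Fi by (auto simp: D_def)
    qed
  qed
  then show ?thesis
  proof (cases n)
    case 0
    then show ?thesis
      using sat_in_sats[OF K' P] by (auto simp: has_chain_0)
  next
    case (Suc k)
    then show ?thesis
      unfolding has_chain_def using D \<open>\<And>i. Suc i < n \<Longrightarrow> D i \<subset> D (Suc i)\<close>
      by (intro exI[of _ D]) auto
  qed
qed

lemma sat_least_sats: "N \<in> sats P K \<Longrightarrow> sat P K \<subseteq> N"
  using sat_mono[of K N P] by (auto simp: sats_def)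

text \<open>As long as \<open>tors P K\<close> exceeds \<open>sat P K\<close>, it yields an m with
  annihilator P, and adjoining m lowers the length by at most one. Noetherian induction on K ends
  the process, and then \<open>sat P K\<close> is the only member.\<close>

lemma chain_length_sats_finite:
  assumes "submodule K R M" and P: "primeideal P R"
  shows "chain_length (sats P K) \<noteq> \<infinity>"
  using assms(1)
proof (induction rule: noeth_induct)
  case (step K)
  note K = \<open>submodule K R M\<close>
  show ?case
  proof (cases "tors P K \<subseteq> sat P K")
    case True
    have "N = sat P K" if "N \<in> sats P K" for N
      using sat_least_sats[OF that] that True unfolding sats_def by blast
    then have "\<not> has_chain (sats P K) 1"
      unfolding has_chain_1 by (metis psubsetE order_refl)
    then have "n \<le> 0" if "has_chain (sats P K) n" for n
      using has_chain_mono[OF that, of 1] by linarith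
    then show ?thesis
      unfolding chain_length_finite_iff by blast
  next
    case False
    then obtain x where x: "x \<in> tors P K" "x \<notin> sat P K"
      by blast
    then obtain a where a: "a \<in> carrier R" "colon K (a \<odot>\<^bsub>M\<^esub> x) = P"
      using tors_assoc[OF K P] by blast
    define m where "m = a \<odot>\<^bsub>M\<^esub> x"
    have m: "m \<in> carrier M" "colon K m = P"
      using a x(1) tors_carrier[of P K] by (auto simp: m_def)
    have "m \<notin> K"
      using prime_one[OF P] m by (auto simp: colon_def)
    then have "chain_length (sats P (adjoin K m)) \<noteq> \<infinity>"
      using adjoin_superset[OF K m(1)] by (intro step.IH adjoin_sub[OF K m(1)]) auto
    then obtain b where b: "\<And>n. has_chain (sats P (adjoin K m)) n \<Longrightarrow> n \<le> b"
      unfolding chain_length_finite_iff by blast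
    have "n \<le> Suc b" if "has_chain (sats P K) n" for n
      using b[OF has_chain_adjoin[OF K P m that]] by linarith
    then show ?thesis
      unfolding chain_length_finite_iff by blast
  qed
qed

lemma has_chain_sats_iff:
  assumes "submodule K R M" and "primeideal P R"
  shows "has_chain (sats P K) n \<longleftrightarrow> n \<le> loc_length P K"
  unfolding loc_length_def
  by (rule has_chain_iff_le[OF chain_length_sats_finite[OF assms]]) (use sat_in_sats[OF assms] in auto)

lemma loc_length_nonzero_assoc:
  assumes K: "submodule K R M" and P: "primeideal P R" and "loc_length P K \<noteq> 0"
  obtains m where "m \<in> carrier M" "colon K m = P"
proof -
  have "has_chain (sats P K) 1"
    using assms by (simp add: has_chain_sats_iff)
  then obtain N N' where N: "N \<in> sats P K" "N' \<in> sats P K" "N \<subset> N'"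
    unfolding has_chain_1 by blast
  obtain x where x: "x \<in> N'" "x \<notin> sat P K"
    using sat_least_sats[OF N(1)] N(3) by blast
  have xt: "x \<in> tors P K"
    using N(2) x(1) unfolding sats_def by blast
  then obtain a where a: "a \<in> carrier R" "colon K (a \<odot>\<^bsub>M\<^esub> x) = P"
    using tors_assoc[OF K P _ x(2)] by blast
  have "x \<in> carrier M"
    using xt tors_carrier by blast
  then show thesis
    using that[of "a \<odot>\<^bsub>M\<^esub> x"] a by simp
qed

text \<open>By localization in stages, the saturation at P determines those at all smaller primes,
  hence also \<open>tors P\<close>.\<close>

lemma loc_length_sat_cong:
  assumes K: "submodule K R M" and N: "submodule N R M" and P: "primeideal P R"
    and eq: "sat P K = sat P N"
  shows "loc_length P K = loc_length P N"
proof -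
  have "sats P K \<subseteq> sats P N" if K: "submodule K R M" and N: "submodule N R M" and eq: "sat P K = sat P N" for K N
  proof -
    have "sat P1 K = sat P1 N" if "primeideal P1 R" "P1 \<subset> P" for P1
      using sat_sat[OF P K that(1)] sat_sat[OF P N that(1)] that(2) eq by (metis psubset_imp_subset)
    then have "tors P K = tors P N"
      by (simp add: tors_def)
    moreover have "N \<subseteq> L" if "L \<in> sats P K" for L
      using sat_least_sats[OF that] sat_superset[OF N P] eq by (simp add: order_trans)
    ultimately show ?thesis
      unfolding sats_def by blast
  qed
  from this[OF K N eq] this[OF N K eq[symmetric]] have "sats P K = sats P N"
    by (rule antisym)
  then show ?thesis
    by (simp add: loc_length_def)
qed

text \<open>Chains above N also count above K, and \<open>sat P K\<close> can be put strictly
  beneath each of them.\<close>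

lemma loc_length_less:
  assumes K: "submodule K R M" and N: "submodule N R M" "K \<subseteq> N" "N \<subseteq> tors P K" and P: "primeideal P R"
    and ne: "sat P N \<noteq> sat P K"
  shows "loc_length P N < loc_length P K"
proof -
  have "has_chain (sats P N) (loc_length P N)"
    using has_chain_sats_iff[OF N(1) P] by simp
  then have "has_chain (sats P K) (Suc (loc_length P N))"
  proof (rule has_chain_Cons)
    show "sat P K \<in> sats P K"
      by (rule sat_in_sats[OF K P])
    show "sats P N \<subseteq> sats P K"
      using tors_eq[OF K N(2,3)] N(2) unfolding sats_def by blast
    show "sat P K \<subset> L" if "L \<in> sats P N" for L
      using sat_least_sats[OF that] sat_mono[OF N(2), of P] ne by blast
  qed
  then show ?thesis
    using has_chain_sats_iff[OF K P] by auto
qed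

lemma loc_length_adjoin:
  assumes K: "submodule K R M" and P: "primeideal P R" and m: "m \<in> carrier M" "colon K m = P"
  shows "loc_length P K - 1 \<le> loc_length P (adjoin K m)"
proof -
  have "has_chain (sats P K) (loc_length P K)"
    using has_chain_sats_iff[OF K P] by simp
  from has_chain_adjoin[OF K P m this] show ?thesis
    using has_chain_sats_iff[OF adjoin_sub[OF K m(1)] P] by simp
qed

section \<open>Coheights of primes containing an annihilator\<close>

text \<open>R/Q is a quotient of R modulo \<open>colon K m\<close>, which is isomorphic to (K + R
  m)/K and hence noetherian. In terms of ideals, J is sent to the submodule formed by K and the
  multiples of m by preimages of J, and this map reflects inclusions.\<close>

lemma conoetherian_prime_above_colon:
  assumes K: "submodule K R M" and m: "m \<in> carrier M" and Q: "primeideal Q R" "colon K m \<subseteq> Q"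
  shows "conoetherian_prime R Q"
proof -
  interpret Q: ideal Q R
    using Q(1) by (rule primeideal.axioms(1))
  interpret S: ring "R Quot Q"
    by (rule Q.quotient_is_ring)
  let ?f = "\<lambda>a. Q +> a"
  note hom = Q.rcos_ring_hom
  define N where "N J = {x. \<exists>k\<in>K. \<exists>a\<in>carrier R. ?f a \<in> J \<and> x = k \<oplus>\<^bsub>M\<^esub> a \<odot>\<^bsub>M\<^esub> m}" for J
  have N_sub: "submodule (N J) R M" if J: "ideal J (R Quot Q)" for J
  proof -
    interpret J: ideal J "R Quot Q"
      by (rule J)
    show ?thesis
    proof (rule submoduleI_smult)
      show "N J \<subseteq> carrier M"
        using m sub_carrier[OF K] by (auto simp: N_def)
      have "?f \<zero> = \<zero>\<^bsub>R Quot Q\<^esub>"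
        by (rule ring_hom_zero[OF hom R.ring_axioms S.ring_axioms])
      then have "?f \<zero> \<in> J"
        using J.zero_closed by simp
      moreover have "\<zero>\<^bsub>M\<^esub> = \<zero>\<^bsub>M\<^esub> \<oplus>\<^bsub>M\<^esub> \<zero> \<odot>\<^bsub>M\<^esub> m"
        using m by simp
      ultimately show "\<zero>\<^bsub>M\<^esub> \<in> N J"
        unfolding N_def using sub_zero[OF K] by blast
    next
      fix x y assume "x \<in> N J" "y \<in> N J"
      then obtain k a l b where x: "k \<in> K" "a \<in> carrier R" "?f a \<in> J" "x = k \<oplus>\<^bsub>M\<^esub> a \<odot>\<^bsub>M\<^esub> m"
        and y: "l \<in> K" "b \<in> carrier R" "?f b \<in> J" "y = l \<oplus>\<^bsub>M\<^esub> b \<odot>\<^bsub>M\<^esub> m"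
        unfolding N_def by blast
      have "k \<in> carrier M" "l \<in> carrier M"
        using x(1) y(1) sub_carrier[OF K] by auto
      then have "x \<oplus>\<^bsub>M\<^esub> y = (k \<oplus>\<^bsub>M\<^esub> l) \<oplus>\<^bsub>M\<^esub> (a \<oplus> b) \<odot>\<^bsub>M\<^esub> m"
        using x(2,4) y(2,4) m by (simp add: smult_l_distr M.a_ac)
      moreover have "?f (a \<oplus> b) \<in> J"
        using ring_hom_add[OF hom x(2) y(2)] J.a_closed[OF x(3) y(3)] by simp
      moreover have "k \<oplus>\<^bsub>M\<^esub> l \<in> K"
        by (rule sub_add[OF K x(1) y(1)])
      ultimately show "x \<oplus>\<^bsub>M\<^esub> y \<in> N J"
        unfolding N_def using x(2) y(2) by blast
    next
      fix c x assume c: "c \<in> carrier R" and "x \<in> N J"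
      then obtain k a where x: "k \<in> K" "a \<in> carrier R" "?f a \<in> J" "x = k \<oplus>\<^bsub>M\<^esub> a \<odot>\<^bsub>M\<^esub> m"
        unfolding N_def by blast
      have "k \<in> carrier M"
        using x(1) sub_carrier[OF K] by auto
      then have "c \<odot>\<^bsub>M\<^esub> x = c \<odot>\<^bsub>M\<^esub> k \<oplus>\<^bsub>M\<^esub> (c \<otimes> a) \<odot>\<^bsub>M\<^esub> m"
        using x(2,4) c m by (simp add: smult_r_distr smult_assoc1)
      moreover have "?f (c \<otimes> a) \<in> J"
        using ring_hom_mult[OF hom c x(2)] J.I_l_closed[OF x(3) ring_hom_closed[OF hom c]] by simp
      moreover have "c \<odot>\<^bsub>M\<^esub> k \<in> K"
        by (rule sub_smult[OF K c x(1)])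
      ultimately show "c \<odot>\<^bsub>M\<^esub> x \<in> N J"
        unfolding N_def using c x(2) by blast
    qed
  qed
  \<comment> \<open>If a m and b m agree modulo K, then a - b lies in \<open>colon K m\<close>,
    hence in Q, and a and b have the same class in R/Q.\<close>
  have N_inj: "J2 \<subseteq> J1" if J: "ideal J1 (R Quot Q)" "ideal J2 (R Quot Q)" "N J2 \<subseteq> N J1" for J1 J2
  proof
    fix c assume c: "c \<in> J2"
    then have "c \<in> carrier (R Quot Q)"
      using ideal.Icarr[OF J(2)] by blast
    then obtain a where a: "a \<in> carrier R" "c = ?f a"
      by (auto simp: FactRing_simps)
    have "a \<odot>\<^bsub>M\<^esub> m = \<zero>\<^bsub>M\<^esub> \<oplus>\<^bsub>M\<^esub> a \<odot>\<^bsub>M\<^esub> m"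
      using a(1) m by simp
    then have "a \<odot>\<^bsub>M\<^esub> m \<in> N J2"
      unfolding N_def using sub_zero[OF K] a c by blast
    then obtain k b where b: "k \<in> K" "b \<in> carrier R" "?f b \<in> J1" "a \<odot>\<^bsub>M\<^esub> m = k \<oplus>\<^bsub>M\<^esub> b \<odot>\<^bsub>M\<^esub> m"
      using J(3) unfolding N_def by blast
    have "k \<in> carrier M"
      by (rule sub_carrier[OF K b(1)])
    then have "(a \<ominus> b) \<odot>\<^bsub>M\<^esub> m = k"
      using a(1) b(2,4) m
      by (simp add: smult_l_distr smult_l_minus R.minus_eq M.a_assoc M.r_neg)
    then have "a \<ominus> b \<in> Q"
      using b(1,2) a(1) Q(2) by (auto simp: colon_def)
    moreover have "a = (a \<ominus> b) \<oplus> b"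
      using a(1) b(2) by (simp add: R.minus_eq R.a_assoc R.l_neg)
    ultimately have "a \<in> Q +> b"
      unfolding a_r_coset_def' by blast
    then have "Q +> b = Q +> a"
      by (rule Q.a_repr_independence'[OF _ b(2)])
    then show "c \<in> J1"
      using a(2) b(3) by simp
  qed
  have "noetherian_ring (R Quot Q)"
  proof (rule S.trivial_ideal_chain_imp_noetherian)
    fix C assume C: "C \<noteq> {}" "subset.chain {I. ideal I (R Quot Q)} C"
    have id: "ideal J (R Quot Q)" if "J \<in> C" for J
      using C(2) that unfolding subset_chain_def by blast
    obtain J0 where "J0 \<in> C"
      using C(1) by blast
    then have "N J0 \<in> N ` C"
      by (rule imageI)
    then obtain L where L: "L \<in> N ` C" "\<And>L'. L' \<in> N ` C \<Longrightarrow> L \<subseteq> L' \<Longrightarrow> L' = L"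
      by (rule noeth_maximal) (use id N_sub in blast, rule that)
    then obtain J where J: "J \<in> C" "L = N J"
      by blast
    have "J' \<subseteq> J" if J': "J' \<in> C" for J'
    proof (rule ccontr)
      assume n: "\<not> J' \<subseteq> J"
      then have "J \<subseteq> J'"
        using C(2) J(1) J' unfolding subset_chain_def by blast
      then have "L \<subseteq> N J'"
        unfolding J(2) N_def by blast
      then have "N J' = L"
        using J' by (intro L(2)) blast+
      then show False
        using n N_inj[OF id[OF J(1)] id[OF J']] J(2) by simp
    qed
    then have "\<Union>C = J"
      using J(1) by blast
    then show "\<Union>C \<in> C"
      using J(1) by simp
  qed
  then show ?thesis
    using Q(1) by (simp add: conoetherian_prime_def)
qed

lemma conoetherian_colon:
  "submodule K R M \<Longrightarrow> m \<in> carrier M \<Longrightarrow> primeideal (colon K m) R \<Longrightarrow> conoetherian_prime R (colon K m)"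
  by (rule conoetherian_prime_above_colon) auto

section \<open>Coheight as a strictly decreasing ordinal function on conoetherian primes\<close>

abbreviation coht :: "'a set \<Rightarrow> ('a + 'c) set ordinal"
  where "coht \<equiv> coheight R"

lemma coht_less:
  assumes "conoetherian_prime R P" and "primeideal Q R" and "P \<subset> Q"
  shows "coht Q < coht P"
proof -
  let ?S = "{osuc (coht Q) | Q. primeideal Q R \<and> P \<subset> Q}"
  \<comment> \<open>There are no more primes than subsets of R, so the family is bounded within this
    ordinal type and \<open>osup\<close> really is an upper bound.\<close>
  have "|?S| \<le>o |UNIV :: 'a set set|"
  proof (rule ordLeq_transitive[OF card_of_mono1 card_of_image[of "\<lambda>Q. osuc (coht Q)" UNIV]])
    show "?S \<subseteq> range (\<lambda>Q. osuc (coht Q))"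
      by blast
  qed
  moreover have "|UNIV :: 'a set set| \<le>o |UNIV :: (('a + 'c) set + nat) set|"
    by (rule card_of_ordLeqI[of "\<lambda>S. Inl (Inl ` S)"]) (auto simp: inj_on_def inj_image_eq_iff)
  ultimately have "|?S| \<le>o |UNIV :: (('a + 'c) set + nat) set|"
    by (rule ordLeq_transitive)
  then have "osuc (coht Q) \<le> osup ?S"
    by (rule osup_upper) (use assms(2,3) in blast)
  then have "osuc (coht Q) \<le> coht P"
    using coheight_rec[OF R.is_cring assms(1), where 'x = "('a + 'c) set"] by simp
  then show ?thesis
    by (simp add: osuc_le_iff)
qed

lemma less_coht:
  assumes "conoetherian_prime R P" and "b < coht P"
  shows "\<exists>Q. primeideal Q R \<and> P \<subset> Q \<and> b \<le> coht Q"
proof -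
  have "b < osup {osuc (coht Q) | Q. primeideal Q R \<and> P \<subset> Q}"
    using coheight_rec[OF R.is_cring assms(1), where 'x = "('a + 'c) set"] assms(2) by simp
  then show ?thesis
    by (blast dest: less_osup less_osuc_iff[THEN iffD1])
qed

section \<open>Small submodules of large local length\<close>

text \<open>For a prime \<open>Q\<close> strictly above \<open>P = colon K m\<close>, these submodules \<open>N\<close> of \<open>E = adjoin K m\<close>
  correspond to the ideals of the local domain \<open>(R/P)\<^sub>Q\<close> of finite colength.\<close>

definition cofinite_subs :: "'a set \<Rightarrow> 'c set \<Rightarrow> 'c set \<Rightarrow> 'c set set"
  where "cofinite_subs Q K E = {N. submodule N R M \<and> K \<subseteq> N \<and> N \<subseteq> E \<and>
    sat Q N \<inter> E \<subseteq> N \<and> E \<subseteq> tors Q N}"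

lemma cofinite_subs_Int:
  assumes Q: "primeideal Q R" and N: "N1 \<in> cofinite_subs Q K E" "N2 \<in> cofinite_subs Q K E"
  shows "N1 \<inter> N2 \<in> cofinite_subs Q K E"
proof -
  have sub: "submodule N1 R M" "submodule N2 R M"
    using N by (auto simp: cofinite_subs_def)
  have "tors Q N1 \<inter> tors Q N2 \<subseteq> tors Q (N1 \<inter> N2)"
    unfolding tors_def using sat_Int[OF sub] by blast
  moreover have "sat Q (N1 \<inter> N2) = sat Q N1 \<inter> sat Q N2"
    by (rule sat_Int[OF sub Q])
  ultimately show ?thesis
    using N sub_Int[OF sub] unfolding cofinite_subs_def by blast
qed

lemma cofinite_subs_self:
  assumes "submodule E R M" and Q: "primeideal Q R" and "K \<subseteq> E"
  shows "E \<in> cofinite_subs Q K E"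
  using assms sat_superset[OF assms(1) Q] sat_subset_tors[of Q E] unfolding cofinite_subs_def by blast

text \<open>A submodule that is maximal among the saturated ones avoiding \<open>f\<close> has simple essential socle
  at \<open>Q\<close>, and this forces finite colength.\<close>

lemma cofinite_subs_avoid:
  assumes E: "submodule E R M" and K: "submodule K R M" "K \<subseteq> E" "sat Q K \<inter> E \<subseteq> K"
    and Q: "primeideal Q R" and f: "f \<notin> K"
  shows "\<exists>N\<in>cofinite_subs Q K E. f \<notin> N"
proof -
  let ?S = "{N. submodule N R M \<and> K \<subseteq> N \<and> N \<subseteq> E \<and> sat Q N \<inter> E \<subseteq> N \<and> f \<notin> N}"
  have "K \<in> ?S"
    using K f by blast
  then obtain N where N: "N \<in> ?S" and max: "\<And>N'. N' \<in> ?S \<Longrightarrow> N \<subseteq> N' \<Longrightarrow> N' = N"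
    by (rule noeth_maximal) (blast, rule that)
  have sub: "submodule N R M" and NE: "K \<subseteq> N" "N \<subseteq> E" "sat Q N \<inter> E \<subseteq> N" "f \<notin> N"
    using N by blast+
  \<comment> \<open>By maximality, f is captured by the saturation of every larger submodule of E:
    at Q its class lies in each nonzero submodule of E/N.\<close>
  have f_in: "f \<in> E \<and> f \<in> sat Q (adjoin N y)" if y: "y \<in> E" "y \<notin> N" for y
  proof (rule ccontr)
    assume nf: "\<not> (f \<in> E \<and> f \<in> sat Q (adjoin N y))"
    have yM: "y \<in> carrier M"
      by (rule sub_carrier[OF E y(1)])
    have adj: "submodule (adjoin N y) R M"
      by (rule adjoin_sub[OF sub yM])
    let ?N = "sat Q (adjoin N y) \<inter> E"
    have adj_le: "adjoin N y \<subseteq> ?N"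
      using sat_superset[OF adj Q] adjoin_least[OF E NE(2) y(1)] by blast
    have "sat Q ?N \<subseteq> sat Q (sat Q (adjoin N y))"
      by (rule sat_mono) blast
    then have "sat Q ?N \<inter> E \<subseteq> ?N"
      using sat_idem[OF Q adj] by blast
    then have "?N \<in> ?S"
      using sub_Int[OF sat_sub[OF adj Q] E] nf adj_le adjoin_superset(1)[OF sub yM] NE(1) by blast
    then have "?N = N"
      using adj_le adjoin_superset(1)[OF sub yM] by (intro max) blast+
    then show False
      using adj_le adjoin_superset(2)[OF sub yM] y(2) by blast
  qed
  \<comment> \<open>If y survived at a prime strictly below Q, then E/N would contain an element z
    whose prime annihilator lies strictly below Q.\<close>
  have "y \<in> sat P1 N" if y: "y \<in> E" and P1: "primeideal P1 R" "P1 \<subset> Q" for y P1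
  proof (rule ccontr)
    assume "y \<notin> sat P1 N"
    then obtain a where a: "a \<in> carrier R" "primeideal (colon N (a \<odot>\<^bsub>M\<^esub> y)) R" "colon N (a \<odot>\<^bsub>M\<^esub> y) \<subseteq> P1"
      using exists_prime_colon_below[OF sub P1(1) sub_carrier[OF E y]] by blast
    define z where "z = a \<odot>\<^bsub>M\<^esub> y"
    have z: "z \<in> E" "z \<in> carrier M"
      using sub_smult[OF E a(1) y] sub_carrier[OF E] by (auto simp: z_def)
    have pz: "primeideal (colon N z) R" "colon N z \<subseteq> P1"
      using a by (simp_all add: z_def)
    have zN: "z \<notin> N"
      using prime_one[OF pz(1)] z(2) by (auto simp: colon_def)
    obtain s where fE: "f \<in> E" and s: "f \<in> carrier M" "s \<in> carrier R" "s \<notin> Q" "s \<odot>\<^bsub>M\<^esub> f \<in> adjoin N z"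
      using f_in[OF z(1) zN] satE by metis
    obtain n c where nc: "n \<in> N" "c \<in> carrier R" "s \<odot>\<^bsub>M\<^esub> f = n \<oplus>\<^bsub>M\<^esub> c \<odot>\<^bsub>M\<^esub> z"
      using s(4) unfolding adjoin_def by blast
    have sf: "s \<odot>\<^bsub>M\<^esub> f \<notin> N"
      using satI[OF s(1-3), of N] NE(3,4) fE by blast
    have cz: "c \<odot>\<^bsub>M\<^esub> z \<notin> N"
    proof
      assume "c \<odot>\<^bsub>M\<^esub> z \<in> N"
      then have "s \<odot>\<^bsub>M\<^esub> f \<in> N"
        unfolding nc(3) by (rule sub_add[OF sub nc(1)])
      with sf show False ..
    qed
    \<comment> \<open>Modulo N, the element s f is a nonzero multiple of z and inherits its
      annihilator.\<close>
    have col: "colon N (s \<odot>\<^bsub>M\<^esub> f) = colon N z"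
      unfolding nc(3) colon_add[OF sub nc(1) smult_closed[OF nc(2) z(2)]]
      by (rule colon_prime_smult[OF sub z(2) pz(1) nc(2) cz])
    \<comment> \<open>Multiplying s f by an element of Q outside this annihilator gives another
      nonzero class, which must capture f once more.\<close>
    obtain q where q: "q \<in> Q" "q \<notin> colon N z"
      using P1(2) pz(2) by blast
    have qR: "q \<in> carrier R"
      by (rule prime_subset[OF Q q(1)])
    have sfE: "s \<odot>\<^bsub>M\<^esub> f \<in> E"
      by (rule sub_smult[OF E s(2) fE])
    have "q \<notin> colon N (s \<odot>\<^bsub>M\<^esub> f)"
      using q(2) by (simp add: col)
    then have "q \<odot>\<^bsub>M\<^esub> (s \<odot>\<^bsub>M\<^esub> f) \<notin> N"
      using qR by (simp add: colon_def)
    then have "f \<in> sat Q (adjoin N (q \<odot>\<^bsub>M\<^esub> (s \<odot>\<^bsub>M\<^esub> f)))"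
      using f_in[OF sub_smult[OF E qR sfE]] by blast
    then obtain t where t: "t \<in> carrier R" "t \<notin> Q" "t \<odot>\<^bsub>M\<^esub> f \<in> adjoin N (q \<odot>\<^bsub>M\<^esub> (s \<odot>\<^bsub>M\<^esub> f))"
      by (rule satE)
    then obtain n' d where d: "n' \<in> N" "d \<in> carrier R" "t \<odot>\<^bsub>M\<^esub> f = n' \<oplus>\<^bsub>M\<^esub> d \<odot>\<^bsub>M\<^esub> (q \<odot>\<^bsub>M\<^esub> (s \<odot>\<^bsub>M\<^esub> f))"
      unfolding adjoin_def by blast
    \<comment> \<open>Nakayama's argument: modulo N, t f = u f with u in Q and t outside Q, so t - u
      is outside Q and kills f. Closedness of N in E then puts f into N.\<close>
    let ?u = "(d \<otimes> s) \<otimes> q"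
    have uR: "?u \<in> carrier R"
      using d(2) s(2) qR by simp
    have uQ: "?u \<in> Q"
      using prime_mult_in[OF Q q(1)] d(2) s(2) by blast
    have n'M: "n' \<in> carrier M"
      by (rule sub_carrier[OF sub d(1)])
    have "t \<odot>\<^bsub>M\<^esub> f = n' \<oplus>\<^bsub>M\<^esub> ?u \<odot>\<^bsub>M\<^esub> f"
    proof -
      have "?u = d \<otimes> (q \<otimes> s)"
        using d(2) s(2) qR by (simp add: R.m_ac)
      then have "?u \<odot>\<^bsub>M\<^esub> f = d \<odot>\<^bsub>M\<^esub> (q \<odot>\<^bsub>M\<^esub> (s \<odot>\<^bsub>M\<^esub> f))"
        using d(2) s(1,2) qR by (simp add: smult_assoc1)
      then show ?thesis
        using d(3) by simp
    qed
    then have "(t \<ominus> ?u) \<odot>\<^bsub>M\<^esub> f = n'"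
      using t(1) uR s(1) n'M
      by (simp add: smult_l_distr smult_l_minus R.minus_eq M.a_assoc M.r_neg)
    moreover have "t \<ominus> ?u \<notin> Q"
    proof
      assume "t \<ominus> ?u \<in> Q"
      then have "(t \<ominus> ?u) \<oplus> ?u \<in> Q"
        using uQ additive_subgroup.a_closed[OF ideal.axioms(1)[OF primeideal.axioms(1)[OF Q]]] by blast
      moreover have "(t \<ominus> ?u) \<oplus> ?u = t"
        using t(1) uR by (simp add: R.minus_eq R.a_assoc R.l_neg)
      ultimately show False
        using t(2) by simp
    qed
    ultimately have "f \<in> sat Q N"
      using d(1) s(1) t(1) uR by (intro satI[of _ "t \<ominus> ?u"]) auto
    then show False
      using NE(3,4) fE by blast
  qed
  then have "E \<subseteq> tors Q N"
    unfolding tors_def using sub_carrier[OF E] by blast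
  then show ?thesis
    using sub NE unfolding cofinite_subs_def by blast
qed

text \<open>The members of \<open>cofinite_subs\<close> are closed under finite intersection, and
  every element outside K is avoided by one of them, but K itself is never a member. So one can pass
  to strictly smaller members indefinitely while avoiding F, and each descent lengthens the chain
  above.\<close>

lemma large_loc_length:
  assumes K: "submodule K R M" and m: "m \<in> carrier M" and P: "primeideal (colon K m) R"
    and Q: "primeideal Q R" "colon K m \<subset> Q" and F: "finite F" "F \<inter> K = {}"
  shows "\<exists>N. submodule N R M \<and> K \<subset> N \<and> N \<subseteq> adjoin K m \<and> N \<inter> F = {} \<and> n \<le> loc_length Q N"
proof -
  let ?E = "adjoin K m" and ?C = "cofinite_subs Q K (adjoin K m)"
  have E: "submodule ?E R M" and KE: "K \<subseteq> ?E"
    using adjoin_sub[OF K m] adjoin_superset[OF K m] by auto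
  \<comment> \<open>E/K is a copy of R/P, in which an element outside Q, hence outside P, is not a
    zero divisor.\<close>
  have closed: "sat Q K \<inter> ?E \<subseteq> K"
  proof
    fix x assume x: "x \<in> sat Q K \<inter> ?E"
    then obtain s where s: "s \<in> carrier R" "s \<notin> Q" "s \<odot>\<^bsub>M\<^esub> x \<in> K"
      by (auto elim: satE)
    obtain k a where ka: "k \<in> K" "a \<in> carrier R" "x = k \<oplus>\<^bsub>M\<^esub> a \<odot>\<^bsub>M\<^esub> m"
      using x unfolding adjoin_def by blast
    have kM: "k \<in> carrier M"
      by (rule sub_carrier[OF K ka(1)])
    have "s \<odot>\<^bsub>M\<^esub> k \<oplus>\<^bsub>M\<^esub> (s \<otimes> a) \<odot>\<^bsub>M\<^esub> m \<in> K"
      using s kM ka(2,3) m by (simp add: smult_r_distr smult_assoc1)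
    then have "(s \<otimes> a) \<odot>\<^bsub>M\<^esub> m \<in> K"
      using sub_add_cancel[OF K sub_smult[OF K s(1) ka(1)]] s(1) ka(2) m by simp
    then have "s \<otimes> a \<in> colon K m"
      using s(1) ka(2) by (simp add: colon_def)
    then have "a \<in> colon K m"
      using primeideal.I_prime[OF P s(1) ka(2)] s(2) Q(2) by blast
    then show "x \<in> K"
      unfolding ka(3) using sub_add[OF K ka(1)] by (simp add: colon_def)
  qed
  have C_sub: "submodule N R M" "K \<subseteq> N" "N \<subseteq> ?E" if "N \<in> ?C" for N
    using that by (auto simp: cofinite_subs_def)
  \<comment> \<open>Membership of K would make m vanish at P = \<open>colon K m\<close>, although no
    element outside P sends m into K.\<close>
  have C_ne: "N \<noteq> K" if "N \<in> ?C" for N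
  proof
    assume "N = K"
    then have "m \<in> tors Q K"
      using that adjoin_superset(2)[OF K m] by (auto simp: cofinite_subs_def)
    then have "m \<in> sat (colon K m) K"
      by (rule torsD[OF _ P Q(2)])
    then show False
      by (elim satE) (simp add: colon_def)
  qed
  have avoid: "\<exists>N\<in>?C. N \<inter> F = {}"
    using F
  proof (induction rule: finite_induct)
    case empty
    then show ?case
      using cofinite_subs_self[OF E Q(1) KE] by blast
  next
    case (insert f F)
    then obtain N1 where N1: "N1 \<in> ?C" "N1 \<inter> F = {}"
      by blast
    obtain N2 where N2: "N2 \<in> ?C" "f \<notin> N2"
      using cofinite_subs_avoid[OF E K KE closed Q(1), of f] insert.prems by blast
    then show ?case
      using cofinite_subs_Int[OF Q(1) N1(1) N2(1)] N1(2) N2(2) by blast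
  qed
  have "\<exists>N\<in>?C. N \<inter> F = {} \<and> has_chain {N' \<in> ?C. N \<subseteq> N'} n"
  proof (induction n)
    case 0
    then show ?case
      using avoid unfolding has_chain_0 by blast
  next
    case (Suc n)
    then obtain N where N: "N \<in> ?C" "N \<inter> F = {}" "has_chain {N' \<in> ?C. N \<subseteq> N'} n"
      by blast
    \<comment> \<open>Any element of N outside K can serve to make the next intersection strictly
      smaller.\<close>
    obtain f where f: "f \<in> N" "f \<notin> K"
      using C_ne[OF N(1)] C_sub(2)[OF N(1)] by blast
    obtain N2 where N2: "N2 \<in> ?C" "f \<notin> N2"
      using cofinite_subs_avoid[OF E K KE closed Q(1) f(2)] by blast
    let ?N = "N \<inter> N2"
    have C: "?N \<in> ?C"
      by (rule cofinite_subs_Int[OF Q(1) N(1) N2(1)])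
    have "has_chain {N' \<in> ?C. ?N \<subseteq> N'} (Suc n)"
    proof (rule has_chain_Cons[OF N(3)])
      show "?N \<in> {N' \<in> ?C. ?N \<subseteq> N'}"
        using C by blast
      show "?N \<subset> A" if "A \<in> {N' \<in> ?C. N \<subseteq> N'}" for A
        using that f(1) N2(2) by blast
    qed blast
    then show ?case
      using C N(2) by blast
  qed
  then obtain N where N: "N \<in> ?C" "N \<inter> F = {}" "has_chain {N' \<in> ?C. N \<subseteq> N'} n"
    by blast
  note sub = C_sub(1)[OF N(1)]
  \<comment> \<open>Saturation keeps these inclusions strict because each member is recovered as the
    trace of its saturation on E.\<close>
  have "has_chain (sats Q N) n"
  proof (rule has_chain_image[OF N(3), of "sat Q"])
    show "sat Q ` {N' \<in> ?C. N \<subseteq> N'} \<subseteq> sats Q N"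
    proof
      fix L assume "L \<in> sat Q ` {N' \<in> ?C. N \<subseteq> N'}"
      then obtain N' where N': "N' \<in> ?C" "N \<subseteq> N'" "L = sat Q N'"
        by blast
      note sub' = C_sub(1)[OF N'(1)]
      have "N' \<subseteq> tors Q N"
        using N(1) C_sub(3)[OF N'(1)] unfolding cofinite_subs_def by blast
      then have "sat Q N' \<subseteq> tors Q N"
        using sat_mono[of N' "tors Q N" Q] sat_tors[OF Q(1) sub] by simp
      then show "L \<in> sats Q N"
        unfolding N'(3) sats_def
        using sat_sub[OF sub' Q(1)] sat_idem[OF Q(1) sub'] sat_superset[OF sub' Q(1)] N'(2) by blast
    qed
    fix A B assume A: "A \<in> {N' \<in> ?C. N \<subseteq> N'}" and B: "B \<in> {N' \<in> ?C. N \<subseteq> N'}" and AB: "A \<subset> B"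
    obtain x where x: "x \<in> B" "x \<notin> A"
      using AB by blast
    have "x \<in> ?E" "sat Q A \<inter> ?E \<subseteq> A"
      using x(1) A B unfolding cofinite_subs_def by blast+
    then have "x \<notin> sat Q A"
      using x(2) by blast
    moreover have "x \<in> sat Q B"
      using sat_superset[of B Q] C_sub(1)[of B] B Q(1) x(1) by blast
    moreover have "sat Q A \<subseteq> sat Q B"
      using AB by (intro sat_mono) blast
    ultimately show "sat Q A \<subset> sat Q B"
      by blast
  qed
  then have "n \<le> loc_length Q N"
    by (simp add: has_chain_sats_iff[OF sub Q(1)])
  then show ?thesis
    using C_sub[OF N(1)] C_ne[OF N(1)] N(2) by blast
qed

section \<open>The rank of a submodule\<close>

definition weight :: "'c set \<Rightarrow> ('a + 'c) set ordinal \<Rightarrow> nat"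
  where "weight K \<alpha> =
    (\<Sum>P | conoetherian_prime R P \<and> coht P = \<alpha> \<and> loc_length P K \<noteq> 0. loc_length P K)"

definition submodule_rank :: "'c set \<Rightarrow> ('a + 'c) set ordinal"
  where "submodule_rank K = cantor_sum (\<lambda>\<gamma>. weight K (ordinal_shift \<gamma>))"

lemma conoetherian_prime_prime: "conoetherian_prime R P \<Longrightarrow> primeideal P R"
  by (simp add: conoetherian_prime_def)

lemma loc_length_support:
  assumes "submodule K R M" "primeideal P R" "loc_length P K \<noteq> 0"
  shows "P \<in> assoc_primes K"
  using loc_length_nonzero_assoc[OF assms] assms(2) unfolding assoc_primes_def by blast

lemma assoc_prime_conoetherian:
  assumes "submodule K R M" "P \<in> assoc_primes K"
  shows "conoetherian_prime R P"
  using assms conoetherian_colon[OF assms(1)] unfolding assoc_primes_def by blast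

text \<open>The support of \<open>loc_length\<close> depends on K. Over a common finite index set S,
  the weights of two submodules can be compared term by term.\<close>

lemma weight_eq:
  assumes K: "submodule K R M" and S: "finite S" "assoc_primes K \<subseteq> S"
  shows "weight K \<alpha> = (\<Sum>P\<in>{P \<in> S. conoetherian_prime R P \<and> coht P = \<alpha>}. loc_length P K)"
  unfolding weight_def
proof (rule sum.mono_neutral_left)
  show "finite {P \<in> S. conoetherian_prime R P \<and> coht P = \<alpha>}"
    using S(1) by simp
  show "{P. conoetherian_prime R P \<and> coht P = \<alpha> \<and> loc_length P K \<noteq> 0} \<subseteq>
      {P \<in> S. conoetherian_prime R P \<and> coht P = \<alpha>}"
    using loc_length_support[OF K] conoetherian_prime_prime S(2) by blast
qed blast

lemma finite_weight:
  assumes K: "submodule K R M"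
  shows "finite {\<gamma>. weight K (ordinal_shift \<gamma>) \<noteq> 0}"
proof (rule finite_subset)
  show "{\<gamma>. weight K (ordinal_shift \<gamma>) \<noteq> 0} \<subseteq> ordinal_shift -` (coht ` assoc_primes K)"
  proof
    fix \<gamma> assume "\<gamma> \<in> {\<gamma>. weight K (ordinal_shift \<gamma>) \<noteq> 0}"
    then have "weight K (ordinal_shift \<gamma>) \<noteq> 0"
      by simp
    then obtain P where "conoetherian_prime R P" "coht P = ordinal_shift \<gamma>" "loc_length P K \<noteq> 0"
      unfolding weight_def by (metis (mono_tags, lifting) mem_Collect_eq sum.not_neutral_contains_not_neutral)
    then show "\<gamma> \<in> ordinal_shift -` (coht ` assoc_primes K)"
      using loc_length_support[OF K] conoetherian_prime_prime by force
  qed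
  have "inj (ordinal_shift :: ('a + 'c) set ordinal \<Rightarrow> _)"
    by (rule linorder_injI) (metis ordinal_shift_strict_mono less_irrefl)
  then show "finite (ordinal_shift -` (coht ` assoc_primes K))"
    using finite_assoc_primes[OF K] by (intro finite_vimageI finite_imageI)
qed

lemma submodule_rank_less:
  assumes K: "submodule K R M" and N: "submodule N R M" "K \<subset> N"
    and top: "\<And>x. x \<in> N \<Longrightarrow> primeideal (colon K x) R \<Longrightarrow> \<exists>Q. primeideal Q R \<and> colon K x \<subset> Q"
  shows "submodule_rank N < submodule_rank K"
proof -
  \<comment> \<open>These are the associated primes of N/K; by assumption none of them is maximal
    among the primes.\<close>
  define A where "A = {colon K x | x. x \<in> N \<and> primeideal (colon K x) R}"
  have A_assoc: "A \<subseteq> assoc_primes K"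
    using sub_carrier[OF N(1)] unfolding A_def assoc_primes_def by blast
  then have fin: "finite A"
    using finite_assoc_primes[OF K] finite_subset by blast
  have A_prime: "conoetherian_prime R P" "primeideal P R" if "P \<in> A" for P
    using assoc_prime_conoetherian[OF K] conoetherian_prime_prime A_assoc that by blast+
  have below: "\<exists>P\<in>A. P \<subseteq> Q" if "x \<in> N" "primeideal Q R" "x \<notin> sat Q K" for x Q
    using exists_prime_colon_below[OF K that(2) sub_carrier[OF N(1) that(1)] that(3)]
      sub_smult[OF N(1) _ that(1)] unfolding A_def by blast
  obtain x0 where x0: "x0 \<in> N" "x0 \<notin> K"
    using N(2) by blast
  have "A \<noteq> {}"
    using exists_prime_colon[OF K sub_carrier[OF N(1) x0(1)] x0(2)] sub_smult[OF N(1) _ x0(1)]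
    unfolding A_def by blast
  then have "Max (coht ` A) \<in> coht ` A"
    using fin by (intro Max_in) auto
  then obtain P where P: "P \<in> A" "coht P = Max (coht ` A)"
    by auto
  have max: "coht Q \<le> coht P" if "Q \<in> A" for Q
    using P(2) fin that by simp
  obtain Q where "primeideal Q R" "P \<subset> Q"
    using P(1) top unfolding A_def by blast
  \<comment> \<open>Only a positive coheight corresponds to an exponent of the normal form.\<close>
  then have "0 < coht P"
    using coht_less[OF A_prime(1)[OF P(1)]] ordinal_zero_le le_less_trans by metis
  then obtain \<gamma> where \<gamma>: "ordinal_shift \<gamma> = coht P"
    by (rule ordinal_shift_surj)
  \<comment> \<open>If N/K survived at such a Q, some associated prime would lie below Q, strictly
    since Q is not in A, and would have greater coheight than P.\<close>
  have sat_eq: "sat Q N = sat Q K" if Q: "conoetherian_prime R Q" "coht P \<le> coht Q" "Q \<notin> A" for Q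
  proof
    note Qp = conoetherian_prime_prime[OF Q(1)]
    have "x \<in> sat Q K" if x: "x \<in> N" for x
    proof (rule ccontr)
      assume "x \<notin> sat Q K"
      then obtain P' where P': "P' \<in> A" "P' \<subseteq> Q"
        using below[OF x Qp] by blast
      then have "P' \<subset> Q"
        using Q(3) by blast
      then have "coht Q < coht P'"
        by (rule coht_less[OF A_prime(1)[OF P'(1)] Qp])
      then show False
        using max[OF P'(1)] Q(2) by simp
    qed
    then have "N \<subseteq> sat Q K"
      by blast
    then show "sat Q N \<subseteq> sat Q K"
      using sat_mono sat_idem[OF Qp K] by metis
    show "sat Q K \<subseteq> sat Q N"
      using N(2) by (intro sat_mono) blast
  qed
  have len_eq: "loc_length Q N = loc_length Q K"
    if "conoetherian_prime R Q" "coht P \<le> coht Q" "Q \<notin> A" for Q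
    using loc_length_sat_cong[OF N(1) K conoetherian_prime_prime[OF that(1)]] sat_eq[OF that] by blast
  \<comment> \<open>No member of A lies strictly below a Q of maximal coheight, so N/K vanishes at
    all primes strictly below Q and has finite length there. It is nonzero at Q because Q
    annihilates one of its elements exactly.\<close>
  have len_less: "loc_length Q N < loc_length Q K"
    if Q: "Q \<in> A" "coht Q = coht P" for Q
  proof (rule loc_length_less[OF K N(1) psubset_imp_subset[OF N(2)] _ A_prime(2)[OF Q(1)]])
    note Qp = A_prime(2)[OF Q(1)]
    show "N \<subseteq> tors Q K"
    proof
      fix y assume y: "y \<in> N"
      have "y \<in> sat P1 K" if P1: "primeideal P1 R" "P1 \<subset> Q" for P1
      proof (rule ccontr)
        assume "y \<notin> sat P1 K"
        then obtain P' where P': "P' \<in> A" "P' \<subseteq> P1"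
          using below[OF y P1(1)] by blast
        then have "coht Q < coht P'"
          using P1(2) by (intro coht_less[OF A_prime(1)[OF P'(1)] Qp]) blast
        then show False
          using max[OF P'(1)] Q(2) by simp
      qed
      then show "y \<in> tors Q K"
        using sub_carrier[OF N(1) y] unfolding tors_def by blast
    qed
    obtain x where x: "x \<in> N" "Q = colon K x"
      using Q(1) unfolding A_def by blast
    have "x \<notin> sat Q K"
      unfolding x(2) by (auto elim!: satE simp: colon_def)
    moreover have "x \<in> sat Q N"
      using sat_superset[OF N(1) Qp] x(1) by blast
    ultimately show "sat Q N \<noteq> sat Q K"
      by blast
  qed
  let ?S = "assoc_primes K \<union> assoc_primes N"
  have S: "finite ?S" "assoc_primes K \<subseteq> ?S" "assoc_primes N \<subseteq> ?S"
    using finite_assoc_primes K N(1) by auto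
  note w = weight_eq[OF N(1) S(1,3)] weight_eq[OF K S(1,2)]
  show ?thesis
    unfolding submodule_rank_def
  proof (rule cantor_sum_less[where \<alpha> = \<gamma>])
    show "weight N (ordinal_shift \<beta>) = weight K (ordinal_shift \<beta>)" if "\<gamma> < \<beta>" for \<beta>
      unfolding w
    proof (rule sum.cong[OF refl])
      have *: "coht P < ordinal_shift \<beta>"
        using ordinal_shift_strict_mono[OF that] by (simp add: \<gamma>)
      fix Q assume Q: "Q \<in> {P \<in> ?S. conoetherian_prime R P \<and> coht P = ordinal_shift \<beta>}"
      then have "Q \<notin> A"
        using max[of Q] * by auto
      then show "loc_length Q N = loc_length Q K"
        using Q * by (intro len_eq) auto
    qed
    show "weight N (ordinal_shift \<gamma>) < weight K (ordinal_shift \<gamma>)"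
      unfolding w \<gamma>
    proof (rule sum_strict_mono_ex1)
      show "\<forall>Q\<in>{Q \<in> ?S. conoetherian_prime R Q \<and> coht Q = coht P}. loc_length Q N \<le> loc_length Q K"
        using len_eq len_less by (metis (mono_tags, lifting) less_imp_le mem_Collect_eq order_refl)
      have "P \<in> {Q \<in> ?S. conoetherian_prime R Q \<and> coht Q = coht P}"
        using P(1) A_assoc A_prime(1) by blast
      then show "\<exists>Q\<in>{Q \<in> ?S. conoetherian_prime R Q \<and> coht Q = coht P}. loc_length Q N < loc_length Q K"
        using len_less[OF P(1) refl] by blast
    qed (use S(1) in simp)
  qed (use finite_weight K N(1) in auto)
qed

lemma submodule_rank_approx:
  assumes K: "submodule K R M" and b: "b < submodule_rank K" and F: "finite F" "F \<inter> K = {}"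
  shows "\<exists>N. submodule N R M \<and> K \<subset> N \<and> N \<inter> F = {} \<and> b \<le> submodule_rank N"
proof -
  define g where "g \<gamma> = weight K (ordinal_shift \<gamma>)" for \<gamma>
  have rank_K: "submodule_rank K = cantor_sum g"
    by (simp add: submodule_rank_def g_def[abs_def])
  have fg: "finite {\<beta>. g \<beta> \<noteq> 0}"
    using finite_weight[OF K] by (simp add: g_def)
  have "\<exists>\<gamma>. g \<gamma> \<noteq> 0"
  proof (rule ccontr)
    assume "\<not> ?thesis"
    then have "g = (\<lambda>_. 0)"
      by auto
    then show False
      using b rank_K ordinal_zero_le[of b] by (simp add: cantor_sum_zero)
  qed
  then obtain \<gamma>0 where \<gamma>0: "g \<gamma>0 \<noteq> 0" ..
  define \<gamma> where "\<gamma> = (LEAST \<gamma>. g \<gamma> \<noteq> 0)"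
  have \<gamma>: "g \<gamma> \<noteq> 0" "\<And>\<beta>. \<beta> < \<gamma> \<Longrightarrow> g \<beta> = 0"
    unfolding \<gamma>_def by (rule LeastI[of _ \<gamma>0], rule \<gamma>0) (metis not_less_Least)
  from \<gamma>(1) obtain P where P: "conoetherian_prime R P" "coht P = ordinal_shift \<gamma>" "loc_length P K \<noteq> 0"
    unfolding g_def weight_def
    by (metis (mono_tags, lifting) mem_Collect_eq sum.not_neutral_contains_not_neutral)
  note Pp = conoetherian_prime_prime[OF P(1)]
  obtain m where m: "m \<in> carrier M" "colon K m = P"
    by (rule loc_length_nonzero_assoc[OF K Pp P(3)])
  \<comment> \<open>The two extremes are all that is available: near P the module (K + R m)/K is
    simple, and away from the primes containing P it is zero.\<close>
  have weight_N: "(\<forall>\<beta>>\<gamma>. weight N (ordinal_shift \<beta>) = g \<beta>) \<and> g \<gamma> - 1 \<le> weight N (ordinal_shift \<gamma>)"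
    if N: "submodule N R M" "K \<subset> N" "N \<subseteq> adjoin K m" for N
  proof -
    let ?S = "insert P (assoc_primes K \<union> assoc_primes N)"
    have S: "finite ?S" "assoc_primes K \<subseteq> ?S" "assoc_primes N \<subseteq> ?S"
      using finite_assoc_primes K N(1) by auto
    note w = weight_eq[OF N(1) S(1,3)] weight_eq[OF K S(1,2)]
    have adj: "submodule (adjoin K m) R M"
      by (rule adjoin_sub[OF K m(1)])
    \<comment> \<open>An element of P outside Q sends m into K, so at Q both K and K + R m, and
      hence N between them, have the same localization.\<close>
    have len_eq: "loc_length Q N = loc_length Q K" if Q: "primeideal Q R" "\<not> P \<subseteq> Q" for Q
    proof (rule loc_length_sat_cong[OF N(1) K Q(1)])
      obtain p where p: "p \<in> P" "p \<notin> Q"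
        using Q(2) by blast
      then have "p \<in> carrier R" "p \<odot>\<^bsub>M\<^esub> m \<in> K"
        using m(2) by (auto simp: colon_def)
      then have "m \<in> sat Q K"
        using p(2) m(1) by (intro satI[of _ p])
      then have "adjoin K m \<subseteq> sat Q K"
        by (intro adjoin_least[OF sat_sub[OF K Q(1)] sat_superset[OF K Q(1)]])
      then have "sat Q N \<subseteq> sat Q K"
        using N(3) sat_mono[of N "sat Q K" Q] sat_idem[OF Q(1) K] by simp
      then show "sat Q N = sat Q K"
        using sat_mono[of K N Q] N(2) by blast
    qed
    have nle: "\<not> P \<subseteq> Q" if "primeideal Q R" "coht P \<le> coht Q" "Q \<noteq> P" for Q
      using coht_less[OF P(1) that(1)] that(2,3) by (auto simp: psubset_eq)
    \<comment> \<open>An element of N outside K has the form k + a m with \<open>a\<close> outside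
      P. So m lies in the saturation of N, which then contains all of K + R m.\<close>
    have "loc_length P N = loc_length P (adjoin K m)"
    proof (rule loc_length_sat_cong[OF N(1) adj Pp])
      obtain x where x: "x \<in> N" "x \<notin> K"
        using N(2) by blast
      then obtain k a where ka: "k \<in> K" "a \<in> carrier R" "x = k \<oplus>\<^bsub>M\<^esub> a \<odot>\<^bsub>M\<^esub> m"
        using N(3) unfolding adjoin_def by blast
      have "k \<in> N"
        using ka(1) N(2) by blast
      then have am: "a \<odot>\<^bsub>M\<^esub> m \<in> N"
        using sub_add_cancel[OF N(1) _ smult_closed[OF ka(2) m(1)]] x(1) ka(3) by metis
      have "a \<odot>\<^bsub>M\<^esub> m \<notin> K"
        using x(2) ka(3) sub_add[OF K ka(1)] by metis
      then have "a \<notin> P"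
        using m(2) by (auto simp: colon_def)
      then have "m \<in> sat P N"
        by (rule satI[OF m(1) ka(2) _ am])
      then have "adjoin K m \<subseteq> sat P N"
        using N(2) sat_superset[OF N(1) Pp] by (intro adjoin_least[OF sat_sub[OF N(1) Pp]]) blast+
      then have "sat P (adjoin K m) \<subseteq> sat P N"
        using sat_mono[of "adjoin K m" "sat P N" P] sat_idem[OF Pp N(1)] by simp
      then show "sat P N = sat P (adjoin K m)"
        using sat_mono[OF N(3)] by blast
    qed
    then have len_P: "loc_length P K - 1 \<le> loc_length P N"
      using loc_length_adjoin[OF K Pp m] by simp
    have "weight N (ordinal_shift \<beta>) = g \<beta>" if "\<gamma> < \<beta>" for \<beta>
      unfolding g_def w
    proof (rule sum.cong[OF refl])
      have *: "coht P < ordinal_shift \<beta>"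
        using ordinal_shift_strict_mono[OF that] by (simp add: P(2))
      fix Q assume Q: "Q \<in> {Q \<in> ?S. conoetherian_prime R Q \<and> coht Q = ordinal_shift \<beta>}"
      then have "primeideal Q R" "coht P \<le> coht Q" "Q \<noteq> P"
        using * conoetherian_prime_prime by auto
      then show "loc_length Q N = loc_length Q K"
        using nle len_eq by blast
    qed
    moreover have "g \<gamma> \<le> weight N (ordinal_shift \<gamma>) + 1"
    proof -
      let ?Y = "{Q \<in> ?S. conoetherian_prime R Q \<and> coht Q = ordinal_shift \<gamma>}"
      have fY: "finite ?Y" and PY: "P \<in> ?Y"
        using S(1) P by auto
      \<comment> \<open>Among the primes of this coheight only P can lose length, and it loses at
        most one.\<close>
      have "loc_length Q K \<le> loc_length Q N + (if Q = P then 1 else 0)" if "Q \<in> ?Y" for Q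
      proof (cases "Q = P")
        case True
        then show ?thesis
          using len_P by simp
      next
        case False
        then have "loc_length Q N = loc_length Q K"
          using that P(2) conoetherian_prime_prime by (intro len_eq nle) auto
        then show ?thesis
          by simp
      qed
      then have "(\<Sum>Q\<in>?Y. loc_length Q K) \<le> (\<Sum>Q\<in>?Y. loc_length Q N + (if Q = P then 1 else 0))"
        by (rule sum_mono)
      also have "\<dots> = (\<Sum>Q\<in>?Y. loc_length Q N) + 1"
        unfolding sum.distrib sum.delta[OF fY] using PY by simp
      finally show ?thesis
        unfolding g_def w .
    qed
    ultimately show ?thesis
      by simp
  qed
  have P': "primeideal (colon K m) R"
    using Pp m(2) by simp
  show ?thesis
    using cantor_sum_approx[OF fg \<gamma> b[unfolded rank_K]]
  proof
    assume b': "b \<le> cantor_sum (g(\<gamma> := g \<gamma> - 1))"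
    \<comment> \<open>P has positive coheight, so there is a prime strictly above it. It only serves
      to make N small, and length 0 suffices.\<close>
    obtain Q where Q: "primeideal Q R" "colon K m \<subset> Q"
      using less_coht[OF P(1), of 0] ordinal_shift_pos[of \<gamma>] P(2) m(2) by auto
    obtain N where N: "submodule N R M" "K \<subset> N" "N \<subseteq> adjoin K m" "N \<inter> F = {}"
      using large_loc_length[OF K m(1) P' Q F, of 0] by (elim exE conjE)
    have "cantor_sum (g(\<gamma> := g \<gamma> - 1)) \<le> submodule_rank N"
      unfolding submodule_rank_def
    proof (rule cantor_sum_mono)
      show "finite {\<beta>. (g(\<gamma> := g \<gamma> - 1)) \<beta> \<noteq> 0}"
        by (rule finite_subset[OF _ fg]) (use \<gamma>(1) in auto)
      show "(g(\<gamma> := g \<gamma> - 1)) \<beta> \<le> weight N (ordinal_shift \<beta>)" for \<beta>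
      proof (cases \<beta> \<gamma> rule: linorder_cases)
        case less
        then show ?thesis
          using \<gamma>(2)[OF less] by simp
      qed (use weight_N[OF N(1-3)] in auto)
    qed (rule finite_weight[OF N(1)])
    then show ?thesis
      using b' N order_trans by blast
  next
    assume "\<exists>\<zeta><\<gamma>. \<exists>n. b \<le> cantor_sum (g(\<gamma> := g \<gamma> - 1, \<zeta> := n))"
    then obtain \<zeta> n where \<zeta>: "\<zeta> < \<gamma>" and b': "b \<le> cantor_sum (g(\<gamma> := g \<gamma> - 1, \<zeta> := n))"
      by blast
    have "ordinal_shift \<zeta> < coht P"
      using ordinal_shift_strict_mono[OF \<zeta>] P(2) by simp
    \<comment> \<open>The coheight of Q may exceed \<open>ordinal_shift \<zeta>\<close>. Its
      exponent \<zeta>' then satisfies \<zeta> \<le> \<zeta>' < \<gamma>, and a large coefficient at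
      \<zeta>' does even better than one at \<zeta>.\<close>
    then obtain Q where Q: "primeideal Q R" "P \<subset> Q" "ordinal_shift \<zeta> \<le> coht Q"
      using less_coht[OF P(1)] by blast
    have "0 < coht Q"
      using ordinal_shift_pos Q(3) by (rule less_le_trans)
    then obtain \<zeta>' where \<zeta>': "ordinal_shift \<zeta>' = coht Q"
      by (rule ordinal_shift_surj)
    have "\<zeta> \<le> \<zeta>'"
      using ordinal_shift_strict_mono[of \<zeta>' \<zeta>] Q(3) \<zeta>'
      by (cases \<zeta>' \<zeta> rule: linorder_cases) simp_all
    have "\<zeta>' < \<gamma>"
    proof -
      have "ordinal_shift \<zeta>' < ordinal_shift \<gamma>"
        using coht_less[OF P(1) Q(1,2)] P(2) \<zeta>' by simp
      then show ?thesis
        using ordinal_shift_strict_mono[of \<gamma> \<zeta>'] by (cases \<zeta>' \<gamma> rule: linorder_cases) simp_all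
    qed
    have Q': "colon K m \<subset> Q"
      using Q(2) m(2) by simp
    \<comment> \<open>One more than n, so that the coefficient at \<zeta>' strictly exceeds n also
      when \<zeta>' = \<zeta>.\<close>
    obtain N where N: "submodule N R M" "K \<subset> N" "N \<subseteq> adjoin K m" "N \<inter> F = {}"
        "Suc n \<le> loc_length Q N"
      using large_loc_length[OF K m(1) P' Q(1) Q' F, of "Suc n"] by (elim exE conjE)
    have Qc: "conoetherian_prime R Q"
      by (rule conoetherian_prime_above_colon[OF K m(1) Q(1)]) (use Q' in blast)
    have "loc_length Q N \<le> weight N (coht Q)"
    proof -
      let ?Y = "{P \<in> insert Q (assoc_primes N). conoetherian_prime R P \<and> coht P = coht Q}"
      have fin: "finite (insert Q (assoc_primes N))"
        using finite_assoc_primes[OF N(1)] by simp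
      have "loc_length Q N \<le> (\<Sum>P\<in>?Y. loc_length P N)"
        by (rule member_le_sum) (use Qc fin in auto)
      then show ?thesis
        unfolding weight_eq[OF N(1) fin subset_insertI] .
    qed
    then have big: "n < weight N (ordinal_shift \<zeta>')"
      using N(5) \<zeta>' by simp
    have "cantor_sum (g(\<gamma> := g \<gamma> - 1, \<zeta> := n)) < submodule_rank N"
      unfolding submodule_rank_def
    proof (rule cantor_sum_less_if_dominated[where \<alpha> = \<zeta>'])
      show "finite {\<beta>. (g(\<gamma> := g \<gamma> - 1, \<zeta> := n)) \<beta> \<noteq> 0}"
        by (rule finite_subset[OF _ finite.insertI[OF fg, of \<zeta>]]) (use \<gamma>(1) in auto)
      show "(g(\<gamma> := g \<gamma> - 1, \<zeta> := n)) \<beta> \<le> weight N (ordinal_shift \<beta>)" if "\<zeta>' < \<beta>" for \<beta>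
      proof (cases \<beta> \<gamma> rule: linorder_cases)
        case less
        then show ?thesis
          using \<gamma>(2)[OF less] that \<open>\<zeta> \<le> \<zeta>'\<close> by auto
      qed (use weight_N[OF N(1-3)] that \<open>\<zeta> \<le> \<zeta>'\<close> \<zeta> in auto)
      show "(g(\<gamma> := g \<gamma> - 1, \<zeta> := n)) \<zeta>' < weight N (ordinal_shift \<zeta>')"
        using \<gamma>(2)[OF \<open>\<zeta>' < \<gamma>\<close>] \<open>\<zeta>' < \<gamma>\<close> big by auto
    qed (rule finite_weight[OF N(1)])
    then show ?thesis
      using b' N less_imp_le order_trans by meson
  qed
qed

section \<open>Isolating a submodule\<close>

abbreviation coset :: "'c set \<Rightarrow> 'c \<Rightarrow> 'c set"
  where "coset K x \<equiv> K +>\<^bsub>M\<^esub> x"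

lemma quotient_carrier: "carrier (quotient_module (M\<lparr>carrier := S\<rparr>) K) = coset K ` S"
  by (auto simp: quotient_module_def A_RCOSETS_def' a_r_coset_def')

lemma sub_abelian_subgroup: "submodule K R M \<Longrightarrow> abelian_subgroup K M"
  by (intro abelian_subgroupI3 additive_subgroup.intro submodule.axioms(1)) (auto intro: M.abelian_group_axioms)

lemma coset_self: "submodule K R M \<Longrightarrow> x \<in> carrier M \<Longrightarrow> x \<in> coset K x"
  by (rule abelian_subgroup.a_rcos_self[OF sub_abelian_subgroup])

lemma coset_eq: "submodule K R M \<Longrightarrow> x \<in> carrier M \<Longrightarrow> y \<in> coset K x \<Longrightarrow> coset K y = coset K x"
  by (rule abelian_subgroup.a_repr_independence'[OF sub_abelian_subgroup, symmetric])

lemma coset_eq_zero: "submodule K R M \<Longrightarrow> x \<in> K \<Longrightarrow> coset K x = K"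
  by (rule abelian_subgroup.a_rcos_const[OF sub_abelian_subgroup])

text \<open>The correspondence theorem in the direction that brings a descending sequence in S/K
  back to submodules of M between K and S.\<close>

lemma quotient_submodule:
  assumes K: "submodule K R M" and S: "submodule S R M" "K \<subseteq> S"
    and N: "submodule N R (quotient_module (M\<lparr>carrier := S\<rparr>) K)"
  defines "U \<equiv> {x \<in> S. coset K x \<in> N}"
  shows "submodule U R M" and "K \<subseteq> U" and "U \<subseteq> S" and "coset K ` U = N"
proof -
  let ?Q = "quotient_module (M\<lparr>carrier := S\<rparr>) K"
  have Q_add: "C \<oplus>\<^bsub>?Q\<^esub> D = C <+>\<^bsub>M\<^esub> D" for C D
    by (auto simp: quotient_module_def set_add_def')
  have Q_smult: "a \<odot>\<^bsub>?Q\<^esub> C = (\<Union>x\<in>C. coset K (a \<odot>\<^bsub>M\<^esub> x))" for a C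
    by (auto simp: quotient_module_def a_r_coset_def')
  have sg: "subgroup N (add_monoid ?Q)"
    by (rule submodule.axioms(1)[OF N])
  have N_carrier: "N \<subseteq> coset K ` S"
    using subgroup.subset[OF sg] quotient_carrier by simp
  have "\<zero>\<^bsub>?Q\<^esub> \<in> N"
    using subgroup.one_closed[OF sg] by simp
  then have KN: "K \<in> N"
    by (simp add: quotient_module_def)
  show KU: "K \<subseteq> U"
    using S(2) KN coset_eq_zero[OF K] unfolding U_def by auto
  show US: "U \<subseteq> S"
    by (auto simp: U_def)
  show "coset K ` U = N"
    using N_carrier unfolding U_def by blast
  have SM: "x \<in> carrier M" if "x \<in> S" for x
    by (rule sub_carrier[OF S(1) that])
  show "submodule U R M"
  proof (rule submoduleI_smult)
    show "U \<subseteq> carrier M"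
      using US SM by blast
    show "\<zero>\<^bsub>M\<^esub> \<in> U"
      using KU sub_zero[OF K] by blast
  next
    fix x y assume xy: "x \<in> U" "y \<in> U"
    then have "coset K x \<oplus>\<^bsub>?Q\<^esub> coset K y \<in> N"
      using subgroup.m_closed[OF sg] by (simp add: U_def)
    moreover have "coset K x \<oplus>\<^bsub>?Q\<^esub> coset K y = coset K (x \<oplus>\<^bsub>M\<^esub> y)"
      unfolding Q_add using xy US SM by (intro abelian_subgroup.a_rcos_sum[OF sub_abelian_subgroup[OF K]]) auto
    ultimately show "x \<oplus>\<^bsub>M\<^esub> y \<in> U"
      using xy sub_add[OF S(1)] by (simp add: U_def)
  next
    fix a x assume a: "a \<in> carrier R" and x: "x \<in> U"
    have xM: "x \<in> carrier M"
      using x US SM by blast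
    \<comment> \<open>Scalar multiplication on the quotient is a union over all representatives;
      they all give the same coset, so the union collapses.\<close>
    have "coset K (a \<odot>\<^bsub>M\<^esub> y) = coset K (a \<odot>\<^bsub>M\<^esub> x)" if y: "y \<in> coset K x" for y
    proof -
      obtain k where k: "k \<in> K" "y = k \<oplus>\<^bsub>M\<^esub> x"
        using y unfolding a_r_coset_def' by blast
      have "a \<odot>\<^bsub>M\<^esub> y = a \<odot>\<^bsub>M\<^esub> k \<oplus>\<^bsub>M\<^esub> a \<odot>\<^bsub>M\<^esub> x"
        unfolding k(2) using a sub_carrier[OF K k(1)] xM by (rule smult_r_distr)
      then have "a \<odot>\<^bsub>M\<^esub> y \<in> coset K (a \<odot>\<^bsub>M\<^esub> x)"
        unfolding a_r_coset_def' using sub_smult[OF K a k(1)] by blast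
      then show ?thesis
        using a xM by (intro coset_eq[OF K]) simp_all
    qed
    then have "a \<odot>\<^bsub>?Q\<^esub> coset K x = coset K (a \<odot>\<^bsub>M\<^esub> x)"
      unfolding Q_smult by (intro UN_constant_eq[OF coset_self[OF K xM]] ballI)
    moreover have "a \<odot>\<^bsub>?Q\<^esub> coset K x \<in> N"
      using submodule.smult_closed[OF N a] x by (simp add: U_def)
    ultimately show "a \<odot>\<^bsub>M\<^esub> x \<in> U"
      using x sub_smult[OF S(1) a] by (simp add: U_def)
  qed
qed

lemma annihilated_sub:
  assumes K: "submodule K R M" and P: "P \<subseteq> carrier R"
  shows "submodule {x \<in> carrier M. P \<subseteq> colon K x} R M"
proof (rule submoduleI_smult)
  show "\<zero>\<^bsub>M\<^esub> \<in> {x \<in> carrier M. P \<subseteq> colon K x}"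
    using P sub_zero[OF K] by (auto simp: colon_def)
next
  fix x y assume "x \<in> {x \<in> carrier M. P \<subseteq> colon K x}" "y \<in> {x \<in> carrier M. P \<subseteq> colon K x}"
  then show "x \<oplus>\<^bsub>M\<^esub> y \<in> {x \<in> carrier M. P \<subseteq> colon K x}"
    using sub_add[OF K] by (auto simp: colon_def subset_eq smult_r_distr)
next
  fix a x assume a: "a \<in> carrier R" and x: "x \<in> {x \<in> carrier M. P \<subseteq> colon K x}"
  have "p \<odot>\<^bsub>M\<^esub> (a \<odot>\<^bsub>M\<^esub> x) \<in> K" if p: "p \<in> P" for p
  proof -
    have "p \<odot>\<^bsub>M\<^esub> (a \<odot>\<^bsub>M\<^esub> x) = a \<odot>\<^bsub>M\<^esub> (p \<odot>\<^bsub>M\<^esub> x)"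
      using a x p P by (auto simp: smult_assoc1[symmetric] R.m_comm)
    moreover have "p \<odot>\<^bsub>M\<^esub> x \<in> K"
      using x p by (auto simp: colon_def)
    ultimately show ?thesis
      using sub_smult[OF K a] by simp
  qed
  then show "a \<odot>\<^bsub>M\<^esub> x \<in> {x \<in> carrier M. P \<subseteq> colon K x}"
    using a x P by (auto simp: colon_def)
qed blast

text \<open>R/P is a field, so S/K is a noetherian vector space and has finite length. In the
  present terms, submodules between K and S are recovered from their saturations at P, which bounds
  chains by \<open>loc_length P K\<close>.\<close>

lemma artinian_annihilated:
  assumes K: "submodule K R M" and P: "primeideal P R"
    and top: "\<And>Q. primeideal Q R \<Longrightarrow> \<not> P \<subset> Q"
  defines "S \<equiv> {x \<in> carrier M. P \<subseteq> colon K x}"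
  shows "submodule S R M" and "K \<subseteq> S"
    and "artinian_module R (quotient_module (M\<lparr>carrier := S\<rparr>) K)"
proof -
  have P_carrier: "P \<subseteq> carrier R"
    using prime_subset[OF P] by blast
  show S: "submodule S R M"
    unfolding S_def by (rule annihilated_sub[OF K P_carrier])
  show KS: "K \<subseteq> S"
    using sub_smult[OF K] sub_carrier[OF K] P_carrier by (auto simp: S_def colon_def)
  have "S \<subseteq> tors P K"
  proof
    fix x assume x: "x \<in> S"
    have "x \<in> sat P1 K" if P1: "P1 \<subset> P" for P1
    proof -
      obtain p where p: "p \<in> P" "p \<notin> P1"
        using P1 by blast
      then have "p \<in> carrier R" "p \<odot>\<^bsub>M\<^esub> x \<in> K"
        using x by (auto simp: S_def colon_def)
      then show ?thesis
        using p(2) x by (intro satI[of _ p]) (auto simp: S_def)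
    qed
    then show "x \<in> tors P K"
      using x by (simp add: tors_def S_def)
  qed
  then have sat_S: "sat P N \<subseteq> tors P K" if "N \<subseteq> S" for N
    using sat_mono[of N "tors P K" P] sat_tors[OF P K] that by simp
  \<comment> \<open>If x were outside N, some multiple of x would have a prime annihilator modulo N
    containing P as well as s, hence strictly above P.\<close>
  have closed: "x \<in> N" if N: "submodule N R M" "K \<subseteq> N" and x: "x \<in> S" "x \<in> sat P N" for x N
  proof (rule ccontr)
    assume "x \<notin> N"
    obtain s where s: "x \<in> carrier M" "s \<in> carrier R" "s \<notin> P" "s \<odot>\<^bsub>M\<^esub> x \<in> N"
      using x(2) by (rule satE)
    obtain a where a: "a \<in> carrier R" "primeideal (colon N (a \<odot>\<^bsub>M\<^esub> x)) R"
      using exists_prime_colon[OF N(1) s(1) \<open>x \<notin> N\<close>] by blast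
    have colon_a: "t \<in> colon N (a \<odot>\<^bsub>M\<^esub> x)" if t: "t \<in> carrier R" "t \<odot>\<^bsub>M\<^esub> x \<in> N" for t
    proof -
      have "t \<odot>\<^bsub>M\<^esub> (a \<odot>\<^bsub>M\<^esub> x) = a \<odot>\<^bsub>M\<^esub> (t \<odot>\<^bsub>M\<^esub> x)"
        using t(1) a(1) s(1) by (simp add: smult_assoc1[symmetric] R.m_comm)
      then show ?thesis
        using sub_smult[OF N(1) a(1) t(2)] t(1) by (simp add: colon_def)
    qed
    have "P \<subseteq> colon N (a \<odot>\<^bsub>M\<^esub> x)"
    proof
      fix p assume "p \<in> P"
      then have "p \<in> carrier R" "p \<odot>\<^bsub>M\<^esub> x \<in> K"
        using x(1) by (auto simp: S_def colon_def)
      then show "p \<in> colon N (a \<odot>\<^bsub>M\<^esub> x)"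
        using N(2) by (intro colon_a) auto
    qed
    then show False
      using top[OF a(2)] colon_a[OF s(2,4)] s(3) by blast
  qed
  define \<N> where "\<N> = {N. submodule N R M \<and> K \<subseteq> N \<and> N \<subseteq> S}"
  have bound: "n \<le> loc_length P K" if "has_chain \<N> n" for n
  proof -
    have "has_chain (sats P K) n"
    proof (rule has_chain_image[OF that, of "sat P"])
      show "sat P ` \<N> \<subseteq> sats P K"
      proof
        fix L assume "L \<in> sat P ` \<N>"
        then obtain N where N: "submodule N R M" "K \<subseteq> N" "N \<subseteq> S" "L = sat P N"
          unfolding \<N>_def by blast
        then show "L \<in> sats P K"
          unfolding sats_def
          using sat_sub[OF N(1) P] sat_idem[OF P N(1)] sat_superset[OF N(1) P] sat_S[OF N(3)] by blast
      qed
      fix A B assume A: "A \<in> \<N>" and B: "B \<in> \<N>" and AB: "A \<subset> B"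
      have A': "submodule A R M" "K \<subseteq> A" and B': "submodule B R M" "B \<subseteq> S"
        using A B by (auto simp: \<N>_def)
      obtain x where x: "x \<in> B" "x \<notin> A"
        using AB by blast
      have "x \<notin> sat P A"
        using closed[OF A', of x] x B'(2) by blast
      moreover have "x \<in> sat P B"
        using sat_superset[OF B'(1) P] x(1) by blast
      moreover have "sat P A \<subseteq> sat P B"
        using AB by (intro sat_mono) blast
      ultimately show "sat P A \<subset> sat P B"
        by blast
    qed
    then show ?thesis
      using has_chain_sats_iff[OF K P] by blast
  qed
  show "artinian_module R (quotient_module (M\<lparr>carrier := S\<rparr>) K)"
    unfolding artinian_module_def
  proof (intro allI impI)
    fix N :: "nat \<Rightarrow> 'c set set"
    assume N: "\<forall>i. submodule (N i) R (quotient_module (M\<lparr>carrier := S\<rparr>) K) \<and> N (Suc i) \<subseteq> N i"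
    define U where "U i = {x \<in> S. coset K x \<in> N i}" for i
    have U: "submodule (U i) R M" "K \<subseteq> U i" "U i \<subseteq> S" "coset K ` U i = N i" for i
      using quotient_submodule[OF K S KS, of "N i"] N unfolding U_def by blast+
    have "\<exists>n. \<forall>i\<ge>n. U i = U n"
    proof (rule decreasing_stabilizes)
      show "n \<le> loc_length P K" if "has_chain \<N> n" for n
        by (rule bound[OF that])
      show "U i \<in> \<N>" for i
        using U(1-3) unfolding \<N>_def by blast
      show "U (Suc i) \<subseteq> U i" for i
        using N unfolding U_def by blast
    qed
    then show "\<exists>n. \<forall>i\<ge>n. N i = N n"
      using U(4) by metis
  qed
qed

text \<open>For an associated prime P that is maximal among the primes, the elements of M/K
  annihilated by P form an artinian subquotient, finite by assumption. Excluding its nonzero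
  elements leaves only N whose associated primes over K are not maximal, and for these the rank
  drops.\<close>

lemma isolating_finite_set:
  assumes K: "submodule K R M"
    and fin: "\<And>S. submodule S R M \<Longrightarrow> K \<subseteq> S \<Longrightarrow>
      artinian_module R (quotient_module (M\<lparr>carrier := S\<rparr>) K) \<Longrightarrow>
      finite (carrier (quotient_module (M\<lparr>carrier := S\<rparr>) K))"
  shows "\<exists>F. finite F \<and> F \<subseteq> carrier M \<and> F \<inter> K = {} \<and>
    (\<forall>N. submodule N R M \<longrightarrow> K \<subset> N \<longrightarrow> N \<inter> F = {} \<longrightarrow> submodule_rank N < submodule_rank K)"
proof -
  define T where "T = {P \<in> assoc_primes K. \<forall>Q. primeideal Q R \<longrightarrow> \<not> P \<subset> Q}"
  define S where "S P = {x \<in> carrier M. P \<subseteq> colon K x}" for P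
  define r where "r C = (SOME x. x \<in> C)" for C :: "'c set"
  have T_prime: "primeideal P R" "\<And>Q. primeideal Q R \<Longrightarrow> \<not> P \<subset> Q" if "P \<in> T" for P
    using that unfolding T_def assoc_primes_def by blast+
  \<comment> \<open>One representative per nonzero coset is enough: N contains K, so it contains a
    whole coset as soon as it meets it.\<close>
  define F where "F = (\<Union>P\<in>T. r ` (coset K ` S P - {K}))"
  have r: "r C \<in> C" "coset K (r C) = C" if C: "P \<in> T" "C \<in> coset K ` S P" for P C
  proof -
    obtain x where x: "x \<in> carrier M" "C = coset K x"
      using C(2) unfolding S_def by blast
    then have "x \<in> C"
      using coset_self[OF K] by simp
    then show "r C \<in> C"
      unfolding r_def by (rule someI)
    then show "coset K (r C) = C"
      unfolding x(2) by (rule coset_eq[OF K x(1)])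
  qed
  have "finite (coset K ` S P)" if "P \<in> T" for P
    using fin[of "S P"] artinian_annihilated[OF K T_prime(1)[OF that] T_prime(2)[OF that]]
    unfolding S_def quotient_carrier by blast
  moreover have "finite T"
    using finite_assoc_primes[OF K] by (simp add: T_def)
  ultimately have "finite F"
    unfolding F_def by blast
  moreover have "F \<subseteq> carrier M"
  proof
    fix y assume "y \<in> F"
    then obtain P C where PC: "P \<in> T" "C \<in> coset K ` S P" "y = r C"
      unfolding F_def by blast
    then have "y \<in> C"
      using r(1) by blast
    moreover have "C \<subseteq> carrier M"
      using PC(2) sub_carrier[OF K] by (auto simp: S_def a_r_coset_def')
    ultimately show "y \<in> carrier M"
      by blast
  qed
  moreover have "F \<inter> K = {}"
    unfolding F_def using r(2) coset_eq_zero[OF K] by fastforce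
  moreover have "submodule_rank N < submodule_rank K"
    if N: "submodule N R M" "K \<subset> N" "N \<inter> F = {}" for N
  proof (rule submodule_rank_less[OF K N(1,2)])
    fix x assume x: "x \<in> N" and P: "primeideal (colon K x) R"
    show "\<exists>Q. primeideal Q R \<and> colon K x \<subset> Q"
    proof (rule ccontr)
      assume "\<nexists>Q. primeideal Q R \<and> colon K x \<subset> Q"
      then have T: "colon K x \<in> T"
        using sub_carrier[OF N(1) x] P unfolding T_def assoc_primes_def by blast
      have xM: "x \<in> carrier M"
        by (rule sub_carrier[OF N(1) x])
      have C: "coset K x \<in> coset K ` S (colon K x)"
        using xM by (auto simp: S_def)
      have "x \<notin> K"
        using prime_one[OF P] xM by (auto simp: colon_def)
      then have "coset K x \<noteq> K"
        using coset_self[OF K xM] by blast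
      then have "r (coset K x) \<in> F"
        unfolding F_def using T C by blast
      moreover obtain k where "k \<in> K" "r (coset K x) = k \<oplus>\<^bsub>M\<^esub> x"
        using r(1)[OF T C] unfolding a_r_coset_def' by blast
      then have "r (coset K x) \<in> N"
        using N(2) x sub_add[OF N(1)] by auto
      ultimately show False
        using N(3) by blast
    qed
  qed
  ultimately show ?thesis
    by blast
qed

section \<open>The space of submodules\<close>

lemma topspace_submodule_topology: "topspace (submodule_topology R M) = {N. submodule N R M}"
  by (auto simp: submodule_topology_def topspace_pullback_topology)

lemma openin_submodule_topology_basic:
  assumes F: "finite F1" "finite F2" "F1 \<subseteq> carrier M" "F2 \<subseteq> carrier M" "F1 \<inter> F2 = {}"
  shows "openin (submodule_topology R M) {N. submodule N R M \<and> F1 \<subseteq> N \<and> N \<inter> F2 = {}}"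
  unfolding submodule_topology_def openin_pullback_topology
proof (intro exI conjI)
  let ?U = "\<lambda>m. if m \<in> F1 then {True} else if m \<in> F2 then {False} else UNIV"
  let ?f = "\<lambda>N. \<lambda>m\<in>carrier M. m \<in> N"
  have "finite {m \<in> carrier M. ?U m \<noteq> UNIV}"
    by (rule finite_subset[of _ "F1 \<union> F2"]) (use F in auto)
  then show "openin (product_topology (\<lambda>_. discrete_topology (UNIV :: bool set)) (carrier M)) (Pi\<^sub>E (carrier M) ?U)"
    by (simp add: openin_PiE_gen)
  have "?f N \<in> Pi\<^sub>E (carrier M) ?U \<longleftrightarrow> F1 \<subseteq> N \<and> N \<inter> F2 = {}" for N
  proof
    assume *: "?f N \<in> Pi\<^sub>E (carrier M) ?U"
    have "m \<in> N" if "m \<in> F1" for m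
      using PiE_mem[OF *, of m] that F(3) by auto
    moreover have "m \<notin> N" if "m \<in> F2" for m
    proof -
      have "m \<notin> F1" "m \<in> carrier M"
        using that F(4,5) by auto
      then show ?thesis
        using PiE_mem[OF *, of m] that by simp
    qed
    ultimately show "F1 \<subseteq> N \<and> N \<inter> F2 = {}"
      by blast
  next
    assume *: "F1 \<subseteq> N \<and> N \<inter> F2 = {}"
    show "?f N \<in> Pi\<^sub>E (carrier M) ?U"
    proof (rule PiE_I)
      fix m assume "m \<in> carrier M"
      then show "?f N m \<in> ?U m"
        using * by auto
    qed simp
  qed
  then show "{N. submodule N R M \<and> F1 \<subseteq> N \<and> N \<inter> F2 = {}} = ?f -` Pi\<^sub>E (carrier M) ?U \<inter> {N. submodule N R M}"
    by auto
qed

text \<open>For N above K, the conditions of a basic neighbourhood that demand membership hold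
  automatically, so only finitely many elements to be avoided remain.\<close>

lemma openin_submodule_topology_nbhd:
  assumes "openin (submodule_topology R M) V" and "K \<in> V"
  shows "\<exists>F. finite F \<and> F \<inter> K = {} \<and> (\<forall>N. submodule N R M \<longrightarrow> K \<subseteq> N \<longrightarrow> N \<inter> F = {} \<longrightarrow> N \<in> V)"
proof -
  let ?f = "\<lambda>N. \<lambda>m\<in>carrier M. m \<in> N"
  obtain W where W: "openin (product_topology (\<lambda>_. discrete_topology (UNIV :: bool set)) (carrier M)) W"
      and V: "V = ?f -` W \<inter> {N. submodule N R M}"
    using assms(1) unfolding submodule_topology_def openin_pullback_topology by blast
  have "?f K \<in> W"
    using assms(2) V by blast
  then obtain U where U: "finite {m \<in> carrier M. U m \<noteq> UNIV}" "?f K \<in> Pi\<^sub>E (carrier M) U" "Pi\<^sub>E (carrier M) U \<subseteq> W"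
    using W unfolding openin_product_topology_alt by (auto simp del: restrict_PiE_iff)
  let ?F = "{m \<in> carrier M. U m \<noteq> UNIV} - K"
  have "N \<in> V" if N: "submodule N R M" "K \<subseteq> N" "N \<inter> ?F = {}" for N
  proof -
    have "?f N \<in> Pi\<^sub>E (carrier M) U"
    proof (rule PiE_I)
      fix m assume m: "m \<in> carrier M"
      show "?f N m \<in> U m"
      proof (cases "U m = UNIV")
        case False
        then have "m \<in> N \<longleftrightarrow> m \<in> K"
          using N(2,3) m by blast
        then show ?thesis
          using PiE_mem[OF U(2) m] m by simp
      qed simp
    qed simp
    then show ?thesis
      using U(3) N(1) unfolding V by blast
  qed
  then show ?thesis
    using U(1) by (intro exI[of _ ?F] conjI) auto
qed

lemma quotient_module_zero: "ring.zero (quotient_module M K) = K"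
  by (simp add: quotient_module_def)

lemma module_CB_rank_eq:
  assumes fin: "\<And>K S. submodule K R M \<Longrightarrow> submodule S R M \<Longrightarrow> K \<subseteq> S \<Longrightarrow>
      artinian_module R (quotient_module (M\<lparr>carrier := S\<rparr>) K) \<Longrightarrow>
      finite (carrier (quotient_module (M\<lparr>carrier := S\<rparr>) K))"
  shows "module_CB_rank R M = Some (submodule_rank {\<zero>\<^bsub>M\<^esub>})"
proof -
  let ?T = "quotient_topology R M" and ?rk = "\<lambda>Y. submodule_rank (ring.zero Y)"
  let ?A = "{quotient_module M K | K. submodule K R M}"
  have top: "topspace ?T = ?A"
    by (auto simp: quotient_topology_def topspace_pullback_topology topspace_submodule_topology
        quotient_module_zero)
  have "CB_layer ?T \<alpha> = {x \<in> topspace ?T. ?rk x = \<alpha>}" for \<alpha>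
  proof (rule CB_layer_eq_rank)
    fix x assume "x \<in> topspace ?T"
    then obtain K where K: "submodule K R M" "x = quotient_module M K"
      unfolding top by blast
    obtain F2 where F2: "finite F2" "F2 \<subseteq> carrier M" "F2 \<inter> K = {}"
      and less: "\<And>N. submodule N R M \<Longrightarrow> K \<subset> N \<Longrightarrow> N \<inter> F2 = {} \<Longrightarrow> submodule_rank N < submodule_rank K"
      using isolating_finite_set[OF K(1) fin[OF K(1)]] by blast
    \<comment> \<open>Requiring N to contain finitely many generators of K is an open condition that
      restricts the neighbourhood to submodules above K.\<close>
    obtain F1 where F1: "finite F1" "F1 \<subseteq> K" "\<And>N. submodule N R M \<Longrightarrow> F1 \<subseteq> N \<Longrightarrow> K \<subseteq> N"
      by (rule finitely_generated[OF K(1)], rule that)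
    let ?V = "{N. submodule N R M \<and> F1 \<subseteq> N \<and> N \<inter> F2 = {}}"
    have "openin (submodule_topology R M) ?V"
      using F1(2) sub_carrier[OF K(1)] F2 by (intro openin_submodule_topology_basic F1(1)) auto
    then have "openin ?T (ring.zero -` ?V \<inter> ?A)"
      unfolding quotient_topology_def openin_pullback_topology by blast
    moreover have "x \<in> ring.zero -` ?V \<inter> ?A"
      using K F1(2) F2(3) by (auto simp: quotient_module_zero)
    moreover have "?rk y < ?rk x" if y: "y \<in> ring.zero -` ?V \<inter> ?A - {x}" for y
    proof -
      obtain N where N: "submodule N R M" "y = quotient_module M N"
        using y by blast
      then have "F1 \<subseteq> N" "N \<inter> F2 = {}" "N \<noteq> K"
        using y K(2) by (auto simp: quotient_module_zero)
      then have "submodule_rank N < submodule_rank K"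
        using F1(3)[OF N(1)] by (intro less[OF N(1)]) auto
      then show ?thesis
        by (simp add: N(2) K(2) quotient_module_zero)
    qed
    ultimately show "\<exists>U. openin ?T U \<and> x \<in> U \<and> (\<forall>y\<in>U - {x}. ?rk y < ?rk x)"
      by blast
  next
    fix x U b assume "x \<in> topspace ?T" and U: "openin ?T U" "x \<in> U" and b: "b < ?rk x"
    then obtain K where K: "submodule K R M" "x = quotient_module M K"
      unfolding top by blast
    obtain V where V: "openin (submodule_topology R M) V" "U = ring.zero -` V \<inter> ?A"
      using U(1) unfolding quotient_topology_def openin_pullback_topology by blast
    have "K \<in> V"
      using U(2) unfolding V(2) K(2) by (simp add: quotient_module_zero)
    then obtain F where F: "finite F" "F \<inter> K = {}"
      and sub: "\<forall>N. submodule N R M \<longrightarrow> K \<subseteq> N \<longrightarrow> N \<inter> F = {} \<longrightarrow> N \<in> V"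
      using openin_submodule_topology_nbhd[OF V(1)] by metis
    have "b < submodule_rank K"
      using b by (simp add: K(2) quotient_module_zero)
    then obtain N where N: "submodule N R M" "K \<subset> N" "N \<inter> F = {}" "b \<le> submodule_rank N"
      using submodule_rank_approx[OF K(1) _ F] by metis
    have "N \<in> V"
      using sub N(1,3) psubset_imp_subset[OF N(2)] by blast
    then have "quotient_module M N \<in> U"
      unfolding V(2) using N(1) by (auto simp: quotient_module_zero)
    moreover have "quotient_module M N \<noteq> x"
      using N(2) quotient_module_zero unfolding K(2) by (metis psubset_eq)
    ultimately show "\<exists>y\<in>U - {x}. b \<le> ?rk y"
      using N(4) by (intro bexI[of _ "quotient_module M N"]) (simp_all add: quotient_module_zero)
  qed
  moreover have "quotient_module M {\<zero>\<^bsub>M\<^esub>} \<in> topspace ?T"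
    unfolding top using zero_sub by blast
  ultimately have "CB_rank (quotient_module M {\<zero>\<^bsub>M\<^esub>}) ?T = Some (?rk (quotient_module M {\<zero>\<^bsub>M\<^esub>}))"
    by (rule CB_rank_eq_rank)
  then show ?thesis
    by (simp add: module_CB_rank_def quotient_module_zero)
qed

end

section \<open>Fractions\<close>

locale prime_localization = noetherian_mod +
  fixes P
  assumes prime: "primeideal P R"
begin

abbreviation D :: "'a set"
  where "D \<equiv> carrier R - P"

abbreviation fr :: "'a \<Rightarrow> 'a \<Rightarrow> ('a \<times> 'a) set"
  where "fr \<equiv> fraction R P"

abbreviation L :: "('a \<times> 'a) set ring"
  where "L \<equiv> localization R P"

lemma D_closed: "s \<in> D \<Longrightarrow> s \<in> carrier R"
  by simp

lemma D_one: "\<one> \<in> D"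
  using prime_one[OF prime] by simp

lemma D_mult: "s \<in> D \<Longrightarrow> t \<in> D \<Longrightarrow> s \<otimes> t \<in> D"
  by (rule prime_mult_notin[OF prime])

lemma fraction_rel_iff: "((a, s), (b, t)) \<in> fraction_rel R P \<longleftrightarrow>
    a \<in> carrier R \<and> s \<in> D \<and> b \<in> carrier R \<and> t \<in> D \<and> (\<exists>u\<in>D. u \<otimes> (a \<otimes> t) = u \<otimes> (b \<otimes> s))"
  by (simp add: fraction_rel_def)

lemma equiv_fraction_rel: "equiv (carrier R \<times> D) (fraction_rel R P)"
proof (rule equivI)
  show "refl_on (carrier R \<times> D) (fraction_rel R P)"
  proof (rule refl_onI)
    fix x assume x: "x \<in> carrier R \<times> D"
    obtain a s where "x = (a, s)"
      by (cases x)
    then show "(x, x) \<in> fraction_rel R P"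
      using D_one x by (auto simp: fraction_rel_iff)
  qed
  show "fraction_rel R P \<subseteq> (carrier R \<times> D) \<times> (carrier R \<times> D)"
    by (auto simp: fraction_rel_def)
  show "sym (fraction_rel R P)"
  proof (rule symI)
    fix x y assume xy: "(x, y) \<in> fraction_rel R P"
    obtain a s b t where "x = (a, s)" "y = (b, t)"
      by (cases x, cases y)
    then show "(y, x) \<in> fraction_rel R P"
      using xy unfolding fraction_rel_iff by (metis fraction_rel_iff)
  qed
  show "trans (fraction_rel R P)"
  proof (rule transI)
    fix x y z assume xyz: "(x, y) \<in> fraction_rel R P" "(y, z) \<in> fraction_rel R P"
    obtain a s b t c w where e: "x = (a, s)" "y = (b, t)" "z = (c, w)"
      by (cases x, cases y, cases z)
    obtain u where u: "u \<in> D" "u \<otimes> (a \<otimes> t) = u \<otimes> (b \<otimes> s)"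
      using xyz(1) unfolding e fraction_rel_iff by blast
    obtain v where v: "v \<in> D" "v \<otimes> (b \<otimes> w) = v \<otimes> (c \<otimes> t)"
      using xyz(2) unfolding e fraction_rel_iff by blast
    have m: "a \<in> carrier R" "b \<in> carrier R" "c \<in> carrier R" "s \<in> D" "t \<in> D" "w \<in> D"
      using xyz unfolding e fraction_rel_iff by blast+
    note cl = m u(1) v(1) D_closed[OF m(4)] D_closed[OF m(5)] D_closed[OF m(6)] D_closed[OF u(1)] D_closed[OF v(1)]
    \<comment> \<open>The witness combines both given ones with the middle denominator t, which has
      to be cancelled.\<close>
    have "(u \<otimes> v \<otimes> t) \<otimes> (a \<otimes> w) = (v \<otimes> w) \<otimes> (u \<otimes> (a \<otimes> t))"
      using cl by (simp add: R.m_ac)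
    also have "\<dots> = (v \<otimes> w) \<otimes> (u \<otimes> (b \<otimes> s))"
      by (simp only: u(2))
    also have "\<dots> = (u \<otimes> s) \<otimes> (v \<otimes> (b \<otimes> w))"
      using cl by (simp add: R.m_ac)
    also have "\<dots> = (u \<otimes> s) \<otimes> (v \<otimes> (c \<otimes> t))"
      by (simp only: v(2))
    also have "\<dots> = (u \<otimes> v \<otimes> t) \<otimes> (c \<otimes> s)"
      using cl by (simp add: R.m_ac)
    finally show "(x, z) \<in> fraction_rel R P"
      unfolding e fraction_rel_iff using m D_mult[OF D_mult[OF u(1) v(1)] m(5)] by blast
  qed
qed

lemma fr_eq_iff:
  assumes "a \<in> carrier R" "s \<in> D" "b \<in> carrier R" "t \<in> D"
  shows "fr a s = fr b t \<longleftrightarrow> (\<exists>u\<in>D. u \<otimes> (a \<otimes> t) = u \<otimes> (b \<otimes> s))"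
proof -
  have "fr a s = fr b t \<longleftrightarrow> ((a, s), (b, t)) \<in> fraction_rel R P"
    unfolding fraction_def using assms by (intro eq_equiv_class_iff[OF equiv_fraction_rel]) auto
  then show ?thesis
    using assms unfolding fraction_rel_iff by blast
qed

lemma fr_eqI:
  assumes "a \<in> carrier R" "s \<in> D" "b \<in> carrier R" "t \<in> D" "a \<otimes> t = b \<otimes> s"
  shows "fr a s = fr b t"
  unfolding fr_eq_iff[OF assms(1-4)] using D_one assms(5) by metis

lemma L_carrier: "carrier L = {fr a s | a s. a \<in> carrier R \<and> s \<in> D}"
  unfolding localization_def fraction_def quotient_def by auto

lemma fr_closed: "a \<in> carrier R \<Longrightarrow> s \<in> D \<Longrightarrow> fr a s \<in> carrier L"
  unfolding L_carrier by blast

lemma L_cases: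
  assumes "c \<in> carrier L"
  obtains a s where "a \<in> carrier R" "s \<in> D" "c = fr a s"
  using assms unfolding L_carrier by blast

lemma fr_mem: "(a', s') \<in> fr a s \<longleftrightarrow> ((a, s), (a', s')) \<in> fraction_rel R P"
  by (simp add: fraction_def)

lemma fr_self: "a \<in> carrier R \<Longrightarrow> s \<in> D \<Longrightarrow> (a, s) \<in> fr a s"
  unfolding fr_mem fraction_rel_iff using D_one by blast

text \<open>The operations of the localization are unions over representatives; once the values do
  not depend on the choice, such a union is its common value.\<close>

lemma UN_fr_fr:
  assumes as: "a \<in> carrier R" "s \<in> D" "b \<in> carrier R" "t \<in> D"
    and const: "\<And>a' s' b' t'. (a', s') \<in> fr a s \<Longrightarrow> (b', t') \<in> fr b t \<Longrightarrow> f a' s' b' t' = C"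
  shows "(\<Union>(a, s)\<in>fr a s. \<Union>(b, t)\<in>fr b t. f a s b t) = C"
proof (rule UN_constant_eq[OF fr_self[OF as(1,2)]], rule ballI)
  fix x assume x: "x \<in> fr a s"
  obtain a' s' where x': "x = (a', s')"
    by (cases x)
  have "(\<Union>(b, t)\<in>fr b t. f a' s' b t) = C"
  proof (rule UN_constant_eq[OF fr_self[OF as(3,4)]], rule ballI)
    fix y assume "y \<in> fr b t"
    then show "(case y of (b, t) \<Rightarrow> f a' s' b t) = C"
      using const x x' by (cases y) simp
  qed
  then show "(case x of (a, s) \<Rightarrow> \<Union>(b, t)\<in>fr b t. f a s b t) = C"
    by (simp add: x')
qed

lemma fr_mult:
  assumes as: "a \<in> carrier R" "s \<in> D" "b \<in> carrier R" "t \<in> D"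
  shows "fr a s \<otimes>\<^bsub>L\<^esub> fr b t = fr (a \<otimes> b) (s \<otimes> t)"
proof -
  have "(\<Union>(a, s)\<in>fr a s. \<Union>(b, t)\<in>fr b t. fr (a \<otimes> b) (s \<otimes> t)) = fr (a \<otimes> b) (s \<otimes> t)"
  proof (rule UN_fr_fr[OF as])
    fix a' s' b' t' assume "(a', s') \<in> fr a s" "(b', t') \<in> fr b t"
    then obtain u v where a': "a' \<in> carrier R" "s' \<in> D" and u: "u \<in> D" "u \<otimes> (a \<otimes> s') = u \<otimes> (a' \<otimes> s)"
      and b': "b' \<in> carrier R" "t' \<in> D" and v: "v \<in> D" "v \<otimes> (b \<otimes> t') = v \<otimes> (b' \<otimes> t)"
      unfolding fr_mem fraction_rel_iff by blast
    note cl = as a' b' u(1) v(1) as(2,4)[THEN D_closed] a'(2)[THEN D_closed] b'(2)[THEN D_closed]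
      u(1)[THEN D_closed] v(1)[THEN D_closed]
    have "(u \<otimes> v) \<otimes> ((a' \<otimes> b') \<otimes> (s \<otimes> t)) = (u \<otimes> (a' \<otimes> s)) \<otimes> (v \<otimes> (b' \<otimes> t))"
      using cl by (simp add: R.m_ac)
    also have "\<dots> = (u \<otimes> (a \<otimes> s')) \<otimes> (v \<otimes> (b \<otimes> t'))"
      by (simp only: u(2) v(2))
    also have "\<dots> = (u \<otimes> v) \<otimes> ((a \<otimes> b) \<otimes> (s' \<otimes> t'))"
      using cl by (simp add: R.m_ac)
    finally show "fr (a' \<otimes> b') (s' \<otimes> t') = fr (a \<otimes> b) (s \<otimes> t)"
      using cl D_mult[OF u(1) v(1)] D_mult[OF a'(2) b'(2)] D_mult[OF as(2,4)]
      by (subst fr_eq_iff) (auto intro!: bexI[of _ "u \<otimes> v"])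
  qed
  then show ?thesis
    by (simp add: localization_def)
qed

lemma fr_add:
  assumes as: "a \<in> carrier R" "s \<in> D" "b \<in> carrier R" "t \<in> D"
  shows "fr a s \<oplus>\<^bsub>L\<^esub> fr b t = fr ((a \<otimes> t) \<oplus> (b \<otimes> s)) (s \<otimes> t)"
proof -
  have "(\<Union>(a, s)\<in>fr a s. \<Union>(b, t)\<in>fr b t. fr ((a \<otimes> t) \<oplus> (b \<otimes> s)) (s \<otimes> t)) =
      fr ((a \<otimes> t) \<oplus> (b \<otimes> s)) (s \<otimes> t)"
  proof (rule UN_fr_fr[OF as])
    fix a' s' b' t' assume "(a', s') \<in> fr a s" "(b', t') \<in> fr b t"
    then obtain u v where a': "a' \<in> carrier R" "s' \<in> D" and u: "u \<in> D" "u \<otimes> (a \<otimes> s') = u \<otimes> (a' \<otimes> s)"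
      and b': "b' \<in> carrier R" "t' \<in> D" and v: "v \<in> D" "v \<otimes> (b \<otimes> t') = v \<otimes> (b' \<otimes> t)"
      unfolding fr_mem fraction_rel_iff by blast
    note cl = as a' b' u(1) v(1) as(2,4)[THEN D_closed] a'(2)[THEN D_closed] b'(2)[THEN D_closed]
      u(1)[THEN D_closed] v(1)[THEN D_closed]
    have "(u \<otimes> v) \<otimes> (((a' \<otimes> t') \<oplus> (b' \<otimes> s')) \<otimes> (s \<otimes> t)) =
        (u \<otimes> (a' \<otimes> s)) \<otimes> (v \<otimes> (t \<otimes> t')) \<oplus> (v \<otimes> (b' \<otimes> t)) \<otimes> (u \<otimes> (s \<otimes> s'))"
      using cl by (simp add: R.m_ac R.l_distr R.r_distr)
    also have "\<dots> = (u \<otimes> (a \<otimes> s')) \<otimes> (v \<otimes> (t \<otimes> t')) \<oplus> (v \<otimes> (b \<otimes> t')) \<otimes> (u \<otimes> (s \<otimes> s'))"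
      by (simp only: u(2) v(2))
    also have "\<dots> = (u \<otimes> v) \<otimes> (((a \<otimes> t) \<oplus> (b \<otimes> s)) \<otimes> (s' \<otimes> t'))"
      using cl by (simp add: R.m_ac R.l_distr R.r_distr)
    finally show "fr ((a' \<otimes> t') \<oplus> (b' \<otimes> s')) (s' \<otimes> t') = fr ((a \<otimes> t) \<oplus> (b \<otimes> s)) (s \<otimes> t)"
      using cl D_mult[OF u(1) v(1)] D_mult[OF a'(2) b'(2)] D_mult[OF as(2,4)]
      by (subst fr_eq_iff) (auto intro!: bexI[of _ "u \<otimes> v"])
  qed
  then show ?thesis
    by (simp add: localization_def)
qed

lemma fr_add_same:
  assumes "a \<in> carrier R" "b \<in> carrier R" "s \<in> D"
  shows "fr a s \<oplus>\<^bsub>L\<^esub> fr b s = fr (a \<oplus> b) s"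
  unfolding fr_add[OF assms(1,3,2,3)]
  using assms assms(3)[THEN D_closed] D_mult[OF assms(3,3)]
  by (intro fr_eqI) (auto simp: R.m_ac R.l_distr R.r_distr)

lemma common_denominator:
  assumes "c \<in> carrier L" "c' \<in> carrier L"
  obtains a a' s where "a \<in> carrier R" "a' \<in> carrier R" "s \<in> D" "c = fr a s" "c' = fr a' s"
proof -
  obtain a s where a: "a \<in> carrier R" "s \<in> D" "c = fr a s"
    using assms(1) by (rule L_cases)
  obtain a' s' where a': "a' \<in> carrier R" "s' \<in> D" "c' = fr a' s'"
    using assms(2) by (rule L_cases)
  note cl = a(1,2) a'(1,2) D_closed[OF a(2)] D_closed[OF a'(2)] D_mult[OF a(2) a'(2)]
  have "c = fr (a \<otimes> s') (s \<otimes> s')"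
    unfolding a(3) using cl by (intro fr_eqI) (simp_all add: R.m_ac)
  moreover have "c' = fr (a' \<otimes> s) (s \<otimes> s')"
    unfolding a'(3) using cl by (intro fr_eqI) (simp_all add: R.m_ac)
  ultimately show thesis
    using that[of "a \<otimes> s'" "a' \<otimes> s" "s \<otimes> s'"] cl by simp
qed

lemma L_add_closed: "c \<in> carrier L \<Longrightarrow> c' \<in> carrier L \<Longrightarrow> c \<oplus>\<^bsub>L\<^esub> c' \<in> carrier L"
  by (erule (1) common_denominator) (simp add: fr_add_same fr_closed)

lemma L_mult_closed: "c \<in> carrier L \<Longrightarrow> c' \<in> carrier L \<Longrightarrow> c \<otimes>\<^bsub>L\<^esub> c' \<in> carrier L"
  by (elim L_cases) (simp add: fr_mult fr_closed D_mult[simplified])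

lemma L_distr:
  assumes b: "b \<in> carrier L" and c: "c \<in> carrier L" "c' \<in> carrier L"
  shows "b \<otimes>\<^bsub>L\<^esub> (c \<oplus>\<^bsub>L\<^esub> c') = b \<otimes>\<^bsub>L\<^esub> c \<oplus>\<^bsub>L\<^esub> b \<otimes>\<^bsub>L\<^esub> c'"
proof -
  obtain x t where x: "x \<in> carrier R" "t \<in> D" "b = fr x t"
    using b by (rule L_cases)
  obtain a a' s where a: "a \<in> carrier R" "a' \<in> carrier R" "s \<in> D" "c = fr a s" "c' = fr a' s"
    using c by (rule common_denominator)
  have "t \<otimes> s \<in> D"
    by (rule D_mult[OF x(2) a(3)])
  then show ?thesis
    unfolding x(3) a(4,5) using x(1,2) a(1-3) by (simp add: fr_add_same fr_mult R.r_distr)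
qed

lemma L_left_commute:
  assumes "b \<in> carrier L" "a \<in> carrier R" "c \<in> carrier L"
  shows "b \<otimes>\<^bsub>L\<^esub> (fr a \<one> \<otimes>\<^bsub>L\<^esub> c) = fr a \<one> \<otimes>\<^bsub>L\<^esub> (b \<otimes>\<^bsub>L\<^esub> c)"
proof -
  obtain x t where x: "x \<in> carrier R" "t \<in> D" "b = fr x t"
    using assms(1) by (rule L_cases)
  obtain y s where y: "y \<in> carrier R" "s \<in> D" "c = fr y s"
    using assms(3) by (rule L_cases)
  have "t \<otimes> s \<in> D"
    by (rule D_mult[OF x(2) y(2)])
  then show ?thesis
    unfolding x(3) y(3) using x(1,2) y(1,2) assms(2) D_one
    by (simp add: fr_mult R.m_ac)
qed

text \<open>In place of the ring structure of \<open>L\<close>, finitely many fractions are handled over a common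
  denominator.\<close>

lemma finite_common_denominator:
  assumes "finite C" "C \<subseteq> carrier L"
  shows "\<exists>w\<in>D. \<exists>b. (\<forall>c\<in>C. b c \<in> carrier R \<and> c = fr (b c) w)"
  using assms
proof (induction rule: finite_induct)
  case empty
  then show ?case
    using D_one by blast
next
  case (insert c C)
  then obtain w b where w: "w \<in> D" and b: "\<forall>c\<in>C. b c \<in> carrier R \<and> c = fr (b c) w"
    by blast
  obtain a s where a: "a \<in> carrier R" "s \<in> D" "c = fr a s"
    using insert.prems by (meson L_cases insert_subset)
  let ?b = "\<lambda>c'. if c' = c then a \<otimes> w else b c' \<otimes> s"
  have ws: "w \<otimes> s \<in> D"
    by (rule D_mult[OF w a(2)])
  have "?b c' \<in> carrier R \<and> c' = fr (?b c') (w \<otimes> s)" if "c' \<in> insert c C" for c'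
  proof (cases "c' = c")
    case True
    have "fr a s = fr (a \<otimes> w) (w \<otimes> s)"
      using a(1,2) w ws by (intro fr_eqI) (simp_all add: R.m_ac)
    then show ?thesis
      using True a w by simp
  next
    case False
    then have c': "b c' \<in> carrier R" "c' = fr (b c') w"
      using b that by blast+
    have "fr (b c') w = fr (b c' \<otimes> s) (w \<otimes> s)"
      using a(1,2) w ws c'(1) by (intro fr_eqI) (simp_all add: R.m_ac)
    then have "c' = fr (b c' \<otimes> s) (w \<otimes> s)"
      using c'(2) by (rule trans[rotated])
    then show ?thesis
      using False a(2) c'(1) by simp
  qed
  then have "\<forall>c'\<in>insert c C. ?b c' \<in> carrier R \<and> c' = fr (?b c') (w \<otimes> s)"
    by (rule ballI)
  then show ?case
    by (intro bexI[OF _ ws] exI[of _ ?b])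
qed

section \<open>The tensor product with a localization\<close>

abbreviation F :: "('c \<times> ('a \<times> 'a) set \<Rightarrow>\<^sub>0 int) monoid"
  where "F \<equiv> free_Abelian_group (carrier M \<times> carrier L)"

abbreviation rels :: "('c \<times> ('a \<times> 'a) set \<Rightarrow>\<^sub>0 int) set"
  where "rels \<equiv> tensor_relations M R L (\<lambda>a. fr a \<one>)"

abbreviation Z :: "('c \<times> ('a \<times> 'a) set \<Rightarrow>\<^sub>0 int) set"
  where "Z \<equiv> generate F rels"

abbreviation N :: "(('a \<times> 'a) set, ('c \<times> ('a \<times> 'a) set \<Rightarrow>\<^sub>0 int) set) module"
  where "N \<equiv> module_localization R M P"

abbreviation cl :: "('c \<times> ('a \<times> 'a) set \<Rightarrow>\<^sub>0 int) \<Rightarrow> ('c \<times> ('a \<times> 'a) set \<Rightarrow>\<^sub>0 int) set"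
  where "cl x \<equiv> Z #>\<^bsub>F\<^esub> x"

definition pure :: "'c \<Rightarrow> ('a \<times> 'a) set \<Rightarrow> ('c \<times> ('a \<times> 'a) set \<Rightarrow>\<^sub>0 int) set"
  where "pure m c = cl (frag_of (m, c))"

lemma F_closed:
  "0 \<in> carrier F"
  "m \<in> carrier M \<Longrightarrow> c \<in> carrier L \<Longrightarrow> frag_of (m, c) \<in> carrier F"
  "x \<in> carrier F \<Longrightarrow> - x \<in> carrier F"
  "x \<in> carrier F \<Longrightarrow> y \<in> carrier F \<Longrightarrow> x + y \<in> carrier F"
  "x \<in> carrier F \<Longrightarrow> y \<in> carrier F \<Longrightarrow> x - y \<in> carrier F"
proof -
  show "x + y \<in> carrier F" if "x \<in> carrier F" "y \<in> carrier F"
    using that keys_add[of x y] unfolding carrier_free_Abelian_group_iff by (meson Un_least order_trans)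
  show "x - y \<in> carrier F" if "x \<in> carrier F" "y \<in> carrier F"
    using that keys_diff[of x y] unfolding carrier_free_Abelian_group_iff by (meson Un_least order_trans)
qed simp_all

lemma one_in_L: "fr \<one> \<one> \<in> carrier L"
  by (rule fr_closed[OF R.one_closed D_one])

lemma rels_cases [consumes 1, case_names left right balance]:
  assumes "x \<in> rels"
  obtains m m' c where "m \<in> carrier M" "m' \<in> carrier M" "c \<in> carrier L"
      "x = frag_of (m \<oplus>\<^bsub>M\<^esub> m', c) - frag_of (m, c) - frag_of (m', c)"
    | m c c' where "m \<in> carrier M" "c \<in> carrier L" "c' \<in> carrier L"
      "x = frag_of (m, c \<oplus>\<^bsub>L\<^esub> c') - frag_of (m, c) - frag_of (m, c')"
    | a m c where "a \<in> carrier R" "m \<in> carrier M" "c \<in> carrier L"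
      "x = frag_of (a \<odot>\<^bsub>M\<^esub> m, c) - frag_of (m, fr a \<one> \<otimes>\<^bsub>L\<^esub> c)"
  using assms unfolding tensor_relations_def Un_iff mem_Collect_eq
  apply (elim disjE exE conjE)
  subgoal by (rule that(1))
  subgoal by (rule that(2))
  subgoal by (rule that(3))
  done

lemma rels_left: "m \<in> carrier M \<Longrightarrow> m' \<in> carrier M \<Longrightarrow> c \<in> carrier L \<Longrightarrow>
    frag_of (m \<oplus>\<^bsub>M\<^esub> m', c) - frag_of (m, c) - frag_of (m', c) \<in> rels"
  unfolding tensor_relations_def by blast

lemma rels_right: "m \<in> carrier M \<Longrightarrow> c \<in> carrier L \<Longrightarrow> c' \<in> carrier L \<Longrightarrow>
    frag_of (m, c \<oplus>\<^bsub>L\<^esub> c') - frag_of (m, c) - frag_of (m, c') \<in> rels"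
  unfolding tensor_relations_def by blast

lemma rels_balance: "a \<in> carrier R \<Longrightarrow> m \<in> carrier M \<Longrightarrow> c \<in> carrier L \<Longrightarrow>
    frag_of (a \<odot>\<^bsub>M\<^esub> m, c) - frag_of (m, fr a \<one> \<otimes>\<^bsub>L\<^esub> c) \<in> rels"
  unfolding tensor_relations_def by blast

lemma rels_carrier: "x \<in> rels \<Longrightarrow> x \<in> carrier F"
proof (erule rels_cases)
  fix m m' c assume "m \<in> carrier M" "m' \<in> carrier M" "c \<in> carrier L"
    "x = frag_of (m \<oplus>\<^bsub>M\<^esub> m', c) - frag_of (m, c) - frag_of (m', c)"
  then show "x \<in> carrier F"
    by (simp only:) (intro F_closed M.a_closed)
next
  fix m c c' assume "m \<in> carrier M" "c \<in> carrier L" "c' \<in> carrier L"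
    "x = frag_of (m, c \<oplus>\<^bsub>L\<^esub> c') - frag_of (m, c) - frag_of (m, c')"
  then show "x \<in> carrier F"
    by (simp only:) (intro F_closed L_add_closed)
next
  fix a m c assume "a \<in> carrier R" "m \<in> carrier M" "c \<in> carrier L"
    "x = frag_of (a \<odot>\<^bsub>M\<^esub> m, c) - frag_of (m, fr a \<one> \<otimes>\<^bsub>L\<^esub> c)"
  then show "x \<in> carrier F"
    by (simp only:) (intro F_closed smult_closed L_mult_closed fr_closed D_one)
qed

lemma F_comm_group: "comm_group F"
  by (rule abelian_free_Abelian_group)

lemma Z_subgroup: "subgroup Z F"
  by (rule group.generate_is_subgroup[OF group_free_Abelian_group]) (use rels_carrier in blast)

lemma Z_carrier: "x \<in> Z \<Longrightarrow> x \<in> carrier F"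
  using subgroup.subset[OF Z_subgroup] by blast

lemma Z_closed:
  shows "0 \<in> Z" and "x \<in> Z \<Longrightarrow> y \<in> Z \<Longrightarrow> x + y \<in> Z" and "x \<in> Z \<Longrightarrow> - x \<in> Z"
    and "x \<in> Z \<Longrightarrow> y \<in> Z \<Longrightarrow> x - y \<in> Z"
proof -
  show 0: "0 \<in> Z"
    using subgroup.one_closed[OF Z_subgroup] by simp
  show add: "x + y \<in> Z" if "x \<in> Z" "y \<in> Z" for x y
    using subgroup.m_closed[OF Z_subgroup that] by simp
  show neg: "- x \<in> Z" if "x \<in> Z" for x
    using subgroup.m_inv_closed[OF Z_subgroup that] Z_carrier[OF that] by simp
  show "x - y \<in> Z" if "x \<in> Z" "y \<in> Z" for x y
    using add[OF that(1) neg[OF that(2)]] by simp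
qed

lemma cl_eq_iff: "cl x = cl y \<longleftrightarrow> x - y \<in> Z"
proof
  assume "cl x = cl y"
  moreover have "x \<in> cl x"
    unfolding r_coset_def using Z_closed(1) by force
  ultimately obtain k where "k \<in> Z" "x = k + y"
    unfolding r_coset_def by auto
  then show "x - y \<in> Z"
    by simp
next
  assume *: "x - y \<in> Z"
  have "k + x \<in> cl y" if "k \<in> Z" for k
    unfolding r_coset_def using Z_closed(2)[OF that *] by (auto intro!: bexI[of _ "k + (x - y)"])
  moreover have "k + y \<in> cl x" if "k \<in> Z" for k
    unfolding r_coset_def using Z_closed(4)[OF that *] by (auto intro!: bexI[of _ "k - (x - y)"])
  ultimately show "cl x = cl y"
    by (auto simp: r_coset_def)
qed

lemma cl_zero: "cl 0 = Z"
  by (simp add: r_coset_def)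

lemma cl_self: "x \<in> cl x"
  unfolding r_coset_def using Z_closed(1) by force

lemma cl_eq_Z_iff: "cl x = Z \<longleftrightarrow> x \<in> Z"
  using cl_eq_iff[of x 0] by (simp add: cl_zero)

lemma N_carrier: "carrier N = cl ` carrier F"
  by (simp only: module_localization_def base_change_def Let_def carrier_FactGroup partial_object.simps)

lemma N_zero: "\<zero>\<^bsub>N\<^esub> = Z"
  by (simp add: module_localization_def base_change_def Let_def)

lemma N_add: "x \<in> carrier F \<Longrightarrow> y \<in> carrier F \<Longrightarrow> cl x \<oplus>\<^bsub>N\<^esub> cl y = cl (x + y)"
  using normal.rcos_sum[OF comm_group.subgroup_imp_normal[OF F_comm_group Z_subgroup], of x y]
  by (simp add: module_localization_def base_change_def Let_def FactGroup_def)

lemma N_smult: "b \<odot>\<^bsub>N\<^esub> C = (\<Union>x\<in>C. cl (frag_extend (\<lambda>(m, c). frag_of (m, b \<otimes>\<^bsub>L\<^esub> c)) x))"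
  by (simp add: module_localization_def base_change_def Let_def)

lemma N_add_group: "comm_group (add_monoid N)"
proof -
  interpret H: comm_group "F Mod Z"
    by (rule comm_group.abelian_FactGroup[OF F_comm_group Z_subgroup])
  have eqs: "carrier N = carrier (F Mod Z)" "ring.add N = monoid.mult (F Mod Z)" "\<zero>\<^bsub>N\<^esub> = \<one>\<^bsub>F Mod Z\<^esub>"
    by (simp_all add: module_localization_def base_change_def Let_def)
  show ?thesis
  proof (rule comm_groupI; unfold monoid_record_simps eqs)
    show "\<exists>y\<in>carrier (F Mod Z). y \<otimes>\<^bsub>F Mod Z\<^esub> x = \<one>\<^bsub>F Mod Z\<^esub>" if "x \<in> carrier (F Mod Z)" for x
      using that H.inv_closed H.l_inv by blast
  qed (rule H.m_closed H.one_closed H.m_assoc H.m_comm H.l_one; assumption)+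
qed

lemma pure_carrier: "m \<in> carrier M \<Longrightarrow> c \<in> carrier L \<Longrightarrow> pure m c \<in> carrier N"
  unfolding N_carrier pure_def by (intro imageI F_closed)

lemma pure_add:
  assumes "m \<in> carrier M" "m' \<in> carrier M" "c \<in> carrier L"
  shows "pure m c \<oplus>\<^bsub>N\<^esub> pure m' c = pure (m \<oplus>\<^bsub>M\<^esub> m') c"
proof -
  have "frag_of (m \<oplus>\<^bsub>M\<^esub> m', c) - (frag_of (m, c) + frag_of (m', c)) \<in> Z"
    using generate.incl[OF rels_left[OF assms], of F] by (simp add: diff_diff_add)
  then have "cl (frag_of (m, c) + frag_of (m', c)) = pure (m \<oplus>\<^bsub>M\<^esub> m') c"
    unfolding pure_def cl_eq_iff[symmetric] by (rule sym)
  then show ?thesis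
    unfolding pure_def using N_add F_closed(2) assms by simp
qed

lemma pure_balance:
  assumes "a \<in> carrier R" "m \<in> carrier M" "c \<in> carrier L"
  shows "pure (a \<odot>\<^bsub>M\<^esub> m) c = pure m (fr a \<one> \<otimes>\<^bsub>L\<^esub> c)"
  unfolding pure_def cl_eq_iff by (rule generate.incl[OF rels_balance[OF assms]])

text \<open>The rule m/s = (t m)/(s t), obtained by moving t across the tensor sign.\<close>

lemma pure_clear:
  assumes "m \<in> carrier M" "s \<in> D" "t \<in> D"
  shows "pure m (fr \<one> s) = pure (t \<odot>\<^bsub>M\<^esub> m) (fr \<one> (s \<otimes> t))"
proof -
  note cl = assms D_one D_closed[OF assms(2)] D_closed[OF assms(3)] D_mult[OF assms(2,3)]
  have "fr t \<one> \<otimes>\<^bsub>L\<^esub> fr \<one> (s \<otimes> t) = fr \<one> s"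
  proof -
    have "fr t \<one> \<otimes>\<^bsub>L\<^esub> fr \<one> (s \<otimes> t) = fr t (s \<otimes> t)"
      using cl by (simp add: fr_mult)
    also have "\<dots> = fr \<one> s"
      using cl by (intro fr_eqI) (simp_all add: R.m_ac)
    finally show ?thesis .
  qed
  then show ?thesis
    using pure_balance[of t m "fr \<one> (s \<otimes> t)"] cl by (simp add: fr_closed)
qed

lemma pure_zero: "c \<in> carrier L \<Longrightarrow> pure \<zero>\<^bsub>M\<^esub> c = Z"
proof -
  assume c: "c \<in> carrier L"
  have "frag_of (\<zero>\<^bsub>M\<^esub> \<oplus>\<^bsub>M\<^esub> \<zero>\<^bsub>M\<^esub>, c) - frag_of (\<zero>\<^bsub>M\<^esub>, c) - frag_of (\<zero>\<^bsub>M\<^esub>, c) \<in> Z"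
    by (intro generate.incl rels_left M.zero_closed c)
  then have "- frag_of (\<zero>\<^bsub>M\<^esub>, c) \<in> Z"
    by simp
  then have "frag_of (\<zero>\<^bsub>M\<^esub>, c) \<in> Z"
    using Z_closed(3)[of "- frag_of (\<zero>\<^bsub>M\<^esub>, c)"] by simp
  then show ?thesis
    by (simp add: pure_def cl_eq_Z_iff)
qed

text \<open>Over a common denominator, a difference of two tensors is again a single tensor, so no
  sums remain in a localization.\<close>

lemma cl_pure:
  assumes "x \<in> carrier F"
  shows "\<exists>m\<in>carrier M. \<exists>s\<in>D. cl x = pure m (fr \<one> s)"
proof -
  have "Poly_Mapping.keys x \<subseteq> carrier M \<times> carrier L"
    using assms by simp
  then show ?thesis
  proof (induction x rule: free_Abelian_group_induct[consumes 1, case_names zero diff frag])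
    case zero
    show ?case
      unfolding cl_zero using pure_zero[OF one_in_L] D_one M.zero_closed by metis
  next
    case (diff x y)
    then obtain m s m' s' where m: "m \<in> carrier M" "s \<in> D" "cl x = pure m (fr \<one> s)"
      and m': "m' \<in> carrier M" "s' \<in> D" "cl y = pure m' (fr \<one> s')"
      by blast
    let ?c = "fr \<one> (s \<otimes> s')" and ?u = "s' \<odot>\<^bsub>M\<^esub> m" and ?v = "s \<odot>\<^bsub>M\<^esub> m'"
    have ss: "s \<otimes> s' \<in> D" "s' \<otimes> s = s \<otimes> s'"
      using D_mult[OF m(2) m'(2)] D_closed[OF m(2)] D_closed[OF m'(2)] by (auto simp: R.m_comm)
    have c: "?c \<in> carrier L"
      by (intro fr_closed ss(1)) simp
    have uv: "?u \<in> carrier M" "?v \<in> carrier M"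
      using m(1,2) m'(1,2) by auto
    have "cl x = cl (frag_of (?u, ?c))"
      using pure_clear[OF m(1,2) m'(2)] m(3) by (simp add: pure_def)
    then have x: "x - frag_of (?u, ?c) \<in> Z"
      by (simp add: cl_eq_iff)
    have "cl y = cl (frag_of (?v, ?c))"
      using pure_clear[OF m'(1,2) m(2)] m'(3) ss(2) by (simp add: pure_def)
    then have y: "y - frag_of (?v, ?c) \<in> Z"
      by (simp add: cl_eq_iff)
    \<comment> \<open>Subtraction happens in M: the relation for w + v = u, with the common second
      factor c, replaces the difference of two generators by one.\<close>
    let ?w = "?u \<ominus>\<^bsub>M\<^esub> ?v"
    have w: "?w \<in> carrier M" "?w \<oplus>\<^bsub>M\<^esub> ?v = ?u"
      using uv by (simp_all add: M.minus_eq M.a_assoc M.l_neg)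
    have "frag_of (?w \<oplus>\<^bsub>M\<^esub> ?v, ?c) - frag_of (?w, ?c) - frag_of (?v, ?c) \<in> Z"
      by (intro generate.incl rels_left w(1) uv(2) c)
    then have "frag_of (?u, ?c) - frag_of (?w, ?c) - frag_of (?v, ?c) \<in> Z"
      by (simp only: w(2))
    from Z_closed(2)[OF Z_closed(4)[OF x y] this]
    have "(x - y) - frag_of (?w, ?c) \<in> Z"
      by (simp add: algebra_simps)
    then have "cl (x - y) = pure ?w ?c"
      by (simp add: pure_def cl_eq_iff)
    then show ?case
      using w(1) ss(1) by blast
  next
    case (frag x)
    then obtain m c where x: "x = (m, c)" "m \<in> carrier M" "c \<in> carrier L"
      by blast
    obtain a s where a: "a \<in> carrier R" "s \<in> D" "c = fr a s"
      using x(3) by (rule L_cases)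
    have "fr a \<one> \<otimes>\<^bsub>L\<^esub> fr \<one> s = c"
      using a D_one by (simp add: fr_mult)
    then have "cl (frag_of x) = pure (a \<odot>\<^bsub>M\<^esub> m) (fr \<one> s)"
      using pure_balance[of a m "fr \<one> s"] a x(1,2) by (simp add: fr_closed pure_def)
    then show ?case
      using a x(2) by blast
  qed
qed

lemma N_cases:
  assumes "y \<in> carrier N"
  obtains m s where "m \<in> carrier M" "s \<in> D" "y = pure m (fr \<one> s)"
  using assms cl_pure unfolding N_carrier by blast

text \<open>Multiplying all second factors by b maps each of the three kinds of relations to one of
  the same kind. The endomorphism therefore preserves Z, and scalar multiplication does not depend
  on the representative.\<close>

lemma smult_pure:
  assumes b: "b \<in> carrier L" and m: "m \<in> carrier M" and c: "c \<in> carrier L"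
  shows "b \<odot>\<^bsub>N\<^esub> pure m c = pure m (b \<otimes>\<^bsub>L\<^esub> c)"
proof -
  let ?E = "frag_extend (\<lambda>(m, c). frag_of (m, b \<otimes>\<^bsub>L\<^esub> c))"
  have rels: "?E x \<in> Z" if "x \<in> rels" for x
    using that
  proof (cases x rule: rels_cases)
    case (left m m' c)
    have "?E x = frag_of (m \<oplus>\<^bsub>M\<^esub> m', b \<otimes>\<^bsub>L\<^esub> c) - frag_of (m, b \<otimes>\<^bsub>L\<^esub> c) - frag_of (m', b \<otimes>\<^bsub>L\<^esub> c)"
      by (simp add: left(4) frag_extend_diff)
    then show ?thesis
      by (simp only:) (intro generate.incl rels_left left(1-3) L_mult_closed b)
  next
    case (right m c c')
    have "?E x = frag_of (m, b \<otimes>\<^bsub>L\<^esub> c \<oplus>\<^bsub>L\<^esub> b \<otimes>\<^bsub>L\<^esub> c') - frag_of (m, b \<otimes>\<^bsub>L\<^esub> c) - frag_of (m, b \<otimes>\<^bsub>L\<^esub> c')"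
      by (simp add: right(4) frag_extend_diff L_distr[OF b right(2,3)])
    then show ?thesis
      by (simp only:) (intro generate.incl rels_right right(1-3) L_mult_closed b)
  next
    case (balance a m c)
    have "?E x = frag_of (a \<odot>\<^bsub>M\<^esub> m, b \<otimes>\<^bsub>L\<^esub> c) - frag_of (m, fr a \<one> \<otimes>\<^bsub>L\<^esub> (b \<otimes>\<^bsub>L\<^esub> c))"
      by (simp add: balance(4) frag_extend_diff L_left_commute[OF b balance(1,3)])
    then show ?thesis
      by (simp only:) (intro generate.incl rels_balance balance(1-3) L_mult_closed b)
  qed
  have EZ: "?E x \<in> Z" if "x \<in> Z" for x
    using that
  proof (induction rule: generate.induct)
    case one
    show ?case
      using Z_closed(1) by simp
  next
    case (incl h)
    then show ?case
      by (rule rels)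
  next
    case (inv h)
    have "inv\<^bsub>F\<^esub> h = - h"
      using rels_carrier[OF inv] by simp
    then show ?case
      using Z_closed(3)[OF rels[OF inv]] by (simp add: frag_extend_minus)
  next
    case (eng h1 h2)
    then show ?case
      using Z_closed(2) by (simp add: frag_extend_add)
  qed
  have "cl (?E x) = pure m (b \<otimes>\<^bsub>L\<^esub> c)" if x: "x \<in> pure m c" for x
  proof -
    obtain k where k: "k \<in> Z" "x = k + frag_of (m, c)"
      using x unfolding pure_def r_coset_def by auto
    have "?E x = ?E k + frag_of (m, b \<otimes>\<^bsub>L\<^esub> c)"
      by (simp add: k(2) frag_extend_add)
    then show ?thesis
      using EZ[OF k(1)] by (simp add: pure_def cl_eq_iff)
  qed
  then show ?thesis
    unfolding N_smult by (intro UN_constant_eq[of "frag_of (m, c)"] ballI) (simp_all add: pure_def cl_self)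
qed

section \<open>Detecting zero in the tensor product by clearing denominators\<close>

lemma hom_frag:
  assumes h: "h \<in> hom F (add_monoid M)" and x: "x \<in> carrier F"
  shows "h x \<in> carrier M" and "h 0 = \<zero>\<^bsub>M\<^esub>" and "h (- x) = \<ominus>\<^bsub>M\<^esub> h x"
    and "y \<in> carrier F \<Longrightarrow> h (x + y) = h x \<oplus>\<^bsub>M\<^esub> h y"
    and "y \<in> carrier F \<Longrightarrow> h (x - y) = h x \<ominus>\<^bsub>M\<^esub> h y"
proof -
  interpret h: group_hom F "add_monoid M" h
    by (intro group_hom.intro group_hom_axioms.intro h group_free_Abelian_group M.a_group)
  show "h x \<in> carrier M"
    using h.hom_closed[OF x] by simp
  show "h 0 = \<zero>\<^bsub>M\<^esub>"
    using h.hom_one by simp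
  have neg: "h (- x) = \<ominus>\<^bsub>M\<^esub> h x" if "x \<in> carrier F" for x
    using h.hom_inv[OF that] that by (simp add: a_inv_def)
  then show "h (- x) = \<ominus>\<^bsub>M\<^esub> h x"
    using x .
  have add: "h (x + y) = h x \<oplus>\<^bsub>M\<^esub> h y" if "y \<in> carrier F" for y
    using h.hom_mult[OF x that] by simp
  then show "y \<in> carrier F \<Longrightarrow> h (x + y) = h x \<oplus>\<^bsub>M\<^esub> h y" .
  assume y: "y \<in> carrier F"
  then show "h (x - y) = h x \<ominus>\<^bsub>M\<^esub> h y"
    using add[OF F_closed(3)[OF y]] neg[OF y] by (simp add: M.minus_eq)
qed

text \<open>A homomorphism \<open>h\<close> that clears the common denominator \<open>w\<close> of finitely many fractions
  respects the relations among them up to elements of \<open>M\<close> that die in the localization.\<close>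

definition clears :: "('a \<times> 'a) set set \<Rightarrow> 'a \<Rightarrow> (('a \<times> 'a) set \<Rightarrow> 'a) \<Rightarrow>
    (('c \<times> ('a \<times> 'a) set \<Rightarrow>\<^sub>0 int) \<Rightarrow> 'c) \<Rightarrow> bool"
  where "clears C w b h \<longleftrightarrow> w \<in> D \<and> (\<forall>c\<in>C. b c \<in> carrier R \<and> c = fr (b c) w) \<and>
    h \<in> hom F (add_monoid M) \<and> (\<forall>m\<in>carrier M. \<forall>c\<in>C \<inter> carrier L. h (frag_of (m, c)) = b c \<odot>\<^bsub>M\<^esub> m)"

text \<open>Which fractions need a common denominator is known only after a whole combination of
  relations has been inspected. Hence each relation names a finite set \<open>C0\<close> and
  tolerates any larger C, and such sets can be united along the generation of Z.\<close>

lemma rels_cleared: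
  assumes "x \<in> rels"
  shows "\<exists>C0. finite C0 \<and> C0 \<subseteq> carrier L \<and> (\<forall>C w b h. C0 \<subseteq> C \<longrightarrow> clears C w b h \<longrightarrow>
    (\<exists>u\<in>D. u \<odot>\<^bsub>M\<^esub> h x = \<zero>\<^bsub>M\<^esub>))"
  using assms
proof (cases x rule: rels_cases)
  case (left m m' c)
  have "\<exists>u\<in>D. u \<odot>\<^bsub>M\<^esub> h x = \<zero>\<^bsub>M\<^esub>" if C: "{c} \<subseteq> C" "clears C w b h" for C w b h
  proof -
    have h: "h \<in> hom F (add_monoid M)" and b: "b c \<in> carrier R"
      and hc: "\<And>m. m \<in> carrier M \<Longrightarrow> h (frag_of (m, c)) = b c \<odot>\<^bsub>M\<^esub> m"
      using C left(3) unfolding clears_def by blast+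
    note F = F_closed(2)[OF M.a_closed[OF left(1,2)] left(3)] F_closed(2)[OF left(1,3)] F_closed(2)[OF left(2,3)]
    have "h x = b c \<odot>\<^bsub>M\<^esub> (m \<oplus>\<^bsub>M\<^esub> m') \<ominus>\<^bsub>M\<^esub> b c \<odot>\<^bsub>M\<^esub> m \<ominus>\<^bsub>M\<^esub> b c \<odot>\<^bsub>M\<^esub> m'"
      unfolding left(4) hom_frag(5)[OF h F_closed(5)[OF F(1,2)] F(3)] hom_frag(5)[OF h F(1,2)]
      using hc left(1,2) by simp
    also have "\<dots> = \<zero>\<^bsub>M\<^esub>"
      using left(1,2) b by (simp add: smult_r_distr M.minus_eq M.a_ac M.r_neg M.r_neg1)
    finally show ?thesis
      using D_one by (intro bexI[of _ \<one>]) simp_all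
  qed
  then show ?thesis
    using left(3) by (intro exI[of _ "{c}"]) blast
next
  case (right m c c')
  note cc = L_add_closed[OF right(2,3)]
  have "\<exists>u\<in>D. u \<odot>\<^bsub>M\<^esub> h x = \<zero>\<^bsub>M\<^esub>" if C: "{c, c', c \<oplus>\<^bsub>L\<^esub> c'} \<subseteq> C" "clears C w b h" for C w b h
  proof -
    let ?d = "b (c \<oplus>\<^bsub>L\<^esub> c')"
    have h: "h \<in> hom F (add_monoid M)" and w: "w \<in> D"
      and b: "b c \<in> carrier R" "b c' \<in> carrier R" "?d \<in> carrier R"
      and e: "c = fr (b c) w" "c' = fr (b c') w" "c \<oplus>\<^bsub>L\<^esub> c' = fr ?d w"
      and hc: "h (frag_of (m, c)) = b c \<odot>\<^bsub>M\<^esub> m" "h (frag_of (m, c')) = b c' \<odot>\<^bsub>M\<^esub> m"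
        "h (frag_of (m, c \<oplus>\<^bsub>L\<^esub> c')) = ?d \<odot>\<^bsub>M\<^esub> m"
      using C right(1-3) cc unfolding clears_def by blast+
    \<comment> \<open>Both numerators represent the same fraction over w. They agree after
      multiplication by u w, which therefore kills \<open>h x\<close>.\<close>
    have "fr ?d w = fr (b c \<oplus> b c') w"
      using fr_add_same[OF b(1,2) w] e by metis
    then obtain u where u: "u \<in> D" "u \<otimes> (?d \<otimes> w) = u \<otimes> ((b c \<oplus> b c') \<otimes> w)"
      using fr_eq_iff[OF b(3) w _ w, of "b c \<oplus> b c'"] b(1,2) by auto
    note F = F_closed(2)[OF right(1) cc] F_closed(2)[OF right(1,2)] F_closed(2)[OF right(1,3)]
    have hx: "h x = ?d \<odot>\<^bsub>M\<^esub> m \<ominus>\<^bsub>M\<^esub> b c \<odot>\<^bsub>M\<^esub> m \<ominus>\<^bsub>M\<^esub> b c' \<odot>\<^bsub>M\<^esub> m"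
      unfolding right(4) hom_frag(5)[OF h F_closed(5)[OF F(1,2)] F(3)] hom_frag(5)[OF h F(1,2)] hc ..
    also have "\<dots> = (?d \<ominus> (b c \<oplus> b c')) \<odot>\<^bsub>M\<^esub> m"
      using right(1) b by (simp add: smult_l_distr smult_l_minus M.minus_eq R.minus_eq R.minus_add M.a_ac)
    finally have hx: "h x = (?d \<ominus> (b c \<oplus> b c')) \<odot>\<^bsub>M\<^esub> m" .
    have uw: "u \<otimes> w \<in> D"
      by (rule D_mult[OF u(1) w])
    have "(u \<otimes> w) \<otimes> (?d \<ominus> (b c \<oplus> b c')) = u \<otimes> (?d \<otimes> w) \<ominus> u \<otimes> ((b c \<oplus> b c') \<otimes> w)"
      using b D_closed[OF w] D_closed[OF u(1)]
      by (simp add: R.minus_eq R.r_distr R.l_distr R.r_minus R.m_ac R.minus_add)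
    also have "\<dots> = \<zero>"
      unfolding u(2) using b D_closed[OF w] D_closed[OF u(1)] by (simp add: R.minus_eq R.r_neg)
    finally have "(u \<otimes> w) \<odot>\<^bsub>M\<^esub> h x = \<zero>\<^bsub>M\<^esub>"
      unfolding hx using right(1) b D_closed[OF uw] by (simp add: smult_assoc1[symmetric])
    then show ?thesis
      using uw by blast
  qed
  then show ?thesis
    using right(2,3) cc by (intro exI[of _ "{c, c', c \<oplus>\<^bsub>L\<^esub> c'}"]) blast
next
  case (balance a m c)
  let ?c = "fr a \<one> \<otimes>\<^bsub>L\<^esub> c"
  have cc: "?c \<in> carrier L"
    by (intro L_mult_closed fr_closed balance(1,3) D_one)
  have "\<exists>u\<in>D. u \<odot>\<^bsub>M\<^esub> h x = \<zero>\<^bsub>M\<^esub>" if C: "{c, ?c} \<subseteq> C" "clears C w b h" for C w b h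
  proof -
    let ?d = "b ?c"
    have am: "a \<odot>\<^bsub>M\<^esub> m \<in> carrier M"
      by (rule smult_closed[OF balance(1,2)])
    have h: "h \<in> hom F (add_monoid M)" and w: "w \<in> D"
      and b: "b c \<in> carrier R" "?d \<in> carrier R"
      and e: "c = fr (b c) w" "?c = fr ?d w"
      and hc: "h (frag_of (a \<odot>\<^bsub>M\<^esub> m, c)) = b c \<odot>\<^bsub>M\<^esub> (a \<odot>\<^bsub>M\<^esub> m)" "h (frag_of (m, ?c)) = ?d \<odot>\<^bsub>M\<^esub> m"
      using C balance(2,3) cc am unfolding clears_def by blast+
    have "fr a \<one> \<otimes>\<^bsub>L\<^esub> fr (b c) w = fr (a \<otimes> b c) w"
      using fr_mult[OF balance(1) D_one b(1) w] D_closed[OF w] by simp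
    then have "fr (a \<otimes> b c) w = fr ?d w"
      using e by metis
    then obtain u where u: "u \<in> D" "u \<otimes> ((a \<otimes> b c) \<otimes> w) = u \<otimes> (?d \<otimes> w)"
      using fr_eq_iff[OF _ w b(2) w, of "a \<otimes> b c"] b(1) balance(1) by auto
    have "h x = b c \<odot>\<^bsub>M\<^esub> (a \<odot>\<^bsub>M\<^esub> m) \<ominus>\<^bsub>M\<^esub> ?d \<odot>\<^bsub>M\<^esub> m"
      unfolding balance(4) hom_frag(5)[OF h F_closed(2)[OF am balance(3)] F_closed(2)[OF balance(2) cc]] hc ..
    also have "\<dots> = ((a \<otimes> b c) \<ominus> ?d) \<odot>\<^bsub>M\<^esub> m"
      using balance(1,2) b
      by (simp add: smult_l_distr smult_l_minus M.minus_eq R.minus_eq smult_assoc1[symmetric] R.m_comm)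
    finally have hx: "h x = ((a \<otimes> b c) \<ominus> ?d) \<odot>\<^bsub>M\<^esub> m" .
    have uw: "u \<otimes> w \<in> D"
      by (rule D_mult[OF u(1) w])
    have "(u \<otimes> w) \<otimes> ((a \<otimes> b c) \<ominus> ?d) = u \<otimes> ((a \<otimes> b c) \<otimes> w) \<ominus> u \<otimes> (?d \<otimes> w)"
      using b balance(1) D_closed[OF w] D_closed[OF u(1)]
      by (simp add: R.minus_eq R.r_distr R.r_minus R.m_ac)
    also have "\<dots> = \<zero>"
      unfolding u(2) using b D_closed[OF w] D_closed[OF u(1)] by (simp add: R.minus_eq R.r_neg)
    finally have "(u \<otimes> w) \<odot>\<^bsub>M\<^esub> h x = \<zero>\<^bsub>M\<^esub>"
      unfolding hx using balance(1,2) b D_closed[OF uw] by (simp add: smult_assoc1[symmetric])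
    then show ?thesis
      using uw by blast
  qed
  then show ?thesis
    using balance(3) cc by (intro exI[of _ "{c, ?c}"]) blast
qed

lemma Z_cleared:
  assumes "x \<in> Z"
  shows "\<exists>C0. finite C0 \<and> C0 \<subseteq> carrier L \<and> (\<forall>C w b h. C0 \<subseteq> C \<longrightarrow> clears C w b h \<longrightarrow>
    (\<exists>u\<in>D. u \<odot>\<^bsub>M\<^esub> h x = \<zero>\<^bsub>M\<^esub>))"
  using assms
proof (induction rule: generate.induct)
  case one
  have "\<exists>u\<in>D. u \<odot>\<^bsub>M\<^esub> h \<one>\<^bsub>F\<^esub> = \<zero>\<^bsub>M\<^esub>" if "clears C w b h" for C w b h
  proof -
    have "h \<in> hom F (add_monoid M)"
      using that unfolding clears_def by blast
    then have "h \<one>\<^bsub>F\<^esub> = \<zero>\<^bsub>M\<^esub>"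
      using hom_frag(2)[OF _ F_closed(1)] by simp
    then show ?thesis
      using D_one by (intro bexI[of _ \<one>]) simp_all
  qed
  then show ?case
    by (intro exI[of _ "{}"]) blast
next
  case (incl x)
  then show ?case
    by (rule rels_cleared)
next
  case (inv x)
  note xF = rels_carrier[OF inv]
  obtain C0 where C0: "finite C0" "C0 \<subseteq> carrier L"
    and u: "\<And>C w b h. C0 \<subseteq> C \<Longrightarrow> clears C w b h \<Longrightarrow> \<exists>u\<in>D. u \<odot>\<^bsub>M\<^esub> h x = \<zero>\<^bsub>M\<^esub>"
    using rels_cleared[OF inv] by metis
  have "\<exists>u\<in>D. u \<odot>\<^bsub>M\<^esub> h (inv\<^bsub>F\<^esub> x) = \<zero>\<^bsub>M\<^esub>" if C: "C0 \<subseteq> C" "clears C w b h" for C w b h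
  proof -
    have h: "h \<in> hom F (add_monoid M)"
      using C(2) unfolding clears_def by blast
    obtain v where v: "v \<in> D" "v \<odot>\<^bsub>M\<^esub> h x = \<zero>\<^bsub>M\<^esub>"
      using u[OF C] by blast
    have "h (inv\<^bsub>F\<^esub> x) = \<ominus>\<^bsub>M\<^esub> h x"
      using hom_frag(3)[OF h xF] xF by simp
    then have "v \<odot>\<^bsub>M\<^esub> h (inv\<^bsub>F\<^esub> x) = \<zero>\<^bsub>M\<^esub>"
      using smult_r_minus[OF D_closed[OF v(1)] hom_frag(1)[OF h xF]] v(2) by simp
    then show ?thesis
      using v(1) by blast
  qed
  then show ?case
    using C0 by blast
next
  case (eng x y)
  note xF = Z_carrier[OF eng.hyps(1)] and yF = Z_carrier[OF eng.hyps(2)]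
  obtain C1 where C1: "finite C1" "C1 \<subseteq> carrier L"
    and u1: "\<And>C w b h. C1 \<subseteq> C \<Longrightarrow> clears C w b h \<Longrightarrow> \<exists>u\<in>D. u \<odot>\<^bsub>M\<^esub> h x = \<zero>\<^bsub>M\<^esub>"
    using eng.IH(1) by metis
  obtain C2 where C2: "finite C2" "C2 \<subseteq> carrier L"
    and u2: "\<And>C w b h. C2 \<subseteq> C \<Longrightarrow> clears C w b h \<Longrightarrow> \<exists>u\<in>D. u \<odot>\<^bsub>M\<^esub> h y = \<zero>\<^bsub>M\<^esub>"
    using eng.IH(2) by metis
  have "\<exists>u\<in>D. u \<odot>\<^bsub>M\<^esub> h (x \<otimes>\<^bsub>F\<^esub> y) = \<zero>\<^bsub>M\<^esub>" if C: "C1 \<union> C2 \<subseteq> C" "clears C w b h" for C w b h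
  proof -
    have h: "h \<in> hom F (add_monoid M)"
      using C(2) unfolding clears_def by blast
    obtain u where u: "u \<in> D" "u \<odot>\<^bsub>M\<^esub> h x = \<zero>\<^bsub>M\<^esub>"
      using u1[OF _ C(2)] C(1) by blast
    obtain v where v: "v \<in> D" "v \<odot>\<^bsub>M\<^esub> h y = \<zero>\<^bsub>M\<^esub>"
      using u2[OF _ C(2)] C(1) by blast
    note cl = D_closed[OF u(1)] D_closed[OF v(1)] hom_frag(1)[OF h xF] hom_frag(1)[OF h yF]
    have "h (x \<otimes>\<^bsub>F\<^esub> y) = h x \<oplus>\<^bsub>M\<^esub> h y"
      using hom_frag(4)[OF h xF yF] by simp
    then have "(u \<otimes> v) \<odot>\<^bsub>M\<^esub> h (x \<otimes>\<^bsub>F\<^esub> y) = (v \<otimes> u) \<odot>\<^bsub>M\<^esub> h x \<oplus>\<^bsub>M\<^esub> (u \<otimes> v) \<odot>\<^bsub>M\<^esub> h y"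
      using cl by (simp add: smult_r_distr R.m_comm)
    also have "\<dots> = v \<odot>\<^bsub>M\<^esub> (u \<odot>\<^bsub>M\<^esub> h x) \<oplus>\<^bsub>M\<^esub> u \<odot>\<^bsub>M\<^esub> (v \<odot>\<^bsub>M\<^esub> h y)"
      using cl by (simp only: smult_assoc1)
    also have "\<dots> = \<zero>\<^bsub>M\<^esub>"
      using cl by (simp add: u(2) v(2))
    finally show ?thesis
      using D_mult[OF u(1) v(1)] by blast
  qed
  then show ?case
    using C1 C2 by (intro exI[of _ "C1 \<union> C2"]) blast
qed

text \<open>A tensor is zero because of finitely many relations among finitely many fractions. A
  homomorphism to M that clears their common denominator turns this into a relation in M, so no
  separately built module of fractions is required as a target.\<close>

lemma pure_eq_zero_iff:
  assumes m: "m \<in> carrier M" and s: "s \<in> D"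
  shows "pure m (fr \<one> s) = Z \<longleftrightarrow> (\<exists>u\<in>D. u \<odot>\<^bsub>M\<^esub> m = \<zero>\<^bsub>M\<^esub>)"
proof
  assume "\<exists>u\<in>D. u \<odot>\<^bsub>M\<^esub> m = \<zero>\<^bsub>M\<^esub>"
  then obtain u where u: "u \<in> D" "u \<odot>\<^bsub>M\<^esub> m = \<zero>\<^bsub>M\<^esub>"
    by blast
  have "pure m (fr \<one> s) = pure \<zero>\<^bsub>M\<^esub> (fr \<one> (s \<otimes> u))"
    using pure_clear[OF m s u(1)] u(2) by simp
  also have "\<dots> = Z"
    by (intro pure_zero fr_closed D_mult s u(1)) simp
  finally show "pure m (fr \<one> s) = Z" .
next
  assume "pure m (fr \<one> s) = Z"
  then have "frag_of (m, fr \<one> s) \<in> Z"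
    unfolding pure_def cl_eq_Z_iff .
  from Z_cleared[OF this] obtain C0 where C0: "finite C0" "C0 \<subseteq> carrier L"
    and u: "\<And>C w b h. C0 \<subseteq> C \<Longrightarrow> clears C w b h \<Longrightarrow> \<exists>u\<in>D. u \<odot>\<^bsub>M\<^esub> h (frag_of (m, fr \<one> s)) = \<zero>\<^bsub>M\<^esub>"
    by metis
  let ?c = "fr \<one> s" and ?C = "insert (fr \<one> s) C0"
  have c: "?c \<in> carrier L"
    by (intro fr_closed s) simp
  obtain w b where w: "w \<in> D" and b: "\<forall>c\<in>?C. b c \<in> carrier R \<and> c = fr (b c) w"
    using finite_common_denominator[of ?C] C0 c by blast
  \<comment> \<open>The universal property asks for values on all of \<open>carrier L\<close>.
    Fractions without the chosen denominator receive the numerator 0.\<close>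
  define b' where "b' c = (if c \<in> ?C then b c else \<zero>)" for c
  have "(\<lambda>(m, c). b' c \<odot>\<^bsub>M\<^esub> m) ` (carrier M \<times> carrier L) \<subseteq> carrier (add_monoid M)"
    using b by (auto simp: b'_def)
  then obtain h where h: "h \<in> hom F (add_monoid M)"
    and hf: "\<And>x. x \<in> carrier M \<times> carrier L \<Longrightarrow> h (frag_of x) = (\<lambda>(m, c). b' c \<odot>\<^bsub>M\<^esub> m) x"
    using comm_group.free_Abelian_group_universal[OF M.a_comm_group] by blast
  have "clears ?C w b' h"
    unfolding clears_def using w b h hf by (simp add: b'_def)
  then obtain v where v: "v \<in> D" "v \<odot>\<^bsub>M\<^esub> h (frag_of (m, ?c)) = \<zero>\<^bsub>M\<^esub>"
    using u[of ?C] by blast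
  have bc: "b ?c \<in> carrier R" "?c = fr (b ?c) w"
    using b by blast+
  \<comment> \<open>The numerator of 1/s over w cannot lie in P, since t w = t b s for some t
    outside P, and the left side is outside P. It may thus be absorbed into the multiplier that
    kills m.\<close>
  have "b ?c \<in> D"
  proof -
    obtain t where t: "t \<in> D" "t \<otimes> (\<one> \<otimes> w) = t \<otimes> (b ?c \<otimes> s)"
      using fr_eq_iff[of \<one> s "b ?c" w] bc s w by auto
    have "t \<otimes> (\<one> \<otimes> w) \<in> D"
      using D_mult[OF t(1) w] D_closed[OF w] by simp
    moreover have "t \<otimes> (b ?c \<otimes> s) \<in> P" if "b ?c \<in> P"
    proof -
      have "t \<otimes> (b ?c \<otimes> s) = (t \<otimes> s) \<otimes> b ?c"
        using D_closed[OF t(1)] D_closed[OF s] bc(1) by (simp add: R.m_ac)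
      then show ?thesis
        using prime_mult_in[OF prime that] D_closed[OF D_mult[OF t(1) s]] by simp
    qed
    ultimately show ?thesis
      using t(2) bc(1) by auto
  qed
  moreover have "h (frag_of (m, ?c)) = b ?c \<odot>\<^bsub>M\<^esub> m"
    using hf[of "(m, ?c)"] m c by (simp add: b'_def)
  then have "(v \<otimes> b ?c) \<odot>\<^bsub>M\<^esub> m = \<zero>\<^bsub>M\<^esub>"
    using v D_closed[OF v(1)] bc(1) m by (simp add: smult_assoc1)
  ultimately show "\<exists>u\<in>D. u \<odot>\<^bsub>M\<^esub> m = \<zero>\<^bsub>M\<^esub>"
    using D_mult[OF v(1)] by blast
qed

section \<open>Submodules of a localization\<close>

lemma pure_smult:
  assumes "a \<in> carrier R" "t \<in> D" "m \<in> carrier M" "s \<in> D"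
  shows "fr a t \<odot>\<^bsub>N\<^esub> pure m (fr \<one> s) = pure (a \<odot>\<^bsub>M\<^esub> m) (fr \<one> (t \<otimes> s))"
proof -
  have ts: "t \<otimes> s \<in> D"
    by (rule D_mult[OF assms(2,4)])
  have s: "fr \<one> s \<in> carrier L"
    by (intro fr_closed assms(4)) simp
  have "fr a t \<odot>\<^bsub>N\<^esub> pure m (fr \<one> s) = pure m (fr a (t \<otimes> s))"
    unfolding smult_pure[OF fr_closed[OF assms(1,2)] assms(3) s] using assms by (simp add: fr_mult)
  also have "fr a (t \<otimes> s) = fr a \<one> \<otimes>\<^bsub>L\<^esub> fr \<one> (t \<otimes> s)"
    using assms(1) ts D_one D_closed[OF ts] by (simp add: fr_mult)
  also have "pure m \<dots> = pure (a \<odot>\<^bsub>M\<^esub> m) (fr \<one> (t \<otimes> s))"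
    by (rule pure_balance[symmetric, OF assms(1,3) fr_closed[OF R.one_closed ts]])
  finally show ?thesis .
qed

lemma pure_eq_iff:
  assumes m: "m \<in> carrier M" "s \<in> D" and m': "m' \<in> carrier M" "t \<in> D"
  shows "pure m (fr \<one> s) = pure m' (fr \<one> t) \<longleftrightarrow> (\<exists>u\<in>D. u \<odot>\<^bsub>M\<^esub> (t \<odot>\<^bsub>M\<^esub> m) = u \<odot>\<^bsub>M\<^esub> (s \<odot>\<^bsub>M\<^esub> m'))"
proof -
  interpret A: comm_group "add_monoid N"
    by (rule N_add_group)
  let ?c = "fr \<one> (s \<otimes> t)" and ?x = "t \<odot>\<^bsub>M\<^esub> m" and ?y = "s \<odot>\<^bsub>M\<^esub> m'"
  have st: "s \<otimes> t \<in> D" "t \<otimes> s = s \<otimes> t"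
    using D_mult[OF m(2) m'(2)] D_closed[OF m(2)] D_closed[OF m'(2)] by (auto simp: R.m_comm)
  have c: "?c \<in> carrier L"
    by (intro fr_closed st(1)) simp
  have xy: "?x \<in> carrier M" "?y \<in> carrier M"
    using m m' by auto
  have w: "?x \<ominus>\<^bsub>M\<^esub> ?y \<in> carrier M" "(?x \<ominus>\<^bsub>M\<^esub> ?y) \<oplus>\<^bsub>M\<^esub> ?y = ?x"
    using xy by (simp_all add: M.minus_eq M.a_assoc M.l_neg)
  have *: "pure m (fr \<one> s) = pure ?x ?c" "pure m' (fr \<one> t) = pure ?y ?c"
    using pure_clear[OF m m'(2)] pure_clear[OF m' m(2)] st(2) by simp_all
  have add: "pure (?x \<ominus>\<^bsub>M\<^esub> ?y) ?c \<oplus>\<^bsub>N\<^esub> pure ?y ?c = pure ?x ?c"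
    using pure_add[OF w(1) xy(2) c] w(2) by simp
  have "pure ?x ?c = pure ?y ?c \<longleftrightarrow> pure (?x \<ominus>\<^bsub>M\<^esub> ?y) ?c = Z"
    using A.r_cancel_one[of "pure ?y ?c" "pure (?x \<ominus>\<^bsub>M\<^esub> ?y) ?c"] add
      pure_carrier[OF xy(2) c] pure_carrier[OF w(1) c] by (simp add: N_zero)
  also have "\<dots> \<longleftrightarrow> (\<exists>u\<in>D. u \<odot>\<^bsub>M\<^esub> (?x \<ominus>\<^bsub>M\<^esub> ?y) = \<zero>\<^bsub>M\<^esub>)"
    by (rule pure_eq_zero_iff[OF w(1) st(1)])
  also have "\<dots> \<longleftrightarrow> (\<exists>u\<in>D. u \<odot>\<^bsub>M\<^esub> ?x = u \<odot>\<^bsub>M\<^esub> ?y)"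
  proof (rule bex_cong[OF refl])
    fix u assume u: "u \<in> D"
    have "u \<odot>\<^bsub>M\<^esub> (?x \<ominus>\<^bsub>M\<^esub> ?y) = u \<odot>\<^bsub>M\<^esub> ?x \<ominus>\<^bsub>M\<^esub> u \<odot>\<^bsub>M\<^esub> ?y"
      using xy D_closed[OF u] by (simp add: M.minus_eq smult_r_distr smult_r_minus)
    moreover have "v \<ominus>\<^bsub>M\<^esub> v' = \<zero>\<^bsub>M\<^esub> \<longleftrightarrow> v = v'" if "v \<in> carrier M" "v' \<in> carrier M" for v v'
      using that by (metis M.minus_eq M.minus_equality M.minus_minus M.a_inv_closed M.r_neg)
    ultimately show "u \<odot>\<^bsub>M\<^esub> (?x \<ominus>\<^bsub>M\<^esub> ?y) = \<zero>\<^bsub>M\<^esub> \<longleftrightarrow> u \<odot>\<^bsub>M\<^esub> ?x = u \<odot>\<^bsub>M\<^esub> ?y"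
      using xy D_closed[OF u] by simp
  qed
  finally show ?thesis
    unfolding * .
qed

definition contract :: "('c \<times> ('a \<times> 'a) set \<Rightarrow>\<^sub>0 int) set set \<Rightarrow> 'c set"
  where "contract V = {m \<in> carrier M. pure m (fr \<one> \<one>) \<in> V}"

definition extend :: "'c set \<Rightarrow> ('c \<times> ('a \<times> 'a) set \<Rightarrow>\<^sub>0 int) set set"
  where "extend W = {pure m (fr \<one> s) | m s. m \<in> W \<and> s \<in> D}"

lemma subN_carrier: "submodule V L N \<Longrightarrow> x \<in> V \<Longrightarrow> x \<in> carrier N"
  using subgroup.subset[OF submodule.axioms(1)] by fastforce

lemma subN_pure_iff:
  assumes V: "submodule V L N" and m: "m \<in> carrier M" "s \<in> D"
  shows "pure m (fr \<one> s) \<in> V \<longleftrightarrow> pure m (fr \<one> \<one>) \<in> V"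
proof
  assume "pure m (fr \<one> \<one>) \<in> V"
  then have "fr \<one> s \<odot>\<^bsub>N\<^esub> pure m (fr \<one> \<one>) \<in> V"
    by (intro submodule.smult_closed[OF V] fr_closed m(2)) simp_all
  then show "pure m (fr \<one> s) \<in> V"
    using pure_smult[OF R.one_closed m(2,1) D_one] m D_closed[OF m(2)] by simp
next
  assume "pure m (fr \<one> s) \<in> V"
  then have "fr s \<one> \<odot>\<^bsub>N\<^esub> pure m (fr \<one> s) \<in> V"
    by (intro submodule.smult_closed[OF V] fr_closed D_closed[OF m(2)] D_one)
  moreover have "fr s \<one> \<odot>\<^bsub>N\<^esub> pure m (fr \<one> s) = pure (s \<odot>\<^bsub>M\<^esub> m) (fr \<one> s)"
    using pure_smult[OF D_closed[OF m(2)] D_one m] D_closed[OF m(2)] by simp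
  moreover have "\<dots> = pure m (fr \<one> \<one>)"
    using pure_clear[OF m(1) D_one m(2)] D_closed[OF m(2)] by simp
  ultimately show "pure m (fr \<one> \<one>) \<in> V"
    by simp
qed

lemma subN_contract_iff:
  assumes "submodule V L N" and "m \<in> carrier M" "s \<in> D"
  shows "pure m (fr \<one> s) \<in> V \<longleftrightarrow> m \<in> contract V"
  using subN_pure_iff[OF assms] assms(2) by (simp add: contract_def)

lemma contract_sub:
  assumes V: "submodule V L N"
  shows "submodule (contract V) R M" and "sat P (contract V) = contract V"
proof -
  have sg: "subgroup V (add_monoid N)"
    by (rule submodule.axioms(1)[OF V])
  show sub: "submodule (contract V) R M"
  proof (rule submoduleI_smult)
    show "contract V \<subseteq> carrier M"
      by (auto simp: contract_def)
    show "\<zero>\<^bsub>M\<^esub> \<in> contract V"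
      using subgroup.one_closed[OF sg] pure_zero[OF one_in_L] by (simp add: contract_def N_zero)
  next
    fix x y assume xy: "x \<in> contract V" "y \<in> contract V"
    then have "pure x (fr \<one> \<one>) \<oplus>\<^bsub>N\<^esub> pure y (fr \<one> \<one>) \<in> V"
      using subgroup.m_closed[OF sg] by (simp add: contract_def)
    then show "x \<oplus>\<^bsub>M\<^esub> y \<in> contract V"
      using xy pure_add[OF _ _ one_in_L] by (simp add: contract_def)
  next
    fix a x assume a: "a \<in> carrier R" and x: "x \<in> contract V"
    then have xM: "x \<in> carrier M" and xV: "pure x (fr \<one> \<one>) \<in> V"
      by (auto simp: contract_def)
    have "fr a \<one> \<odot>\<^bsub>N\<^esub> pure x (fr \<one> \<one>) \<in> V"
      by (rule submodule.smult_closed[OF V fr_closed[OF a D_one] xV])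
    then show "a \<odot>\<^bsub>M\<^esub> x \<in> contract V"
      using pure_smult[OF a D_one xM D_one] a xM by (simp add: contract_def)
  qed
  have "sat P (contract V) \<subseteq> contract V"
  proof
    fix x assume "x \<in> sat P (contract V)"
    then obtain s where s: "x \<in> carrier M" "s \<in> carrier R" "s \<notin> P" "s \<odot>\<^bsub>M\<^esub> x \<in> contract V"
      by (rule satE)
    then have sD: "s \<in> D"
      by simp
    have "pure (s \<odot>\<^bsub>M\<^esub> x) (fr \<one> s) \<in> V"
      using subN_contract_iff[OF V smult_closed[OF s(2,1)] sD] s(4) by simp
    moreover have "pure (s \<odot>\<^bsub>M\<^esub> x) (fr \<one> s) = pure x (fr \<one> \<one>)"
      using pure_clear[OF s(1) D_one sD] s(2) by simp
    ultimately show "x \<in> contract V"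
      using s(1) by (simp add: contract_def)
  qed
  then show "sat P (contract V) = contract V"
    using sat_superset[OF sub prime] by blast
qed

text \<open>Equality of fractions only says that a multiple of m by an element outside P lies in W;
  saturation removes that multiplier.\<close>

lemma extend_iff:
  assumes W: "submodule W R M" "sat P W = W" and m: "m \<in> carrier M" "s \<in> D"
  shows "pure m (fr \<one> s) \<in> extend W \<longleftrightarrow> m \<in> W"
proof
  assume "pure m (fr \<one> s) \<in> extend W"
  then obtain m' t where m': "m' \<in> W" "t \<in> D" "pure m (fr \<one> s) = pure m' (fr \<one> t)"
    unfolding extend_def by blast
  have m'M: "m' \<in> carrier M"
    by (rule sub_carrier[OF W(1) m'(1)])
  obtain u where u: "u \<in> D" "u \<odot>\<^bsub>M\<^esub> (t \<odot>\<^bsub>M\<^esub> m) = u \<odot>\<^bsub>M\<^esub> (s \<odot>\<^bsub>M\<^esub> m')"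
    using m'(3) pure_eq_iff[OF m m'M m'(2)] by blast
  have "u \<odot>\<^bsub>M\<^esub> (t \<odot>\<^bsub>M\<^esub> m) \<in> W"
    unfolding u(2) by (intro sub_smult[OF W(1)] D_closed u(1) m(2) m'(1))
  moreover have "u \<odot>\<^bsub>M\<^esub> (t \<odot>\<^bsub>M\<^esub> m) = (u \<otimes> t) \<odot>\<^bsub>M\<^esub> m"
    using smult_assoc1[OF D_closed[OF u(1)] D_closed[OF m'(2)] m(1)] by simp
  ultimately have "m \<in> sat P W"
    using D_mult[OF u(1) m'(2)] m(1) by (intro satI[of _ "u \<otimes> t"]) auto
  then show "m \<in> W"
    using W(2) by simp
next
  assume "m \<in> W"
  then show "pure m (fr \<one> s) \<in> extend W"
    unfolding extend_def using m(2) by blast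
qed

lemma extend_sub:
  assumes W: "submodule W R M"
  shows "submodule (extend W) L N"
proof (intro submodule.intro submodule_axioms.intro)
  interpret A: comm_group "add_monoid N"
    by (rule N_add_group)
  show "subgroup (extend W) (add_monoid N)"
  proof (rule A.subgroupI)
    show "extend W \<subseteq> carrier (add_monoid N)"
      using sub_carrier[OF W] by (auto simp: extend_def intro!: pure_carrier fr_closed)
    show "extend W \<noteq> {}"
      using sub_zero[OF W] D_one unfolding extend_def by blast
  next
    fix x assume "x \<in> extend W"
    then obtain m s where m: "m \<in> W" "s \<in> D" "x = pure m (fr \<one> s)"
      unfolding extend_def by blast
    have mM: "m \<in> carrier M"
      by (rule sub_carrier[OF W m(1)])
    have c: "fr \<one> s \<in> carrier L"
      by (intro fr_closed m(2)) simp
    have "pure (\<ominus>\<^bsub>M\<^esub> m) (fr \<one> s) \<oplus>\<^bsub>N\<^esub> x = \<zero>\<^bsub>N\<^esub>"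
      unfolding m(3) N_zero using pure_add[OF _ mM c, of "\<ominus>\<^bsub>M\<^esub> m"] mM pure_zero[OF c] by (simp add: M.l_neg)
    then have "inv\<^bsub>add_monoid N\<^esub> x = pure (\<ominus>\<^bsub>M\<^esub> m) (fr \<one> s)"
      using mM c m(3) by (intro A.inv_equality) (simp_all add: pure_carrier)
    then show "inv\<^bsub>add_monoid N\<^esub> x \<in> extend W"
      unfolding extend_def using sub_neg[OF W m(1)] m(2) by auto
    fix y assume "y \<in> extend W"
    then obtain m' t where m': "m' \<in> W" "t \<in> D" "y = pure m' (fr \<one> t)"
      unfolding extend_def by blast
    have m'M: "m' \<in> carrier M"
      by (rule sub_carrier[OF W m'(1)])
    have st: "s \<otimes> t \<in> D" "t \<otimes> s = s \<otimes> t"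
      using D_mult[OF m(2) m'(2)] D_closed[OF m(2)] D_closed[OF m'(2)] by (auto simp: R.m_comm)
    have c': "fr \<one> (s \<otimes> t) \<in> carrier L"
      by (intro fr_closed st(1)) simp
    have "x = pure (t \<odot>\<^bsub>M\<^esub> m) (fr \<one> (s \<otimes> t))" "y = pure (s \<odot>\<^bsub>M\<^esub> m') (fr \<one> (s \<otimes> t))"
      using pure_clear[OF mM m(2) m'(2)] pure_clear[OF m'M m'(2) m(2)] st(2) m(3) m'(3) by simp_all
    then have "x \<oplus>\<^bsub>N\<^esub> y = pure (t \<odot>\<^bsub>M\<^esub> m \<oplus>\<^bsub>M\<^esub> s \<odot>\<^bsub>M\<^esub> m') (fr \<one> (s \<otimes> t))"
      using pure_add[OF _ _ c'] mM m'M D_closed[OF m(2)] D_closed[OF m'(2)] by simp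
    moreover have "t \<odot>\<^bsub>M\<^esub> m \<oplus>\<^bsub>M\<^esub> s \<odot>\<^bsub>M\<^esub> m' \<in> W"
      by (rule sub_add[OF W sub_smult[OF W D_closed[OF m'(2)] m(1)] sub_smult[OF W D_closed[OF m(2)] m'(1)]])
    ultimately show "x \<otimes>\<^bsub>add_monoid N\<^esub> y \<in> extend W"
      unfolding extend_def using st(1) by auto
  qed
  fix b x assume b: "b \<in> carrier L" and "x \<in> extend W"
  then obtain m s where m: "m \<in> W" "s \<in> D" "x = pure m (fr \<one> s)"
    unfolding extend_def by blast
  obtain a t where a: "a \<in> carrier R" "t \<in> D" "b = fr a t"
    using b by (rule L_cases)
  have "b \<odot>\<^bsub>N\<^esub> x = pure (a \<odot>\<^bsub>M\<^esub> m) (fr \<one> (t \<otimes> s))"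
    unfolding a(3) m(3) by (rule pure_smult[OF a(1,2) sub_carrier[OF W m(1)] m(2)])
  then show "b \<odot>\<^bsub>N\<^esub> x \<in> extend W"
    unfolding extend_def using sub_smult[OF W a(1) m(1)] D_mult[OF a(2) m(2)] by blast
qed

lemma submodule_restrict_iff:
  assumes V0: "submodule V0 L N"
  shows "submodule V L (N\<lparr>carrier := V0\<rparr>) \<longleftrightarrow> submodule V L N \<and> V \<subseteq> V0"
proof -
  interpret A: comm_group "add_monoid N"
    by (rule N_add_group)
  have eq: "add_monoid (N\<lparr>carrier := V0\<rparr>) = (add_monoid N)\<lparr>carrier := V0\<rparr>"
    by simp
  have sg0: "subgroup V0 (add_monoid N)"
    by (rule submodule.axioms(1)[OF V0])
  have "subgroup V ((add_monoid N)\<lparr>carrier := V0\<rparr>) \<longleftrightarrow> subgroup V (add_monoid N) \<and> V \<subseteq> V0"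
    using A.incl_subgroup[OF sg0, of V] A.subgroup_incl[OF _ sg0, of V]
      subgroup.subset[of V "(add_monoid N)\<lparr>carrier := V0\<rparr>"] by auto
  then show ?thesis
    unfolding submodule_def submodule_axioms_def eq by auto
qed

definition saturated_subs :: "'c set \<Rightarrow> 'c set set"
  where "saturated_subs W = {U. submodule U R M \<and> sat P U = U \<and> U \<subseteq> W}"

text \<open>Contraction and extension both keep inclusions strict, on all submodules and on
  saturated ones respectively, so chains can be transported in both directions.\<close>

lemma module_length_extend:
  assumes W: "submodule W R M" "sat P W = W"
  shows "module_length L (N\<lparr>carrier := extend W\<rparr>) = chain_length (saturated_subs W)"
proof -
  let ?\<V> = "{V. submodule V L N \<and> V \<subseteq> extend W}"
  have "has_chain ?\<V> n \<longleftrightarrow> has_chain (saturated_subs W) n" for n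
  proof
    assume "has_chain ?\<V> n"
    then show "has_chain (saturated_subs W) n"
    proof (rule has_chain_image[where f = contract])
      show "contract ` ?\<V> \<subseteq> saturated_subs W"
      proof
        fix U assume "U \<in> contract ` ?\<V>"
        then obtain V where V: "submodule V L N" "V \<subseteq> extend W" "U = contract V"
          by blast
        have "U \<subseteq> W"
          unfolding V(3) contract_def using V(2) extend_iff[OF W _ D_one] by blast
        then show "U \<in> saturated_subs W"
          unfolding saturated_subs_def V(3) using contract_sub[OF V(1)] by blast
      qed
      fix V V' assume V: "V \<in> ?\<V>" and V': "V' \<in> ?\<V>" and less: "V \<subset> V'"
      obtain x where x: "x \<in> V'" "x \<notin> V"
        using less by blast
      obtain m s where m: "m \<in> carrier M" "s \<in> D" "x = pure m (fr \<one> s)"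
        using subN_carrier[OF _ x(1)] V' N_cases by blast
      have "m \<in> contract V'" "m \<notin> contract V"
        using x subN_contract_iff[OF _ m(1,2)] V V' unfolding m(3) by blast+
      moreover have "contract V \<subseteq> contract V'"
        unfolding contract_def using less by blast
      ultimately show "contract V \<subset> contract V'"
        by blast
    qed
  next
    assume "has_chain (saturated_subs W) n"
    then show "has_chain ?\<V> n"
    proof (rule has_chain_image[where f = extend])
      show "extend ` saturated_subs W \<subseteq> ?\<V>"
      proof
        fix V assume "V \<in> extend ` saturated_subs W"
        then obtain U where U: "submodule U R M" "U \<subseteq> W" "V = extend U"
          unfolding saturated_subs_def by blast
        then show "V \<in> ?\<V>"
          using extend_sub[OF U(1)] unfolding extend_def by blast
      qed
      fix U U' assume U: "U \<in> saturated_subs W" and U': "U' \<in> saturated_subs W" and less: "U \<subset> U'"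
      obtain m where m: "m \<in> U'" "m \<notin> U"
        using less by blast
      have sU: "submodule U R M" "sat P U = U" and sU': "submodule U' R M" "sat P U' = U'"
        using U U' unfolding saturated_subs_def by blast+
      have mM: "m \<in> carrier M"
        by (rule sub_carrier[OF sU'(1) m(1)])
      have "pure m (fr \<one> \<one>) \<in> extend U'" "pure m (fr \<one> \<one>) \<notin> extend U"
        using m extend_iff[OF sU mM D_one] extend_iff[OF sU' mM D_one] by simp_all
      moreover have "extend U \<subseteq> extend U'"
        unfolding extend_def using less by blast
      ultimately show "extend U \<subset> extend U'"
        by blast
    qed
  qed
  then have "chain_length ?\<V> = chain_length (saturated_subs W)"
    by (rule chain_length_eqI)
  then show ?thesis
    unfolding module_length_eq submodule_restrict_iff[OF extend_sub[OF W(1)]] .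
qed

section \<open>Elements of finite length in the localization\<close>

lemma cyclic_submodule_pure:
  assumes m: "m \<in> carrier M" "s \<in> D"
  shows "cyclic_submodule L N (pure m (fr \<one> s)) = extend (sat P (adjoin {\<zero>\<^bsub>M\<^esub>} m))"
proof
  have adj: "submodule (adjoin {\<zero>\<^bsub>M\<^esub>} m) R M"
    by (rule adjoin_sub[OF zero_sub m(1)])
  show "cyclic_submodule L N (pure m (fr \<one> s)) \<subseteq> extend (sat P (adjoin {\<zero>\<^bsub>M\<^esub>} m))"
  proof
    fix x assume "x \<in> cyclic_submodule L N (pure m (fr \<one> s))"
    then obtain b where b: "b \<in> carrier L" "x = b \<odot>\<^bsub>N\<^esub> pure m (fr \<one> s)"
      unfolding cyclic_submodule_def by blast
    obtain a t where a: "a \<in> carrier R" "t \<in> D" "b = fr a t"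
      using b(1) by (rule L_cases)
    have "x = pure (a \<odot>\<^bsub>M\<^esub> m) (fr \<one> (t \<otimes> s))"
      unfolding b(2) a(3) by (rule pure_smult[OF a(1,2) m])
    moreover have "a \<odot>\<^bsub>M\<^esub> m \<in> sat P (adjoin {\<zero>\<^bsub>M\<^esub>} m)"
      using smult_in_adjoin[OF zero_sub m(1) a(1)] sat_superset[OF adj prime] by blast
    ultimately show "x \<in> extend (sat P (adjoin {\<zero>\<^bsub>M\<^esub>} m))"
      unfolding extend_def using D_mult[OF a(2) m(2)] by blast
  qed
  show "extend (sat P (adjoin {\<zero>\<^bsub>M\<^esub>} m)) \<subseteq> cyclic_submodule L N (pure m (fr \<one> s))"
  proof
    fix x assume "x \<in> extend (sat P (adjoin {\<zero>\<^bsub>M\<^esub>} m))"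
    then obtain m' t where m': "m' \<in> sat P (adjoin {\<zero>\<^bsub>M\<^esub>} m)" "t \<in> D" "x = pure m' (fr \<one> t)"
      unfolding extend_def by blast
    obtain u where u: "m' \<in> carrier M" "u \<in> carrier R" "u \<notin> P" "u \<odot>\<^bsub>M\<^esub> m' \<in> adjoin {\<zero>\<^bsub>M\<^esub>} m"
      using m'(1) by (rule satE)
    then have uD: "u \<in> D"
      by simp
    obtain a where a: "a \<in> carrier R" "u \<odot>\<^bsub>M\<^esub> m' = a \<odot>\<^bsub>M\<^esub> m"
      using u(4) unfolding adjoin_zero[OF m(1)] by blast
    have tu: "t \<otimes> u \<in> D"
      by (rule D_mult[OF m'(2) uD])
    have "x = pure (a \<odot>\<^bsub>M\<^esub> m) (fr \<one> (t \<otimes> u))"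
      unfolding m'(3) pure_clear[OF u(1) m'(2) uD] a(2) ..
    also have "\<dots> = pure (s \<odot>\<^bsub>M\<^esub> (a \<odot>\<^bsub>M\<^esub> m)) (fr \<one> ((t \<otimes> u) \<otimes> s))"
      by (rule pure_clear[OF smult_closed[OF a(1) m(1)] tu m(2)])
    also have "s \<odot>\<^bsub>M\<^esub> (a \<odot>\<^bsub>M\<^esub> m) = (s \<otimes> a) \<odot>\<^bsub>M\<^esub> m"
      using smult_assoc1[OF D_closed[OF m(2)] a(1) m(1)] by simp
    also have "pure ((s \<otimes> a) \<odot>\<^bsub>M\<^esub> m) (fr \<one> ((t \<otimes> u) \<otimes> s)) = fr (s \<otimes> a) (t \<otimes> u) \<odot>\<^bsub>N\<^esub> pure m (fr \<one> s)"
      using pure_smult[OF _ tu m, of "s \<otimes> a"] D_closed[OF m(2)] a(1) by simp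
    finally show "x \<in> cyclic_submodule L N (pure m (fr \<one> s))"
      unfolding cyclic_submodule_def using fr_closed[OF R.m_closed[OF D_closed[OF m(2)] a(1)] tu] by blast
  qed
qed

lemma saturated_subs_tors: "saturated_subs (tors P {\<zero>\<^bsub>M\<^esub>}) = sats P {\<zero>\<^bsub>M\<^esub>}"
  unfolding saturated_subs_def sats_def using sub_zero by blast

text \<open>If \<open>m\<close> generates a submodule of finite length and \<open>p\<close> lies in \<open>P\<close> but not in the smaller
  prime \<open>P1\<close>, the stabilization of the submodules generated by the powers \<open>p\<^sup>i m\<close> annihilates \<open>m\<close>
  at \<open>P1\<close>.\<close>

lemma finite_length_iff_tors:
  assumes m: "m \<in> carrier M"
  shows "chain_length (saturated_subs (sat P (adjoin {\<zero>\<^bsub>M\<^esub>} m))) \<noteq> \<infinity> \<longleftrightarrow> m \<in> tors P {\<zero>\<^bsub>M\<^esub>}"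
proof
  let ?W = "sat P (adjoin {\<zero>\<^bsub>M\<^esub>} m)"
  assume mt: "m \<in> tors P {\<zero>\<^bsub>M\<^esub>}"
  \<comment> \<open>The span of m stays in \<open>tors P\<close> of the zero submodule, whose
    saturated submodules have bounded chains.\<close>
  have "adjoin {\<zero>\<^bsub>M\<^esub>} m \<subseteq> tors P {\<zero>\<^bsub>M\<^esub>}"
    using tors_sub[OF zero_sub] mt by (intro adjoin_least) (auto intro: sub_zero)
  then have "?W \<subseteq> tors P {\<zero>\<^bsub>M\<^esub>}"
    using sat_mono[of "adjoin {\<zero>\<^bsub>M\<^esub>} m" "tors P {\<zero>\<^bsub>M\<^esub>}" P] sat_tors[OF prime zero_sub] by simp
  then have "saturated_subs ?W \<subseteq> sats P {\<zero>\<^bsub>M\<^esub>}"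
    unfolding saturated_subs_tors[symmetric] by (auto simp: saturated_subs_def)
  then have "n \<le> loc_length P {\<zero>\<^bsub>M\<^esub>}" if "has_chain (saturated_subs ?W) n" for n
    using has_chain_subset[OF that] has_chain_sats_iff[OF zero_sub prime] by blast
  then show "chain_length (saturated_subs ?W) \<noteq> \<infinity>"
    unfolding chain_length_finite_iff by blast
next
  let ?W = "sat P (adjoin {\<zero>\<^bsub>M\<^esub>} m)"
  assume "chain_length (saturated_subs ?W) \<noteq> \<infinity>"
  then obtain b where b: "\<And>n. has_chain (saturated_subs ?W) n \<Longrightarrow> n \<le> b"
    unfolding chain_length_finite_iff by blast
  have "m \<in> sat P1 {\<zero>\<^bsub>M\<^esub>}" if P1: "primeideal P1 R" "P1 \<subset> P" for P1
  proof -
    obtain p where p: "p \<in> P" "p \<notin> P1"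
      using P1(2) by blast
    have pR: "p \<in> carrier R"
      by (rule prime_subset[OF prime p(1)])
    define z where "z i = (p [^] (i::nat)) \<odot>\<^bsub>M\<^esub> m" for i
    have z: "z i \<in> carrier M" for i
      using pR m by (simp add: z_def)
    have z_Suc: "z (Suc i) = p \<odot>\<^bsub>M\<^esub> z i" for i
      using pR m by (simp add: z_def smult_assoc1[symmetric] R.m_comm)
    have adj: "submodule (adjoin {\<zero>\<^bsub>M\<^esub>} (z i)) R M" for i
      by (rule adjoin_sub[OF zero_sub z])
    have adj_le: "adjoin {\<zero>\<^bsub>M\<^esub>} y \<subseteq> V" if "submodule V R M" "y \<in> V" for y V
      using that sub_zero by (intro adjoin_least) auto
    have adj_m: "submodule (adjoin {\<zero>\<^bsub>M\<^esub>} m) R M"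
      by (rule adjoin_sub[OF zero_sub m])
    have "\<exists>n. \<forall>i\<ge>n. sat P (adjoin {\<zero>\<^bsub>M\<^esub>} (z i)) = sat P (adjoin {\<zero>\<^bsub>M\<^esub>} (z n))"
    proof (rule decreasing_stabilizes[where S = "saturated_subs ?W", OF b])
      show "sat P (adjoin {\<zero>\<^bsub>M\<^esub>} (z i)) \<in> saturated_subs ?W" for i
      proof -
        have "z i \<in> adjoin {\<zero>\<^bsub>M\<^esub>} m"
          unfolding z_def using pR by (intro smult_in_adjoin[OF zero_sub m]) simp
        then have "sat P (adjoin {\<zero>\<^bsub>M\<^esub>} (z i)) \<subseteq> ?W"
          by (intro sat_mono adj_le[OF adj_m])
        then show ?thesis
          unfolding saturated_subs_def using sat_sub[OF adj prime] sat_idem[OF prime adj] by blast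
      qed
      show "sat P (adjoin {\<zero>\<^bsub>M\<^esub>} (z (Suc i))) \<subseteq> sat P (adjoin {\<zero>\<^bsub>M\<^esub>} (z i))" for i
        unfolding z_Suc by (intro sat_mono adj_le[OF adj] smult_in_adjoin[OF zero_sub z pR])
    qed
    then obtain n where n: "\<forall>i\<ge>n. sat P (adjoin {\<zero>\<^bsub>M\<^esub>} (z i)) = sat P (adjoin {\<zero>\<^bsub>M\<^esub>} (z n))"
      by blast
    have "z n \<in> sat P (adjoin {\<zero>\<^bsub>M\<^esub>} (z n))"
      using sat_superset[OF adj prime] adjoin_superset(2)[OF zero_sub z] by blast
    then have "z n \<in> sat P (adjoin {\<zero>\<^bsub>M\<^esub>} (z (Suc n)))"
      using n le_SucI by blast
    then obtain s where s: "s \<in> carrier R" "s \<notin> P" "s \<odot>\<^bsub>M\<^esub> z n \<in> adjoin {\<zero>\<^bsub>M\<^esub>} (z (Suc n))"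
      by (rule satE)
    then obtain a where a: "a \<in> carrier R" "s \<odot>\<^bsub>M\<^esub> z n = a \<odot>\<^bsub>M\<^esub> z (Suc n)"
      unfolding adjoin_zero[OF z] by blast
    have ap: "a \<otimes> p \<in> P" "a \<otimes> p \<in> carrier R"
      using prime_mult_in[OF prime p(1) a(1)] a(1) pR by auto
    \<comment> \<open>From s z = a p z for z = \<open>z n\<close>, with s outside P and a p in P,
      the difference s - a p lies outside P, hence outside P1, and kills z. Since p^n is also
      outside P1, their product kills m at P1.\<close>
    let ?u = "s \<ominus> a \<otimes> p"
    have uR: "?u \<in> carrier R"
      using s(1) ap(2) by simp
    have "?u \<notin> P"
    proof
      assume "?u \<in> P"
      then have "?u \<oplus> a \<otimes> p \<in> P"
        using ap(1) additive_subgroup.a_closed[OF ideal.axioms(1)[OF primeideal.axioms(1)[OF prime]]] by blast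
      moreover have "?u \<oplus> a \<otimes> p = s"
        using s(1) ap(2) by (simp add: R.minus_eq R.a_assoc R.l_neg)
      ultimately show False
        using s(2) by simp
    qed
    then have uP1: "?u \<notin> P1"
      using P1(2) by blast
    have pn: "p [^] n \<notin> P1"
    proof (induction n)
      case 0
      then show ?case
        using prime_one[OF P1(1)] by simp
    next
      case (Suc n)
      then show ?case
        using prime_mult_notin[OF P1(1), of "p [^] n" p] p(2) pR by simp
    qed
    have "?u \<odot>\<^bsub>M\<^esub> z n = s \<odot>\<^bsub>M\<^esub> z n \<ominus>\<^bsub>M\<^esub> a \<odot>\<^bsub>M\<^esub> (p \<odot>\<^bsub>M\<^esub> z n)"
      using s(1) ap(2) z a(1) pR
      by (simp add: R.minus_eq M.minus_eq smult_l_distr smult_l_minus smult_assoc1)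
    also have "\<dots> = \<zero>\<^bsub>M\<^esub>"
      unfolding a(2) z_Suc using a(1) pR z by (simp add: M.minus_eq M.r_neg)
    finally have "(?u \<otimes> p [^] n) \<odot>\<^bsub>M\<^esub> m = \<zero>\<^bsub>M\<^esub>"
      using uR pR m by (simp add: z_def smult_assoc1)
    then show ?thesis
      using prime_mult_notin[OF P1(1), of ?u "p [^] n"] uP1 pn uR pR m
      by (intro satI[of _ "?u \<otimes> p [^] n"]) auto
  qed
  then show "m \<in> tors P {\<zero>\<^bsub>M\<^esub>}"
    using m by (simp add: tors_def)
qed

lemma finite_length_part_eq: "finite_length_part L N = extend (tors P {\<zero>\<^bsub>M\<^esub>})"
proof -
  have W: "submodule (sat P (adjoin {\<zero>\<^bsub>M\<^esub>} m)) R M"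
      "sat P (sat P (adjoin {\<zero>\<^bsub>M\<^esub>} m)) = sat P (adjoin {\<zero>\<^bsub>M\<^esub>} m)" if "m \<in> carrier M" for m
    using sat_sub[OF adjoin_sub[OF zero_sub that] prime] sat_idem[OF prime adjoin_sub[OF zero_sub that]] .
  have *: "module_length L (N\<lparr>carrier := cyclic_submodule L N (pure m (fr \<one> s))\<rparr>) \<noteq> \<infinity> \<longleftrightarrow>
      m \<in> tors P {\<zero>\<^bsub>M\<^esub>}" if "m \<in> carrier M" "s \<in> D" for m s
    unfolding cyclic_submodule_pure[OF that] module_length_extend[OF W[OF that(1)]]
    by (rule finite_length_iff_tors[OF that(1)])
  show ?thesis
  proof
    show "finite_length_part L N \<subseteq> extend (tors P {\<zero>\<^bsub>M\<^esub>})"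
    proof
      fix x assume x: "x \<in> finite_length_part L N"
      then have "x \<in> carrier N"
        by (simp add: finite_length_part_def)
      then obtain m s where m: "m \<in> carrier M" "s \<in> D" "x = pure m (fr \<one> s)"
        by (rule N_cases)
      have "m \<in> tors P {\<zero>\<^bsub>M\<^esub>}"
        using x *[OF m(1,2)] unfolding m(3) finite_length_part_def by blast
      then show "x \<in> extend (tors P {\<zero>\<^bsub>M\<^esub>})"
        unfolding extend_def m(3) using m(2) by blast
    qed
    show "extend (tors P {\<zero>\<^bsub>M\<^esub>}) \<subseteq> finite_length_part L N"
    proof
      fix x assume "x \<in> extend (tors P {\<zero>\<^bsub>M\<^esub>})"
      then obtain m s where m: "m \<in> tors P {\<zero>\<^bsub>M\<^esub>}" "s \<in> D" "x = pure m (fr \<one> s)"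
        unfolding extend_def by blast
      have mM: "m \<in> carrier M"
        using m(1) tors_carrier by blast
      have "fr \<one> s \<in> carrier L"
        by (intro fr_closed m(2)) simp
      then have "x \<in> carrier N"
        unfolding m(3) by (rule pure_carrier[OF mM])
      then show "x \<in> finite_length_part L N"
        unfolding finite_length_part_def using *[OF mM m(2)] m(1) unfolding m(3) by blast
    qed
  qed
qed

lemma local_length_eq: "local_length R M P = loc_length P {\<zero>\<^bsub>M\<^esub>}"
  unfolding local_length_def Let_def finite_length_part_eq
    module_length_extend[OF tors_sub[OF zero_sub] sat_tors[OF prime zero_sub]]
    saturated_subs_tors loc_length_def ..

end

section \<open>Identification of the rank of the zero submodule with the reduced length\<close>

lemma (in noetherian_mod) length_at_eq_weight:
  "(length_at R M \<alpha> :: nat) = weight {\<zero>\<^bsub>M\<^esub>} \<alpha>"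
proof -
  have local_length: "local_length R M P = loc_length P {\<zero>\<^bsub>M\<^esub>}" if "conoetherian_prime R P" for P
  proof -
    have "prime_localization R M P"
      by (intro prime_localization.intro prime_localization_axioms.intro noetherian_mod_axioms
          conoetherian_prime_prime[OF that])
    then show ?thesis
      by (rule prime_localization.local_length_eq)
  qed
  have "{P. conoetherian_prime R P \<and> coheight R P = \<alpha> \<and> local_length R M P \<noteq> 0} =
      {P. conoetherian_prime R P \<and> coheight R P = \<alpha> \<and> loc_length P {\<zero>\<^bsub>M\<^esub>} \<noteq> 0}"
    by (intro Collect_cong conj_cong refl) (simp only: local_length)
  then show ?thesis
    unfolding length_at_def weight_def by (rule sum.cong) (simp only: mem_Collect_eq local_length)
qed

lemma (in noetherian_mod) reduced_length_eq_rank: "reduced_length R M = submodule_rank {\<zero>\<^bsub>M\<^esub>}"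
  by (simp add: reduced_length_def submodule_rank_def cantor_sum_def length_at_eq_weight)

theorem theorem12:
  fixes A :: "('a, 'r) ring_scheme" and M :: "('a, 'm, 'e) module_scheme"
  assumes "cring A" and "Module.module A M" and "noetherian_module A M"
    and "\<And>K N. submodule K A M \<Longrightarrow> submodule N A M \<Longrightarrow> K \<subseteq> N \<Longrightarrow>
      artinian_module A (quotient_module (M\<lparr>carrier := N\<rparr>) K) \<Longrightarrow>
      finite (carrier (quotient_module (M\<lparr>carrier := N\<rparr>) K))"
  shows "module_CB_rank A M = Some (reduced_length A M)"
proof -
  interpret noetherian_mod A M
    using assms(2,3) by (intro noetherian_mod.intro noetherian_mod_axioms.intro)
  show ?thesis
    unfolding reduced_length_eq_rank by (rule module_CB_rank_eq[OF assms(4)])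
qed

end
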